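(* Let $(K,v,\sigma)$ be a multiplicative valued difference field of characteristic zero that is spherically complete. Assume that its difference residue field $(\mathbf{k},\bar\sigma)$ is an ACFA of characteristic zero, that the scaling exponent $\rho>0$ of $\sigma$ is transcendental over $\mathbb{Q}$, and that the valuation has a splitting $\gamma\mapsto t^\gamma$ compatible with $\sigma$. Let the difference value group $\Gamma$ of $K$ be a subgroup of $\mathbb{R}$ which is a $\mathbb{Q}(\rho)$-module. Suppose $f\in K_\sigma[x_1^{\pm1},\dots,x_n^{\pm1}]$ is a Laurent difference polynomial. Then the following sets coincide: (1) $\mathrm{trop}(V(f))\subseteq\mathbb{R}^n$, the difference tropical hypersurface associated to $f$; (2) the set of all points $w\in\mathbb{R}^n$ for which the initial form $\mathrm{in}_w(f)$ is not a monomial; (3) the topological closure in $\mathbb{R}^n$ of the set $A=\{(v(y_1),\dots,v(y_n)) : (y_1,\dots,y_n)\in V(f)\}$.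
   Context: A difference field is a field together with a field automorphism $\sigma$. An ACFA is a difference field $(k,\sigma)$ such that every finite system of difference polynomial equations over $k$ having a solution in some difference field extension of $k$ has a solution in $k$. A valued difference field is a valued field $K$ with an automorphism $\sigma$ such that $\sigma(\mathcal{O}_K)=\mathcal{O}_K$, where $\mathcal{O}_K$ is the valuation ring. Then $\sigma$ induces an automorphism $\bar\sigma$, $\bar\sigma(\bar a)=\overline{\sigma(a)}$, on the residue field $\mathbf{k}$, and an automorphism $\sigma_\Gamma$, $v(a)\mapsto v(\sigma(a))$, on the value group $\Gamma$; with these automorphisms they are called the difference residue field and the difference value group. $K$ is multiplicative with scaling exponent $\rho$ (a positive real) if $v(\sigma(x))=\rho\cdot v(x)$ for all $x\in K^\times$ (here $\Gamma\subseteq\mathbb{R}$ is closed under multiplication by $\rho$). $K$ is spherically complete if every family of balls in $K$ totally ordered by inclusion has nonempty intersection. A splitting compatible with $\sigma$ is a group homomorphism $\Gamma\to K^\times$, $\gamma\mapsto t^\gamma$, with $v(t^\gamma)=\gamma$ and $\sigma(t^\gamma)=t^{\rho\gamma}$ for all $\gamma\in\Gamma$. $K_\sigma[x_1^{\pm1},\dots,x_n^{\pm1}]$ is the Laurent polynomial ring over $K$ in the formal variables $\sigma^j(x_i)$, $j\ge 0$, $1\le i\le n$ (with $\sigma^0(x_i)=x_i$). For $u(\sigma)=(u_1(\sigma),\dots,u_n(\sigma))\in(\mathbb{Z}[\sigma])^n$ with $u_i(\sigma)=\sum_j a_{i,j}\sigma^j$, write $x^{u(\sigma)}=\prod_{i,j}\sigma^j(x_i)^{a_{i,j}}$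 and $u(\rho)=(\sum_j a_{i,j}\rho^j)_{i}\in\mathbb{R}^n$. Every $f$ is a finite sum $f=\sum_{u(\sigma)} c_{u(\sigma)}x^{u(\sigma)}$, and it is evaluated at $y\in(K^* )^n$ by substituting $\sigma^j(y_i)$ for $\sigma^j(x_i)$. $V(f)=\{y\in(K^* )^n : f(y)=0\}$. The same notation is used over $(\mathbf{k},\bar\sigma)$. A monomial is a single term $c\,x^{u(\sigma)}$. For $w\in\mathbb{R}^n$, $\mathrm{trop}(f)(w)=\min_{u(\sigma)}\bigl(v(c_{u(\sigma)})+u(\rho)\cdot w\bigr)$, the minimum running over the exponents $u(\sigma)$ appearing in $f$ and $\cdot$ being the standard scalar product. $\mathrm{trop}(V(f))$ is the set of $w\in\mathbb{R}^n$ for which this minimum is attained at least twice, i.e. for at least two distinct exponents $u(\sigma)$. The initial form is $$\mathrm{in}_w(f)=\sum_{u(\sigma):\ v(c_{u(\sigma)})+u(\rho)\cdot w=\mathrm{trop}(f)(w)}\overline{c_{u(\sigma)}t^{-v(c_{u(\sigma)})}}\;x^{u(\bar\sigma)}\in\mathbf{k}_{\bar\sigma}[x_1^{\pm1},\dots,x_n^{\pm1}],$$ the sum running over exponents appearing in $f$.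
   Formalization: The value group Γ is assumed to be nontrivial: for the trivial valuation the scaling exponent is undetermined and the claim fails, e.g. for f = x1 + x2, where trop(V(f)) is the line w1 = w2 but A = {0}. *)

theory Defs
  imports
    "HOL-Analysis.Analysis"
    "HOL-Library.Poly_Mapping"
    "HOL-Computational_Algebra.Polynomial"
    "HOL-Algebra.Algebraic_Closure_Type"
begin

section \<open>Difference fields and ACFA\<close>

definition field_automorphism :: "('a::field \<Rightarrow> 'a) \<Rightarrow> bool" where
  "field_automorphism \<sigma> \<longleftrightarrow> bij \<sigma> \<and> \<sigma> 1 = 1 \<and>
     (\<forall>x y. \<sigma> (x + y) = \<sigma> x + \<sigma> y) \<and> (\<forall>x y. \<sigma> (x * y) = \<sigma> x * \<sigma> y)"

text \<open>
  Difference polynomials over a field type \<open>'k\<close>, in variables indexed by \<open>nat\<close>: the pair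
  \<open>(i, j)\<close> stands for the formal variable \<open>\<sigma>\<^sup>j(x\<^sub>i)\<close>, and the exponents are natural numbers.
\<close>

type_synonym 'k diff_poly = "(nat \<times> nat \<Rightarrow>\<^sub>0 nat) \<Rightarrow>\<^sub>0 'k"

text \<open>
  \<open>(L, \<tau>, \<iota>)\<close>, with \<open>\<iota>\<close> the embedding, is a difference field extension of \<open>('k, \<sigma>)\<close>. The field \<open>L\<close>
  is given by an explicit carrier so that one can quantify over it; \<open>\<iota>\<close> is automatically injective.
\<close>

definition difference_field_extension ::
    "('k::field \<Rightarrow> 'k) \<Rightarrow> 'l ring \<Rightarrow> ('l \<Rightarrow> 'l) \<Rightarrow> ('k \<Rightarrow> 'l) \<Rightarrow> bool" where
  "difference_field_extension \<sigma> L \<tau> \<iota> \<longleftrightarrow>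
     Ring.field L \<and> \<tau> \<in> ring_iso L L \<and> \<iota> \<in> ring_hom ring_of_type_algebra L \<and>
     (\<forall>c. \<iota> (\<sigma> c) = \<tau> (\<iota> c))"

definition diff_poly_eval ::
    "'l ring \<Rightarrow> ('l \<Rightarrow> 'l) \<Rightarrow> ('k::zero \<Rightarrow> 'l) \<Rightarrow> 'k diff_poly \<Rightarrow> (nat \<Rightarrow> 'l) \<Rightarrow> 'l" where
  "diff_poly_eval L \<tau> \<iota> p a =
     finsum L (\<lambda>m. \<iota> (Poly_Mapping.lookup p m) \<otimes>\<^bsub>L\<^esub>
         finprod L (\<lambda>(i, j). (\<tau> ^^ j) (a i) [^]\<^bsub>L\<^esub> Poly_Mapping.lookup m (i, j))
           (Poly_Mapping.keys m))
       (Poly_Mapping.keys p)"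

definition has_solution ::
    "'l ring \<Rightarrow> ('l \<Rightarrow> 'l) \<Rightarrow> ('k::zero \<Rightarrow> 'l) \<Rightarrow> 'k diff_poly set \<Rightarrow> bool" where
  "has_solution L \<tau> \<iota> P \<longleftrightarrow>
     (\<exists>a. (\<forall>i. a i \<in> carrier L) \<and> (\<forall>p\<in>P. diff_poly_eval L \<tau> \<iota> p a = \<zero>\<^bsub>L\<^esub>))"

text \<open>
  HOL cannot quantify over all types inside a formula, so the extensions range over the difference
  fields whose carrier is a subset of \<open>'k list\<close>. This loses nothing: inside an arbitrary
  extension, the difference subfield generated by the image of \<open>'k\<close> and the finitely many
  relevant coordinates of a solution has at most \<open>max |'k| \<aleph>\<^sub>0 = |'k list|\<close> elements, so it is
  isomorphic over \<open>'k\<close> to a difference field of this form.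
\<close>

definition ACFA :: "('k::field \<Rightarrow> 'k) \<Rightarrow> bool" where
  "ACFA \<sigma> \<longleftrightarrow> field_automorphism \<sigma> \<and>
     (\<forall>P :: 'k diff_poly set. finite P \<longrightarrow>
        (\<exists>(L :: 'k list ring) \<tau> \<iota>. difference_field_extension \<sigma> L \<tau> \<iota> \<and> has_solution L \<tau> \<iota> P) \<longrightarrow>
        has_solution ring_of_type_algebra \<sigma> id P)"


section \<open>Valued difference fields\<close>

text \<open>
  A valuation is a function \<open>v\<close> to the reals of which only the values at nonzero elements are
  used; the convention \<open>v(0) = \<infinity>\<close> is built into the definitions below.
\<close>

definition valuation :: "('a::field \<Rightarrow> real) \<Rightarrow> bool" where
  "valuation v \<longleftrightarrow>
     (\<forall>x y. x \<noteq> 0 \<longrightarrow> y \<noteq> 0 \<longrightarrow> v (x * y) = v x + v y) \<and>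
     (\<forall>x y. x \<noteq> 0 \<longrightarrow> y \<noteq> 0 \<longrightarrow> x + y \<noteq> 0 \<longrightarrow> min (v x) (v y) \<le> v (x + y))"

definition value_group :: "('a::field \<Rightarrow> real) \<Rightarrow> real set" where
  "value_group v = v ` {x. x \<noteq> 0}"

definition valuation_ring :: "('a::field \<Rightarrow> real) \<Rightarrow> 'a set" where
  "valuation_ring v = {x. x = 0 \<or> 0 \<le> v x}"

definition valuation_ideal :: "('a::field \<Rightarrow> real) \<Rightarrow> 'a set" where
  "valuation_ideal v = {x. x = 0 \<or> 0 < v x}"

definition valued_difference_field :: "('a::field \<Rightarrow> real) \<Rightarrow> ('a \<Rightarrow> 'a) \<Rightarrow> bool" where
  "valued_difference_field v \<sigma> \<longleftrightarrow>
     valuation v \<and> field_automorphism \<sigma> \<and> \<sigma> ` valuation_ring v = valuation_ring v"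

definition scaling_exponent :: "('a::field \<Rightarrow> real) \<Rightarrow> ('a \<Rightarrow> 'a) \<Rightarrow> real \<Rightarrow> bool" where
  "scaling_exponent v \<sigma> \<rho> \<longleftrightarrow> 0 < \<rho> \<and> (\<forall>x. x \<noteq> 0 \<longrightarrow> v (\<sigma> x) = \<rho> * v x)"

text \<open>
  \<open>('k, \<sigma>k)\<close>, together with the residue map \<open>res\<close>, is the difference residue field: \<open>res\<close>
  restricted to the valuation ring is a surjective ring homomorphism whose kernel is the maximal
  ideal, which identifies \<open>'k\<close> with the quotient, and \<open>\<sigma>k\<close> is the automorphism induced by \<open>\<sigma>\<close>.
  The values of \<open>res\<close> outside the valuation ring are irrelevant.
\<close>

definition difference_residue_field ::
    "('a::field \<Rightarrow> real) \<Rightarrow> ('a \<Rightarrow> 'a) \<Rightarrow> ('a \<Rightarrow> 'k::field) \<Rightarrow> ('k \<Rightarrow> 'k) \<Rightarrow> bool" where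
  "difference_residue_field v \<sigma> res \<sigma>k \<longleftrightarrow>
     res ` valuation_ring v = UNIV \<and> res 1 = 1 \<and>
     (\<forall>a\<in>valuation_ring v. \<forall>b\<in>valuation_ring v.
        res (a + b) = res a + res b \<and> res (a * b) = res a * res b) \<and>
     {a \<in> valuation_ring v. res a = 0} = valuation_ideal v \<and>
     (\<forall>a\<in>valuation_ring v. \<sigma>k (res a) = res (\<sigma> a))"

definition valuation_ball :: "('a::field \<Rightarrow> real) \<Rightarrow> 'a set \<Rightarrow> bool" where
  "valuation_ball v B \<longleftrightarrow> (\<exists>a. \<exists>\<gamma>\<in>value_group v.
     B = {x. x = a \<or> \<gamma> \<le> v (x - a)} \<or> B = {x. x = a \<or> \<gamma> < v (x - a)})"

definition spherically_complete :: "('a::field \<Rightarrow> real) \<Rightarrow> bool" where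
  "spherically_complete v \<longleftrightarrow>
     (\<forall>\<B>. (\<forall>B\<in>\<B>. valuation_ball v B) \<longrightarrow> (\<forall>B\<in>\<B>. \<forall>C\<in>\<B>. B \<subseteq> C \<or> C \<subseteq> B) \<longrightarrow> \<Inter>\<B> \<noteq> {})"

text \<open>The splitting \<open>\<gamma> \<mapsto> t\<^sup>\<gamma>\<close> is a function \<open>t\<close> of which only the values on the value group are used.\<close>

definition compatible_splitting ::
    "('a::field \<Rightarrow> real) \<Rightarrow> ('a \<Rightarrow> 'a) \<Rightarrow> real \<Rightarrow> (real \<Rightarrow> 'a) \<Rightarrow> bool" where
  "compatible_splitting v \<sigma> \<rho> t \<longleftrightarrow>
     (\<forall>\<gamma>\<in>value_group v. t \<gamma> \<noteq> 0 \<and> v (t \<gamma>) = \<gamma> \<and> \<sigma> (t \<gamma>) = t (\<rho> * \<gamma>)) \<and>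
     (\<forall>\<gamma>\<in>value_group v. \<forall>\<delta>\<in>value_group v. t (\<gamma> + \<delta>) = t \<gamma> * t \<delta>)"

definition rational_function_field :: "real \<Rightarrow> real set" where
  "rational_function_field \<rho> =
     {poly (map_poly of_rat p) \<rho> / poly (map_poly of_rat q) \<rho> | p q. poly (map_poly of_rat q) \<rho> \<noteq> 0}"


section \<open>Laurent difference polynomials\<close>

text \<open>
  Exponents are vectors \<open>u \<in> \<int>[\<sigma>]\<^sup>n\<close>, represented as vectors of integer polynomials in one
  variable \<open>\<sigma>\<close>. A Laurent difference polynomial is a finitely supported family of coefficients
  indexed by exponents; its keys are the exponents appearing in it.
\<close>

type_synonym ('a, 'n) laurent_diff_poly = "(int poly ^ 'n) \<Rightarrow>\<^sub>0 'a"

definition exponent_at :: "real \<Rightarrow> int poly ^ 'n \<Rightarrow> real ^ 'n" where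
  "exponent_at \<rho> u = (\<chi> i. poly (map_poly of_int (u $ i)) \<rho>)"

definition monomial_eval :: "('a::field \<Rightarrow> 'a) \<Rightarrow> int poly ^ 'n \<Rightarrow> 'a ^ 'n \<Rightarrow> 'a" where
  "monomial_eval \<sigma> u y =
     (\<Prod>i\<in>UNIV. \<Prod>j\<le>Polynomial.degree (u $ i). (\<sigma> ^^ j) (y $ i) powi poly.coeff (u $ i) j)"

definition laurent_eval ::
    "('a::field \<Rightarrow> 'a) \<Rightarrow> ('a, 'n) laurent_diff_poly \<Rightarrow> 'a ^ 'n \<Rightarrow> 'a" where
  "laurent_eval \<sigma> f y =
     (\<Sum>u\<in>Poly_Mapping.keys f. Poly_Mapping.lookup f u * monomial_eval \<sigma> u y)"

definition zero_set ::
    "('a::field \<Rightarrow> 'a) \<Rightarrow> ('a, 'n) laurent_diff_poly \<Rightarrow> ('a ^ 'n) set" where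
  "zero_set \<sigma> f = {y. (\<forall>i. y $ i \<noteq> 0) \<and> laurent_eval \<sigma> f y = 0}"

definition is_monomial :: "('a::zero, 'n) laurent_diff_poly \<Rightarrow> bool" where
  "is_monomial g \<longleftrightarrow> (\<exists>c u. c \<noteq> 0 \<and> g = Poly_Mapping.single u c)"


section \<open>Tropicalization\<close>

definition trop_term ::
    "('a::field \<Rightarrow> real) \<Rightarrow> real \<Rightarrow> ('a, 'n) laurent_diff_poly \<Rightarrow> real ^ 'n \<Rightarrow>
      int poly ^ 'n \<Rightarrow> real" where
  "trop_term v \<rho> f w u = v (Poly_Mapping.lookup f u) + exponent_at \<rho> u \<bullet> w"

text \<open>Meaningful only for \<open>f \<noteq> 0\<close>.\<close>

definition trop ::
    "('a::field \<Rightarrow> real) \<Rightarrow> real \<Rightarrow> ('a, 'n) laurent_diff_poly \<Rightarrow> real ^ 'n \<Rightarrow> real" where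
  "trop v \<rho> f w = Min (trop_term v \<rho> f w ` Poly_Mapping.keys f)"

text \<open>
  For \<open>f = 0\<close> the minimum is taken over the empty set. The usual convention is that it is then
  \<open>\<infinity>\<close> and every point belongs to the tropical hypersurface.
\<close>

definition trop_hypersurface ::
    "('a::field \<Rightarrow> real) \<Rightarrow> real \<Rightarrow> ('a, 'n) laurent_diff_poly \<Rightarrow> (real ^ 'n) set" where
  "trop_hypersurface v \<rho> f = {w. f = 0 \<or>
     (\<exists>u\<in>Poly_Mapping.keys f. \<exists>u'\<in>Poly_Mapping.keys f. u \<noteq> u' \<and>
        trop_term v \<rho> f w u = trop v \<rho> f w \<and> trop_term v \<rho> f w u' = trop v \<rho> f w)}"

definition initial_form ::
    "('a::field \<Rightarrow> real) \<Rightarrow> real \<Rightarrow> (real \<Rightarrow> 'a) \<Rightarrow> ('a \<Rightarrow> 'k::field) \<Rightarrow>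
      ('a, 'n) laurent_diff_poly \<Rightarrow> real ^ 'n \<Rightarrow> ('k, 'n) laurent_diff_poly" where
  "initial_form v \<rho> t res f w =
     (\<Sum>u | u \<in> Poly_Mapping.keys f \<and> trop_term v \<rho> f w u = trop v \<rho> f w.
        Poly_Mapping.single u
          (res (Poly_Mapping.lookup f u * t (- v (Poly_Mapping.lookup f u)))))"

end

(*
  Only the inclusion of trop(V(f)) in the closure is hard. Points of the hypersurface with coordinates in
  the value group are dense in it, because all ties between terms are linear relations over Q(rho) modulo
  the value group. For such a point w, substituting y_i = t^(w_i) sigma^(m_i)(s) turns f(y) = 0 into
  an integral equation in one unknown unit s that has at least two unit coefficients. It is solved by a Newton
  iteration: an approximate root a is corrected by an h whose valuation makes the constant
  Taylor coefficient at a tie with another one, and the residue of h/t^v(h) is a nonzero root of a difference polynomial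
  with at least two terms. The balls of the possible corrections shrink, and spherical
  completeness lets the iteration pass to limits.

  That a difference polynomial with at least two terms has a nonzero root in an ACFA is shown by
  building a difference field extension inside an algebraic closure: a generic zero of the polynomial defines an
  isomorphism between two subfields, which extends to an automorphism by Zorn's lemma.
*)
theory Submission
  imports Defs
begin

hide_const (open) up_ring.coeff up_ring.monom module.smult Polynomials.degree Polynomials.lead_coeff

text \<open>All algebra takes place in subrings of one fixed algebraically closed field, with graphs
  of isomorphisms in place of maps. Subrings avoid denominators, at the price of pseudo-division,
  and graphs turn every statement about domains into one about ranges by taking converses. Two
  features of \<open>ACFA\<close> shape the use of the extension: a solution supplied for a single
  equation may be zero, so the equation \<open>x_0 * x_1 = 1\<close> is added; and extensions must
  have their carrier in \<open>'k list\<close>, so the automorphism is restricted to a small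
  subfield that is coded by lists. In the Newton iteration no derivative needs to dominate: terms of
  all orders compete, with weights \<open>ev I\<close>, and the largest slope governs the
  correction. After countably many steps the slopes may still be bounded, so a sequence of
  corrections need not lead to a root; a maximal chain of balls replaces the transfinite iteration.
  The exponents \<open>m_i\<close> of the substitution are spread so far apart that distinct
  exponents of \<open>f\<close> stay distinct in the single unknown, which preserves the two unit
  coefficients.\<close>

definition is_subring :: "'a::field set \<Rightarrow> bool" where
  "is_subring A \<longleftrightarrow> 1 \<in> A \<and> (\<forall>x\<in>A. \<forall>y\<in>A. x - y \<in> A \<and> x * y \<in> A)"

lemma is_subringD:
  assumes "is_subring A"
  shows "1 \<in> A" "0 \<in> A" "x \<in> A \<Longrightarrow> y \<in> A \<Longrightarrow> x - y \<in> A" "x \<in> A \<Longrightarrow> y \<in> A \<Longrightarrow> x * y \<in> A"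
    "x \<in> A \<Longrightarrow> - x \<in> A" "x \<in> A \<Longrightarrow> y \<in> A \<Longrightarrow> x + y \<in> A"
proof -
  show 1: "1 \<in> A" and d: "\<And>x y. x \<in> A \<Longrightarrow> y \<in> A \<Longrightarrow> x - y \<in> A"
    and "x \<in> A \<Longrightarrow> y \<in> A \<Longrightarrow> x * y \<in> A"
    using assms by (auto simp: is_subring_def)
  show 0: "0 \<in> A" using d[OF 1 1] by simp
  show m: "\<And>x. x \<in> A \<Longrightarrow> - x \<in> A" using d[OF 0] by simp
  show "x \<in> A \<Longrightarrow> y \<in> A \<Longrightarrow> x + y \<in> A" using d[of x "- y"] m[of y] by simp
qed

lemma is_subring_sum: "is_subring A \<Longrightarrow> (\<And>i. i \<in> I \<Longrightarrow> f i \<in> A) \<Longrightarrow> sum f I \<in> A"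
  by (induction I rule: infinite_finite_induct) (auto intro: is_subringD)

lemma is_subring_prod: "is_subring A \<Longrightarrow> (\<And>i. i \<in> I \<Longrightarrow> f i \<in> A) \<Longrightarrow> prod f I \<in> A"
  by (induction I rule: infinite_finite_induct) (auto intro: is_subringD)

lemma is_subring_power: "is_subring A \<Longrightarrow> x \<in> A \<Longrightarrow> x ^ n \<in> A"
  by (induction n) (auto intro: is_subringD)

section \<open>Algebraicity over subrings of a field\<close>

definition poly_over :: "'a::field set \<Rightarrow> 'a poly \<Rightarrow> bool" where
  "poly_over A p \<longleftrightarrow> (\<forall>i. coeff p i \<in> A)"

text \<open>For a subring \<open>A\<close> this is algebraicity over the fraction field of
  \<open>A\<close>, since denominators can be cleared; nothing is required of the leading
  coefficient.\<close>

definition alg_over :: "'a::field set \<Rightarrow> 'a \<Rightarrow> bool" where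
  "alg_over A x \<longleftrightarrow> (\<exists>p. p \<noteq> 0 \<and> poly_over A p \<and> poly p x = 0)"

lemma alg_over_mono: "alg_over A x \<Longrightarrow> A \<subseteq> B \<Longrightarrow> alg_over B x"
  unfolding alg_over_def poly_over_def by blast

definition adjoin_to :: "'a::field set \<Rightarrow> 'a \<Rightarrow> 'a set" where
  "adjoin_to A x = {poly p x | p. poly_over A p}"

definition ring_gen :: "'a::field set \<Rightarrow> 'a set" where
  "ring_gen S = \<Inter>{A. is_subring A \<and> S \<subseteq> A}"

text \<open>Such a subring is automatically a subfield, since \<open>inverse u\<close> is a root of
  \<open>u X - 1\<close>.\<close>

definition alg_closed_in :: "'a::field set \<Rightarrow> bool" where
  "alg_closed_in A \<longleftrightarrow> is_subring A \<and> (\<forall>x. alg_over A x \<longrightarrow> x \<in> A)"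

text \<open>Defined from above as the least relatively algebraically closed subring, so that its
  closedness follows from monotonicity of \<open>alg_over\<close> and transitivity of algebraicity
  is bypassed.\<close>

definition acl :: "'a::field set \<Rightarrow> 'a set" where
  "acl S = \<Inter>{A. alg_closed_in A \<and> S \<subseteq> A}"

lemma is_subring_Inter: "(\<And>A. A \<in> \<A> \<Longrightarrow> is_subring A) \<Longrightarrow> is_subring (\<Inter>\<A>)"
  by (auto simp: is_subring_def)

lemma ring_gen_subring: "is_subring (ring_gen S)"
  unfolding ring_gen_def by (rule is_subring_Inter) auto

lemma ring_gen_superset: "S \<subseteq> ring_gen S" unfolding ring_gen_def by auto

lemma ring_gen_least: "is_subring A \<Longrightarrow> S \<subseteq> A \<Longrightarrow> ring_gen S \<subseteq> A" unfolding ring_gen_def by auto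

lemma ring_gen_mono: "S \<subseteq> T \<Longrightarrow> ring_gen S \<subseteq> ring_gen T"
  by (meson ring_gen_least ring_gen_subring ring_gen_superset subset_trans)

lemma acl_alg_closed_in: "alg_closed_in (acl S)"
proof -
  have "is_subring (acl S)"
    unfolding acl_def by (rule is_subring_Inter) (auto simp: alg_closed_in_def)
  moreover have "x \<in> acl S" if "alg_over (acl S) x" for x
  proof -
    have "x \<in> A" if "alg_closed_in A" "S \<subseteq> A" for A
    proof -
      have "acl S \<subseteq> A" using that by (auto simp: acl_def)
      with \<open>alg_over (acl S) x\<close> have "alg_over A x" by (rule alg_over_mono)
      with that show ?thesis by (auto simp: alg_closed_in_def)
    qed
    then show ?thesis by (auto simp: acl_def)
  qed
  ultimately show ?thesis by (auto simp: alg_closed_in_def)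
qed

lemma acl_superset: "S \<subseteq> acl S" unfolding acl_def by auto

lemma acl_least: "alg_closed_in A \<Longrightarrow> S \<subseteq> A \<Longrightarrow> acl S \<subseteq> A" unfolding acl_def by auto

lemma poly_over_basic:
  assumes "is_subring A"
  shows "poly_over A 0" "poly_over A 1" "poly_over A p \<Longrightarrow> poly_over A q \<Longrightarrow> poly_over A (p - q)"
    "poly_over A p \<Longrightarrow> poly_over A q \<Longrightarrow> poly_over A (p * q)"
    "poly_over A p \<Longrightarrow> poly_over A q \<Longrightarrow> poly_over A (p + q)"
    "c \<in> A \<Longrightarrow> poly_over A [:c:]"
    "c \<in> A \<Longrightarrow> poly_over A (monom c n)"
    "c \<in> A \<Longrightarrow> poly_over A p \<Longrightarrow> poly_over A (pCons c p)"
    "c \<in> A \<Longrightarrow> poly_over A p \<Longrightarrow> poly_over A (smult c p)"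
  using is_subringD[OF assms]
  by (auto simp: poly_over_def coeff_pCons coeff_mult intro!: is_subring_sum[OF assms] split: nat.splits)

lemma poly_over_sum: "is_subring A \<Longrightarrow> (\<And>i. i \<in> I \<Longrightarrow> poly_over A (f i)) \<Longrightarrow> poly_over A (sum f I)"
  by (induction I rule: infinite_finite_induct) (auto intro: poly_over_basic)

lemma poly_in_subring: "is_subring A \<Longrightarrow> poly_over A p \<Longrightarrow> x \<in> A \<Longrightarrow> poly p x \<in> A"
  unfolding poly_altdef poly_over_def
  by (intro is_subring_sum is_subringD(4) is_subring_power) auto

lemma adjoin_to_subring:
  assumes A: "is_subring A"
  shows "is_subring (adjoin_to A x)"
  unfolding is_subring_def
proof (intro conjI ballI)
  show "1 \<in> adjoin_to A x" using poly_over_basic(2)[OF A] unfolding adjoin_to_def by (auto intro!: exI[of _ 1])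
  fix y z assume "y \<in> adjoin_to A x" "z \<in> adjoin_to A x"
  then obtain p q where "y = poly p x" "z = poly q x" "poly_over A p" "poly_over A q"
    by (auto simp: adjoin_to_def)
  then have "y - z = poly (p - q) x \<and> poly_over A (p - q)" "y * z = poly (p * q) x \<and> poly_over A (p * q)"
    using poly_over_basic(3,4)[OF A, of p q] by auto
  then show "y - z \<in> adjoin_to A x" "y * z \<in> adjoin_to A x"
    unfolding adjoin_to_def by blast+
qed

lemma adjoin_to_superset: "is_subring A \<Longrightarrow> A \<subseteq> adjoin_to A x"
  unfolding adjoin_to_def by (auto intro!: exI[of _ "[:_:]"] poly_over_basic)

lemma adjoin_to_self: "is_subring A \<Longrightarrow> x \<in> adjoin_to A x"
  unfolding adjoin_to_def
  by (auto intro!: exI[of _ "[:0,1:]"] poly_over_basic is_subringD)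

lemma ring_gen_insert: "ring_gen (insert x S) = adjoin_to (ring_gen S) x"
proof
  show "ring_gen (insert x S) \<subseteq> adjoin_to (ring_gen S) x"
    using adjoin_to_subring[OF ring_gen_subring, of S] adjoin_to_superset[OF ring_gen_subring, of S x]
      adjoin_to_self[OF ring_gen_subring, of x S] ring_gen_superset[of S]
    by (intro ring_gen_least) auto
  have 1: "poly_over (ring_gen (insert x S)) p" if "poly_over (ring_gen S) p" for p
    using that ring_gen_mono[of S "insert x S"] by (auto simp: poly_over_def)
  have 2: "x \<in> ring_gen (insert x S)" using ring_gen_superset[of "insert x S"] by simp
  show "adjoin_to (ring_gen S) x \<subseteq> ring_gen (insert x S)"
  proof
    fix y assume "y \<in> adjoin_to (ring_gen S) x"
    then obtain p where p: "y = poly p x" "poly_over (ring_gen S) p" by (auto simp: adjoin_to_def)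
    show "y \<in> ring_gen (insert x S)" unfolding p(1) by (rule poly_in_subring[OF ring_gen_subring 1[OF p(2)] 2])
  qed
qed

text \<open>Steinitz exchange: a polynomial relation between \<open>x\<close> and \<open>b\<close>
  over \<open>A\<close> is read as a polynomial in \<open>x\<close> instead of in \<open>b\<close>.
  It stays nonzero after inserting \<open>b\<close>, because some coefficient \<open>g i\<close> is
  a nonzero polynomial over \<open>A\<close> and \<open>b\<close> is not algebraic over
  \<open>A\<close>.\<close>

lemma algebraic_exchange:
  assumes A: "is_subring A" and b: "alg_over (adjoin_to A x) b" and nb: "\<not> alg_over A b"
  shows "alg_over (adjoin_to A b) x"
proof -
  obtain F where F: "F \<noteq> 0" "poly_over (adjoin_to A x) F" "poly F b = 0"
    using b by (auto simp: alg_over_def)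
  then have "\<forall>j. \<exists>p. poly_over A p \<and> coeff F j = poly p x"
    by (force simp: poly_over_def adjoin_to_def)
  then obtain f where f: "\<And>j. poly_over A (f j)" "\<And>j. coeff F j = poly (f j) x" by metis
  define D where "D = Max ((\<lambda>j. degree (f j)) ` {..degree F})"
  have D: "degree (f j) \<le> D" if "j \<le> degree F" for j
    unfolding D_def using that by (intro Max_ge) auto
  \<comment> \<open>\<open>g i\<close> collects the coefficient of the \<open>i\<close>-th power of
    \<open>x\<close>, as a polynomial in the other variable.\<close>
  define g where "g i = (\<Sum>j\<le>degree F. monom (coeff (f j) i) j)" for i
  have g: "poly_over A (g i)" for i
    unfolding g_def using f(1) by (intro poly_over_sum[OF A] poly_over_basic[OF A]) (auto simp: poly_over_def)
  define H where "H = (\<Sum>i\<le>D. monom (poly (g i) b) i)"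
  have "poly H x = (\<Sum>i\<le>D. (\<Sum>j\<le>degree F. coeff (f j) i * b ^ j) * x ^ i)"
    by (simp add: H_def g_def poly_sum poly_monom)
  also have "\<dots> = (\<Sum>j\<le>degree F. (\<Sum>i\<le>D. coeff (f j) i * x ^ i) * b ^ j)"
    by (simp add: sum_distrib_right sum_distrib_left, subst sum.swap) (simp add: mult_ac)
  also have "\<dots> = (\<Sum>j\<le>degree F. coeff F j * b ^ j)"
  proof (intro sum.cong refl)
    fix j assume "j \<in> {..degree F}"
    then have "(\<Sum>i\<le>D. coeff (f j) i * x ^ i) = poly (f j) x"
      unfolding poly_altdef using D[of j] by (intro sum.mono_neutral_right) (auto simp: coeff_eq_0)
    then show "(\<Sum>i\<le>D. coeff (f j) i * x ^ i) * b ^ j = coeff F j * b ^ j" by (simp add: f(2))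
  qed
  also have "\<dots> = 0" using F(3) by (simp add: poly_altdef)
  finally have H0: "poly H x = 0" .
  have "coeff F (degree F) \<noteq> 0" using F(1) by simp
  then have "f (degree F) \<noteq> 0" using f(2)[of "degree F"] by auto
  then have lc: "coeff (f (degree F)) (degree (f (degree F))) \<noteq> 0" (is "coeff _ ?i \<noteq> 0") by simp
  have "coeff (g ?i) (degree F) \<noteq> 0"
    using lc by (simp add: g_def coeff_sum)
  then have "g ?i \<noteq> 0" by auto
  then have "poly (g ?i) b \<noteq> 0" using nb g by (auto simp: alg_over_def)
  moreover have "coeff H ?i = poly (g ?i) b" using D[of "degree F"] by (simp add: H_def coeff_sum)
  ultimately have "H \<noteq> 0" by auto
  moreover have "poly_over (adjoin_to A b) H"
    unfolding H_def
    by (intro poly_over_sum poly_over_basic adjoin_to_subring A) (use g in \<open>auto simp: adjoin_to_def\<close>)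
  ultimately show ?thesis using H0 by (auto simp: alg_over_def)
qed

section \<open>Partial isomorphisms\<close>

text \<open>Graphs of isomorphisms between two subrings of a field.\<close>

definition partial_iso :: "('a::field \<times> 'a) set \<Rightarrow> bool" where
  "partial_iso G \<longleftrightarrow> (1, 1) \<in> G \<and>
    (\<forall>x y x' y'. (x, y) \<in> G \<longrightarrow> (x', y') \<in> G \<longrightarrow> (x - x', y - y') \<in> G \<and> (x * x', y * y') \<in> G) \<and>
    (\<forall>x y. (x, y) \<in> G \<longrightarrow> (x = 0 \<longleftrightarrow> y = 0))"

lemma partial_isoD:
  assumes "partial_iso G"
  shows "(1, 1) \<in> G" "(0, 0) \<in> G"
    "(x, y) \<in> G \<Longrightarrow> (x', y') \<in> G \<Longrightarrow> (x - x', y - y') \<in> G"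
    "(x, y) \<in> G \<Longrightarrow> (x', y') \<in> G \<Longrightarrow> (x * x', y * y') \<in> G"
    "(x, y) \<in> G \<Longrightarrow> (x', y') \<in> G \<Longrightarrow> (x + x', y + y') \<in> G"
    "(x, y) \<in> G \<Longrightarrow> x = 0 \<longleftrightarrow> y = 0"
proof -
  have d: "\<And>x y x' y'. (x, y) \<in> G \<Longrightarrow> (x', y') \<in> G \<Longrightarrow> (x - x', y - y') \<in> G"
    using assms by (auto simp: partial_iso_def)
  show 1: "(1, 1) \<in> G" "(x, y) \<in> G \<Longrightarrow> (x', y') \<in> G \<Longrightarrow> (x - x', y - y') \<in> G"
    "(x, y) \<in> G \<Longrightarrow> (x', y') \<in> G \<Longrightarrow> (x * x', y * y') \<in> G"
    "(x, y) \<in> G \<Longrightarrow> x = 0 \<longleftrightarrow> y = 0"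
    using assms unfolding partial_iso_def by blast+
  show 0: "(0, 0) \<in> G" using d[OF 1(1) 1(1)] by simp
  assume *: "(x, y) \<in> G" "(x', y') \<in> G"
  show "(x + x', y + y') \<in> G" using d[OF *(1) d[OF 0 *(2)]] by simp
qed

text \<open>Zero is related only to zero; applied to differences, this makes the relation functional
  and injective.\<close>

lemma partial_iso_unique:
  assumes "partial_iso G" "(x, y) \<in> G" "(x', y') \<in> G"
  shows "x = x' \<longleftrightarrow> y = y'"
  using partial_isoD(6)[OF assms(1) partial_isoD(3)[OF assms]] by simp

lemma partial_iso_converse: "partial_iso G \<Longrightarrow> partial_iso (G\<inverse>)"
  unfolding partial_iso_def by blast

lemma partial_iso_subring:
  assumes "partial_iso G"
  shows "is_subring (Domain G)" "is_subring (Range G)"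
proof -
  show "is_subring (Domain G)"
    unfolding is_subring_def using partial_isoD(1,3,4)[OF assms] by (auto simp: Domain.simps) metis+
  show "is_subring (Range G)"
    unfolding is_subring_def using partial_isoD(1,3,4)[OF assms] by (auto simp: Range.simps) metis+
qed

lemma partial_iso_sum:
  "partial_iso G \<Longrightarrow> (\<And>i. i \<in> I \<Longrightarrow> (f i, g i) \<in> G) \<Longrightarrow> (sum f I, sum g I) \<in> G"
  by (induction I rule: infinite_finite_induct) (auto intro: partial_isoD(1-5))

lemma partial_iso_power: "partial_iso G \<Longrightarrow> (x, y) \<in> G \<Longrightarrow> (x ^ n, y ^ n) \<in> G"
  by (induction n) (auto intro: partial_isoD(1-5))

text \<open>\<open>q\<close> is the image of \<open>p\<close> under the isomorphism, kept as a
  relation so that passing to the converse merely exchanges the two polynomials.\<close>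

definition pair_poly :: "('a::field \<times> 'a) set \<Rightarrow> 'a poly \<Rightarrow> 'a poly \<Rightarrow> bool" where
  "pair_poly G p q \<longleftrightarrow> (\<forall>i. (coeff p i, coeff q i) \<in> G)"

lemma pair_poly_basic:
  assumes "partial_iso G"
  shows "pair_poly G 0 0" "pair_poly G p q \<Longrightarrow> pair_poly G p' q' \<Longrightarrow> pair_poly G (p - p') (q - q')"
    "pair_poly G p q \<Longrightarrow> pair_poly G p' q' \<Longrightarrow> pair_poly G (p * p') (q * q')"
    "pair_poly G p q \<Longrightarrow> pair_poly G p' q' \<Longrightarrow> pair_poly G (p + p') (q + q')"
    "(c, c') \<in> G \<Longrightarrow> pair_poly G [:c:] [:c':]"
    "(c, c') \<in> G \<Longrightarrow> pair_poly G (monom c n) (monom c' n)"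
    "(c, c') \<in> G \<Longrightarrow> pair_poly G p q \<Longrightarrow> pair_poly G (pCons c p) (pCons c' q)"
    "(c, c') \<in> G \<Longrightarrow> pair_poly G p q \<Longrightarrow> pair_poly G (smult c p) (smult c' q)"
  using partial_isoD(1-5)[OF assms]
  by (auto simp: pair_poly_def coeff_pCons coeff_mult intro!: partial_iso_sum[OF assms] split: nat.splits)

lemma pair_poly_eq_0:
  assumes "partial_iso G" "pair_poly G p q"
  shows "p = 0 \<longleftrightarrow> q = 0"
  using partial_isoD(6)[OF assms(1)] assms(2) unfolding pair_poly_def poly_eq_iff by auto

lemma pair_poly_degree:
  assumes "partial_iso G" "pair_poly G p q"
  shows "degree p = degree q"
proof -
  have "coeff p i = 0 \<longleftrightarrow> coeff q i = 0" for i
    using assms(2) by (intro partial_isoD(6)[OF assms(1)]) (auto simp: pair_poly_def)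
  then show ?thesis by (simp add: Polynomial.degree_def)
qed

lemma pair_poly_value:
  assumes "partial_iso G" "pair_poly G p q" "(x, y) \<in> G"
  shows "(poly p x, poly q y) \<in> G"
  unfolding poly_altdef pair_poly_degree[OF assms(1,2)]
  using assms by (intro partial_iso_sum partial_isoD(4) partial_iso_power) (auto simp: pair_poly_def)

lemma pair_poly_Domain: "poly_over (Domain G) p \<Longrightarrow> partial_iso G \<Longrightarrow> \<exists>q. pair_poly G p q"
proof -
  assume "poly_over (Domain G) p" and G: "partial_iso G"
  then have "\<forall>i. \<exists>y. (coeff p i, y) \<in> G" by (auto simp: poly_over_def)
  then obtain h where h: "\<And>i. (coeff p i, h i) \<in> G" by metis
  \<comment> \<open>Zero coefficients are sent to zero, so \<open>h\<close> has finite
    support.\<close>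
  have "h i = 0" if "i > degree p" for i
    using h[of i] that partial_isoD(6)[OF G] by (auto simp: coeff_eq_0)
  then have "coeff (Abs_poly h) = h"
    by (intro coeff_Abs_poly) 
  then show ?thesis using h by (auto simp: pair_poly_def intro!: exI[of _ "Abs_poly h"])
qed

text \<open>Coefficients lie in a ring, so \<open>q\<close> is first multiplied by a power of the
  leading coefficient of \<open>p\<close>. Dividing in parallel on both sides keeps quotients and
  remainders related by \<open>G\<close>.\<close>

lemma pair_poly_pseudo_div:
  assumes G: "partial_iso G" and p: "pair_poly G p p'" "p \<noteq> 0"
  shows "pair_poly G q q' \<Longrightarrow> \<exists>c c' s s' u u'. (c, c') \<in> G \<and> c \<noteq> 0 \<and> pair_poly G s s' \<and> pair_poly G u u' \<and>
     smult c q = s * p + u \<and> smult c' q' = s' * p' + u' \<and> (u = 0 \<or> degree u < degree p)"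
proof (induction "degree q" arbitrary: q q' rule: less_induct)
  case less
  note B = pair_poly_basic[OF G]
  show ?case
  proof (cases "q = 0 \<or> degree q < degree p")
    case True
    show ?thesis
      by (rule exI[of _ 1], rule exI[of _ 1], rule exI[of _ 0], rule exI[of _ 0],
          rule exI[of _ q], rule exI[of _ q'], intro conjI)
        (use True partial_isoD(1)[OF G] B(1) less.prems in simp_all)
  next
    case False
    define l l' where "l = lead_coeff p" and "l' = lead_coeff p'"
    define n where "n = degree q - degree p"
    define m m' where "m = monom (lead_coeff q) n" and "m' = monom (lead_coeff q') n"
    have dp: "degree p = degree p'" and dq: "degree q = degree q'"
      using pair_poly_degree[OF G] p less.prems by auto
    have l: "(l, l') \<in> G" "l \<noteq> 0" using p by (auto simp: l_def l'_def pair_poly_def dp[symmetric])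
    have m: "pair_poly G m m'"
      unfolding m_def m'_def by (rule B(6)) (use less.prems in \<open>auto simp: pair_poly_def dq[symmetric]\<close>)
    \<comment> \<open>The leading terms of the two summands agree, which lowers the degree without
      any division.\<close>
    define r r' where "r = smult l q - m * p" and "r' = smult l' q' - m' * p'"
    have r: "pair_poly G r r'" unfolding r_def r'_def by (rule B(2)[OF B(8)[OF l(1) less.prems] B(3)[OF m p(1)]])
    have "coeff r i = 0" if "i \<ge> degree q" for i
    proof (cases "i = degree q")
      case True
      have "coeff (m * p) i = lead_coeff q * lead_coeff p"
        unfolding m_def coeff_monom_mult using False True by (auto simp: n_def)
      then show ?thesis by (simp add: r_def True l_def)
    next
      case neq: False
      have "degree (m * p) \<le> degree q"
        using degree_mult_le[of m p] degree_monom_le[of "lead_coeff q" n] False by (auto simp: n_def m_def)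
      then have "coeff (m * p) i = 0" using neq that by (intro coeff_eq_0) auto
      then show ?thesis using neq that by (simp add: r_def coeff_eq_0)
    qed
    then have dr: "r = 0 \<or> degree r < degree q"
      by (metis leading_coeff_0_iff not_le)
    show ?thesis
    proof (cases "r = 0")
      case True
      then have "r' = 0" using pair_poly_eq_0[OF G r] by simp
      show ?thesis
        by (rule exI[of _ l], rule exI[of _ l'], rule exI[of _ m], rule exI[of _ m'],
            rule exI[of _ 0], rule exI[of _ 0], intro conjI)
          (use l m B(1) True \<open>r' = 0\<close> in \<open>simp_all add: r_def r'_def\<close>)
    next
      case False
      with dr have "degree r < degree q" by simp
      from less.hyps[OF this r] obtain c c' s s' u u' where
        *: "(c, c') \<in> G" "c \<noteq> 0" "pair_poly G s s'" "pair_poly G u u'"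
         "smult c r = s * p + u" "smult c' r' = s' * p' + u'" "u = 0 \<or> degree u < degree p"
        by blast
      have "smult (c * l) q = (s + smult c m) * p + u" "smult (c' * l') q' = (s' + smult c' m') * p' + u'"
        using *(5,6) unfolding r_def r'_def by (auto simp: algebra_simps smult_diff_right)
      moreover have "pair_poly G (s + smult c m) (s' + smult c' m')"
        by (rule B(4)[OF *(3) B(8)[OF *(1) m]])
      moreover have "(c * l, c' * l') \<in> G" using partial_isoD(4)[OF G *(1) l(1)] .
      ultimately show ?thesis using *(2,4,7) l(2)
        by (intro exI[of _ "c * l"] exI[of _ "c' * l'"] exI[of _ "s + smult c m"]
              exI[of _ "s' + smult c' m'"] exI[of _ u] exI[of _ u'] conjI) simp_all
    qed
  qed
qed

definition adjoin_pair :: "('a::field \<times> 'a) set \<Rightarrow> 'a \<Rightarrow> 'a \<Rightarrow> ('a \<times> 'a) set" where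
  "adjoin_pair G x y = {(poly p x, poly q y) | p q. pair_poly G p q}"

lemma adjoin_pair_superset:
  assumes "partial_iso G"
  shows "G \<subseteq> adjoin_pair G x y"
proof (rule subrelI)
  fix a b assume "(a, b) \<in> G"
  then have "(a, b) = (poly [:a:] x, poly [:b:] y) \<and> pair_poly G [:a:] [:b:]"
    using pair_poly_basic(5)[OF assms] by simp
  then show "(a, b) \<in> adjoin_pair G x y" unfolding adjoin_pair_def by blast
qed

lemma adjoin_pair_self:
  assumes "partial_iso G"
  shows "(x, y) \<in> adjoin_pair G x y"
proof -
  have "(x, y) = (poly [:0, 1:] x, poly [:0, 1:] y) \<and> pair_poly G [:0, 1:] [:0, 1:]"
    using pair_poly_basic(5,7)[OF assms] partial_isoD(1,2)[OF assms] by simp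
  then show ?thesis unfolding adjoin_pair_def by blast
qed

text \<open>An element of the extension is the value of many polynomials; the condition on zeros,
  applied to differences, is what makes the assignment well defined and injective.\<close>

lemma adjoin_pair_partial_iso:
  assumes G: "partial_iso G"
    and *: "\<And>p q. pair_poly G p q \<Longrightarrow> poly p x = 0 \<longleftrightarrow> poly q y = 0"
  shows "partial_iso (adjoin_pair G x y)"
  unfolding partial_iso_def
proof (intro conjI allI impI)
  show "(1, 1) \<in> adjoin_pair G x y" using adjoin_pair_superset[OF G] partial_isoD(1)[OF G] by blast
  fix a b a' b' assume "(a, b) \<in> adjoin_pair G x y"
  then obtain p q where pq: "a = poly p x" "b = poly q y" "pair_poly G p q" by (auto simp: adjoin_pair_def)
  show "a = 0 \<longleftrightarrow> b = 0" using pq * by simp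
  assume "(a', b') \<in> adjoin_pair G x y"
  then obtain p' q' where pq': "a' = poly p' x" "b' = poly q' y" "pair_poly G p' q'" by (auto simp: adjoin_pair_def)
  have "(a - a', b - b') = (poly (p - p') x, poly (q - q') y) \<and> pair_poly G (p - p') (q - q')"
    "(a * a', b * b') = (poly (p * p') x, poly (q * q') y) \<and> pair_poly G (p * p') (q * q')"
    using pq pq' pair_poly_basic(2,3)[OF G pq(3) pq'(3)] by auto
  then show "(a - a', b - b') \<in> adjoin_pair G x y" "(a * a', b * b') \<in> adjoin_pair G x y"
    unfolding adjoin_pair_def by blast+
qed

lemma pair_poly_over: "pair_poly G p q \<Longrightarrow> poly_over (Domain G) p \<and> poly_over (Range G) q"
  by (auto simp: pair_poly_def poly_over_def)

lemma partial_iso_extend_transcendental: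
  assumes G: "partial_iso G" and "\<not> alg_over (Domain G) x" "\<not> alg_over (Range G) y"
  shows "partial_iso (adjoin_pair G x y)"
proof (rule adjoin_pair_partial_iso[OF G])
  fix p q assume pq: "pair_poly G p q"
  show "poly p x = 0 \<longleftrightarrow> poly q y = 0"
    using assms pair_poly_over[OF pq] pair_poly_eq_0[OF G pq] by (auto simp: alg_over_def)
qed

text \<open>A minimal polynomial over the fraction field of \<open>Domain G\<close> with
  denominators cleared; it is not normalised, hence not unique.\<close>

definition min_pair :: "('a::field \<times> 'a) set \<Rightarrow> 'a \<Rightarrow> 'a poly \<Rightarrow> bool" where
  "min_pair G x p \<longleftrightarrow> p \<noteq> 0 \<and> poly_over (Domain G) p \<and> poly p x = 0 \<and>
     (\<forall>q. q \<noteq> 0 \<longrightarrow> poly_over (Domain G) q \<longrightarrow> poly q x = 0 \<longrightarrow> degree p \<le> degree q)"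

text \<open>Pseudo-division of \<open>q\<close> by \<open>p\<close> leaves a remainder that vanishes
  at \<open>x\<close>, hence is zero by minimality. The resulting divisibility is transported to the
  other side.\<close>

lemma min_pair_root:
  assumes G: "partial_iso G" and p: "min_pair G x p" "pair_poly G p p'" "poly p' y = 0"
    and q: "pair_poly G q q'" "poly q x = 0"
  shows "poly q' y = 0"
proof -
  have p0: "p \<noteq> 0" "poly p x = 0" using p(1) by (auto simp: min_pair_def)
  obtain c c' s s' u u' where *: "(c, c') \<in> G" "c \<noteq> 0" "pair_poly G s s'" "pair_poly G u u'"
     "smult c q = s * p + u" "smult c' q' = s' * p' + u'" "u = 0 \<or> degree u < degree p"
    using pair_poly_pseudo_div[OF G p(2) p0(1) q(1)] by blast
  have "poly u x = 0" using arg_cong[OF *(5), of "\<lambda>p. poly p x"] q(2) p0 by simp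
  then have "u = 0" using *(4,7) p(1) pair_poly_over[OF *(4)] unfolding min_pair_def by force
  then have "u' = 0" using pair_poly_eq_0[OF G *(4)] by simp
  moreover have "c' \<noteq> 0" using partial_isoD(6)[OF G *(1)] *(2) by simp
  ultimately show ?thesis using arg_cong[OF *(6), of "\<lambda>p. poly p y"] p(3) by simp
qed

lemma min_pair_exists:
  assumes "alg_over (Domain G) x"
  shows "\<exists>p. min_pair G x p"
proof -
  obtain p where "p \<noteq> 0 \<and> poly_over (Domain G) p \<and> poly p x = 0"
    using assms by (auto simp: alg_over_def)
  from ex_has_least_nat[of "\<lambda>p. p \<noteq> 0 \<and> poly_over (Domain G) p \<and> poly p x = 0" p degree, OF this]
  show ?thesis unfolding min_pair_def by blast
qed

lemma pair_poly_converse: "pair_poly (G\<inverse>) p q \<longleftrightarrow> pair_poly G q p"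
  by (simp add: pair_poly_def)

text \<open>\<open>y\<close> is an arbitrary root of the image \<open>p'\<close> of a minimal
  polynomial \<open>p\<close> of \<open>x\<close>. Minimality of \<open>p\<close> gives one
  direction of the condition on zeros; for the other one \<open>p'\<close> has to be minimal for
  \<open>y\<close>, which amounts to irreducibility of \<open>p\<close>.\<close>

lemma partial_iso_extend_algebraic:
  fixes x :: "'a::alg_closed_field"
  assumes G: "partial_iso G" and x: "alg_over (Domain G) x"
  shows "\<exists>y. alg_over (Range G) y \<and> partial_iso (adjoin_pair G x y)"
proof -
  obtain p where p: "min_pair G x p" using min_pair_exists[OF x] by blast
  then have p0: "p \<noteq> 0" "poly_over (Domain G) p" "poly p x = 0" by (auto simp: min_pair_def)
  obtain p' where p': "pair_poly G p p'" using pair_poly_Domain[OF p0(2) G] by blast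
  have dp: "degree p = degree p'" by (rule pair_poly_degree[OF G p'])
  have "degree p \<noteq> 0"
  proof
    assume "degree p = 0"
    then obtain c where "p = [:c:]" by (metis degree_eq_zeroE)
    with p0 show False by simp
  qed
  then obtain y where y: "poly p' y = 0" using alg_closed_imp_poly_has_root[of p'] dp by auto
  have p'0: "p' \<noteq> 0" using pair_poly_eq_0[OF G p'] p0 by simp
  have yalg: "alg_over (Range G) y" using y p'0 pair_poly_over[OF p'] by (auto simp: alg_over_def)
  then have "alg_over (Domain (G\<inverse>)) y" by simp
  then obtain q' where q': "min_pair (G\<inverse>) y q'" using min_pair_exists by blast
  then have q'0: "q' \<noteq> 0" "poly_over (Range G) q'" "poly q' y = 0" by (auto simp: min_pair_def)
  have G': "partial_iso (G\<inverse>)" by (rule partial_iso_converse[OF G])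
  obtain q where q: "pair_poly (G\<inverse>) q' q" using pair_poly_Domain[OF _ G', of q'] q'0 by auto
  then have q2: "pair_poly G q q'" by (simp add: pair_poly_converse)
  have q0: "q \<noteq> 0" using pair_poly_eq_0[OF G' q] q'0 by simp
  have dq: "degree q = degree q'" by (rule pair_poly_degree[OF G q2])
  \<comment> \<open>the minimal polynomial of \<open>y\<close> pulls back to a factor of \<open>p\<close>, so it has full degree\<close>
  obtain c c' s s' u u' where *: "(c, c') \<in> G" "c \<noteq> 0" "pair_poly G s s'" "pair_poly G u u'"
     "smult c p = s * q + u" "smult c' p' = s' * q' + u'" "u = 0 \<or> degree u < degree q"
    using pair_poly_pseudo_div[OF G q2 q0 p'] by blast
  have "poly u' y = 0" using arg_cong[OF *(6), of "\<lambda>p. poly p y"] y q'0 by simp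
  moreover have "degree u = degree u'" by (rule pair_poly_degree[OF G *(4)])
  ultimately have "u' = 0" using *(7) q' pair_poly_over[OF *(4)] pair_poly_eq_0[OF G *(4)] dq
    unfolding min_pair_def by force
  then have "u = 0" using pair_poly_eq_0[OF G *(4)] by simp
  then have sq: "smult c p = s * q" using *(5) by simp
  then have s0: "s \<noteq> 0" using *(2) p0(1) by auto
  have deg: "degree p = degree s + degree q"
    using arg_cong[OF sq, of degree] s0 q0 *(2) by (simp add: degree_mult_eq)
  \<comment> \<open>A factor vanishing at \<open>x\<close> has at least the degree of
    \<open>p\<close>. It cannot be \<open>s\<close>, since \<open>q\<close> is not constant, so it
    is \<open>q\<close>.\<close>
  have "poly s x = 0 \<or> poly q x = 0" using arg_cong[OF sq, of "\<lambda>p. poly p x"] p0(3) by simp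
  then have "degree p \<le> degree s \<or> degree p \<le> degree q"
    using p s0 q0 pair_poly_over[OF *(3)] pair_poly_over[OF q2] unfolding min_pair_def by blast
  moreover have "degree q \<noteq> 0"
  proof
    assume "degree q = 0"
    then obtain c where "q' = [:c:]" using dq by (metis degree_eq_zeroE)
    with q'0 show False by simp
  qed
  ultimately have "degree p' = degree q'" using deg dp dq by linarith
  then have mp: "min_pair (G\<inverse>) y p'"
    using q' p'0 y pair_poly_over[OF p'] by (simp add: min_pair_def)
  have "partial_iso (adjoin_pair G x y)"
  proof (rule adjoin_pair_partial_iso[OF G])
    fix f g assume fg: "pair_poly G f g"
    show "poly f x = 0 \<longleftrightarrow> poly g y = 0"
    proof
      show "poly f x = 0 \<Longrightarrow> poly g y = 0" using min_pair_root[OF G p p' y fg] .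
      show "poly g y = 0 \<Longrightarrow> poly f x = 0"
        using min_pair_root[OF G' mp _ p0(3), of g f] p' fg by (simp add: pair_poly_converse)
    qed
  qed
  with yalg show ?thesis by blast
qed

lemma poly_over_pcompose:
  assumes "is_subring A" "poly_over A p" "poly_over A q"
  shows "poly_over A (pcompose p q)"
  using assms(2)
proof (induction p)
  case (pCons a p)
  have "a \<in> A" "poly_over A p"
    using pCons.prems unfolding poly_over_def by (metis coeff_pCons_0, metis coeff_pCons_Suc)
  then show ?case using pCons.IH assms
    by (auto simp: pcompose_pCons intro!: poly_over_basic)
qed (auto intro: poly_over_basic assms)

lemma partial_iso_Id_on: "is_subring A \<Longrightarrow> partial_iso (Id_on A)"
  by (auto simp: partial_iso_def is_subring_def)

text \<open>If \<open>F(x, b) = 0\<close>, then for each \<open>c \<in> A\<close> the isomorphism \<open>x \<mapsto> x + c\<close> over \<open>A\<close> extends to \<open>b\<close> and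
  yields \<open>F(x + c, b') = 0\<close>. Only finitely many conjugates \<open>b'\<close> are available for infinitely many \<open>c\<close>.\<close>

lemma not_alg_over_adjoin_algebraic:
  fixes x b :: "'a::alg_closed_field"
  assumes A: "is_subring A" "infinite A" and x: "\<not> alg_over A x" and b: "alg_over A b"
  shows "\<not> alg_over (adjoin_to A b) x"
proof
  assume "alg_over (adjoin_to A b) x"
  then obtain F where F: "F \<noteq> 0" "poly_over (adjoin_to A b) F" "poly F x = 0"
    by (auto simp: alg_over_def)
  then have "\<forall>j. \<exists>p. poly_over A p \<and> coeff F j = poly p b"
    by (force simp: poly_over_def adjoin_to_def)
  then obtain f where f: "\<And>j. poly_over A (f j)" "\<And>j. coeff F j = poly (f j) b" by metis
  obtain p where p: "p \<noteq> 0" "poly_over A p" "poly p b = 0" using b by (auto simp: alg_over_def)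
  \<comment> \<open>\<open>F' b'\<close> is \<open>F\<close> with the conjugate \<open>b'\<close>
    put for \<open>b\<close> in its coefficients.\<close>
  define F' where "F' b' = (\<Sum>j\<le>degree F. monom (poly (f j) b') j)" for b'
  have cF': "coeff (F' b') j = (if j \<le> degree F then poly (f j) b' else 0)" for b' j
    by (simp add: F'_def coeff_sum)
  have "\<exists>b'. poly p b' = 0 \<and> F' b' \<noteq> 0 \<and> poly (F' b') (x + c) = 0" if c: "c \<in> A" for c
  proof -
    have I: "partial_iso (Id_on A)" by (rule partial_iso_Id_on[OF A(1)])
    have "\<not> alg_over A (x + c)"
    proof
      assume "alg_over A (x + c)"
      then obtain q where q: "q \<noteq> 0" "poly_over A q" "poly q (x + c) = 0" by (auto simp: alg_over_def)
      have c1: "poly_over A [:c, 1:]" using c is_subringD(1)[OF A(1)]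
        by (auto intro!: poly_over_basic A)
      have "q \<circ>\<^sub>p [:c, 1:] \<noteq> 0" using q(1) by (simp add: pcompose_eq_0_iff)
      moreover have "poly (q \<circ>\<^sub>p [:c, 1:]) x = 0" using q(3) by (simp add: poly_pcompose add.commute)
      ultimately show False using x poly_over_pcompose[OF A(1) q(2) c1] by (auto simp: alg_over_def)
    qed
    then have G1: "partial_iso (adjoin_pair (Id_on A) x (x + c))" (is "partial_iso ?G1")
      using x by (intro partial_iso_extend_transcendental I) auto
    have A1: "(a, a) \<in> ?G1" if "a \<in> A" for a
      using adjoin_pair_superset[OF I] that by (meson Id_onI subsetD)
    then have "alg_over (Domain ?G1) b" using alg_over_mono[OF b, of "Domain ?G1"] by blast
    then obtain b' where G2: "partial_iso (adjoin_pair ?G1 b b')" (is "partial_iso ?G2")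
      using partial_iso_extend_algebraic[OF G1] by blast
    have sub: "?G1 \<subseteq> ?G2" by (rule adjoin_pair_superset[OF G1])
    have A2: "pair_poly ?G2 q q" if "poly_over A q" for q
      using that A1 sub by (auto simp: pair_poly_def poly_over_def)
    have b2: "(b, b') \<in> ?G2" by (rule adjoin_pair_self[OF G1])
    have x2: "(x, x + c) \<in> ?G2" using adjoin_pair_self[OF I] sub by blast
    have v: "(poly q b, poly q b') \<in> ?G2" if "poly_over A q" for q
      by (rule pair_poly_value[OF G2 A2[OF that] b2])
    have "poly p b' = 0" using partial_isoD(6)[OF G2 v[OF p(2)]] p(3) by simp
    moreover have FF: "pair_poly ?G2 F (F' b')"
      unfolding pair_poly_def
    proof
      fix i show "(coeff F i, coeff (F' b') i) \<in> ?G2"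
        using v[OF f(1)[of i]] f(2)[of i] partial_isoD(2)[OF G2] by (auto simp: cF' coeff_eq_0)
    qed
    moreover have "F' b' \<noteq> 0" using pair_poly_eq_0[OF G2 FF] F(1) by simp
    moreover have "poly (F' b') (x + c) = 0"
      using partial_isoD(6)[OF G2 pair_poly_value[OF G2 FF x2]] F(3) by simp
    ultimately show ?thesis by blast
  qed
  then obtain h where h: "\<And>c. c \<in> A \<Longrightarrow> poly p (h c) = 0 \<and> F' (h c) \<noteq> 0 \<and> poly (F' (h c)) (x + c) = 0"
    by metis
  have "finite (h ` A)"
    by (rule finite_subset[OF _ poly_roots_finite[OF p(1)]]) (use h in auto)
  then obtain c0 where c0: "c0 \<in> A" "infinite {c \<in> A. h c = h c0}"
    using pigeonhole_infinite[OF A(2)] by blast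
  have "(\<lambda>c. x + c) ` {c \<in> A. h c = h c0} \<subseteq> {z. poly (F' (h c0)) z = 0}"
    using h by force
  moreover have "finite {z. poly (F' (h c0)) z = 0}" using h[OF c0(1)] by (intro poly_roots_finite) auto
  ultimately have "finite ((\<lambda>c. x + c) ` {c \<in> A. h c = h c0})" using finite_subset by blast
  then have "finite {c \<in> A. h c = h c0}" by (rule finite_imageD) (auto simp: inj_on_def)
  with c0 show False by blast
qed

lemma adjoin_pair_subset:
  assumes "is_subring V" "is_subring W" "G \<subseteq> V \<times> W" "x \<in> V" "y \<in> W"
  shows "adjoin_pair G x y \<subseteq> V \<times> W"
proof
  fix z assume "z \<in> adjoin_pair G x y"
  then obtain p q where pq: "z = (poly p x, poly q y)" "pair_poly G p q" by (auto simp: adjoin_pair_def)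
  then have "poly_over V p" "poly_over W q" using assms(3) by (auto simp: pair_poly_def poly_over_def)
  then show "z \<in> V \<times> W" using poly_in_subring assms by (auto simp: pq(1))
qed

lemma alg_closed_inD: "alg_closed_in W \<Longrightarrow> alg_over A x \<Longrightarrow> A \<subseteq> W \<Longrightarrow> x \<in> W"
  using alg_over_mono unfolding alg_closed_in_def by blast

text \<open>A maximal partial isomorphism inside \<open>W \<times> W\<close> has a relatively
  algebraically closed domain and range, since algebraic elements can always be adjoined. The
  assumptions on \<open>acl\<close> then force both to be all of \<open>W\<close>.\<close>

lemma partial_iso_extend_acl:
  fixes W :: "'a::alg_closed_field set"
  assumes G0: "partial_iso G0" and W: "alg_closed_in W" "G0 \<subseteq> W \<times> W"
    and acl: "W \<subseteq> acl (Domain G0)" "W \<subseteq> acl (Range G0)"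
  shows "\<exists>G. partial_iso G \<and> G0 \<subseteq> G \<and> Domain G = W \<and> Range G = W"
proof -
  define GG where "GG = {G. partial_iso G \<and> G0 \<subseteq> G \<and> G \<subseteq> W \<times> W}"
  have Wr: "is_subring W" using W(1) by (auto simp: alg_closed_in_def)
  have "\<exists>M\<in>GG. (\<forall>Y\<in>GG. (M \<subseteq> Y \<longrightarrow> Y = M))"
  proof (rule subset_Zorn_nonempty)
    show "GG \<noteq> {}" using G0 W(2) by (auto simp: GG_def)
    fix C assume C: "C \<noteq> {}" "subset.chain GG C"
    then have CA: "C \<subseteq> GG" and ch: "\<And>G H. G \<in> C \<Longrightarrow> H \<in> C \<Longrightarrow> G \<subseteq> H \<or> H \<subseteq> G"
      by (auto simp: subset_chain_def)
    have "partial_iso (\<Union>C)"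
      unfolding partial_iso_def
    proof (intro conjI allI impI)
      obtain G where "G \<in> C" using C(1) by blast
      then have "(1, 1) \<in> G" using CA by (auto simp: GG_def intro: partial_isoD(1))
      then show "(1, 1) \<in> \<Union>C" using \<open>G \<in> C\<close> by blast
      fix x y assume xy: "(x, y) \<in> \<Union>C"
      then obtain H where H: "H \<in> C" "(x, y) \<in> H" by blast
      then have "partial_iso H" using CA by (auto simp: GG_def)
      then show "x = 0 \<longleftrightarrow> y = 0" using partial_isoD(6) H(2) by blast
      fix x' y' assume "(x', y') \<in> \<Union>C"
      then obtain H' where H': "H' \<in> C" "(x', y') \<in> H'" by blast
      obtain K where K: "K \<in> C" "(x, y) \<in> K" "(x', y') \<in> K" using ch[OF H(1) H'(1)] H H' by blast
      then have "partial_iso K" using CA by (auto simp: GG_def)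
      from partial_isoD(3,4)[OF this K(2,3)] K(1)
      show "(x - x', y - y') \<in> \<Union>C" "(x * x', y * y') \<in> \<Union>C" by blast+
    qed
    moreover have "G0 \<subseteq> \<Union>C" "\<Union>C \<subseteq> W \<times> W" using C(1) CA by (auto simp: GG_def)
    ultimately show "\<Union>C \<in> GG" by (simp add: GG_def)
  qed
  then obtain G where G: "partial_iso G" "G0 \<subseteq> G" "G \<subseteq> W \<times> W"
    and max: "\<And>H. partial_iso H \<Longrightarrow> H \<subseteq> W \<times> W \<Longrightarrow> G \<subseteq> H \<Longrightarrow> H = G"
    unfolding GG_def by (smt (verit) mem_Collect_eq subset_trans)
  have sub: "Domain G \<subseteq> W" "Range G \<subseteq> W" using G(3) by auto
  have "x \<in> Domain G" if x: "alg_over (Domain G) x" for x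
  proof -
    obtain y where y: "alg_over (Range G) y" "partial_iso (adjoin_pair G x y)"
      using partial_iso_extend_algebraic[OF G(1) x] by blast
    \<comment> \<open>The partner \<open>y\<close> is algebraic over \<open>Range G\<close>, so
      closedness of \<open>W\<close> keeps the extension inside \<open>W \<times> W\<close>, where
      maximality applies.\<close>
    have "x \<in> W" "y \<in> W"
      using alg_closed_inD[OF W(1) x sub(1)] alg_closed_inD[OF W(1) y(1) sub(2)] by auto
    then have "adjoin_pair G x y = G"
      by (intro max y adjoin_pair_subset Wr G adjoin_pair_superset)
    then show ?thesis using adjoin_pair_self[OF G(1), of x y] by blast
  qed
  then have "alg_closed_in (Domain G)" using partial_iso_subring[OF G(1)] by (auto simp: alg_closed_in_def)
  then have "W \<subseteq> Domain G" using acl_least[of "Domain G" "Domain G0"] acl(1) G(2) by blast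
  moreover have "y \<in> Range G" if y: "alg_over (Range G) y" for y
  proof -
    have "alg_over (Domain (G\<inverse>)) y" using y by simp
    then obtain x where x: "alg_over (Range (G\<inverse>)) x" "partial_iso (adjoin_pair (G\<inverse>) y x)"
      using partial_iso_extend_algebraic[OF partial_iso_converse[OF G(1)]] by blast
    have "x \<in> W" "y \<in> W"
      using alg_closed_inD[OF W(1) y sub(2)] alg_closed_inD[OF W(1), of "Domain G" x] x(1) sub(1) by auto
    then have "adjoin_pair (G\<inverse>) y x \<subseteq> W \<times> W"
      by (intro adjoin_pair_subset Wr) (use G(3) in auto)
    moreover have "G\<inverse> \<subseteq> adjoin_pair (G\<inverse>) y x"
      by (rule adjoin_pair_superset[OF partial_iso_converse[OF G(1)]])
    ultimately have "(adjoin_pair (G\<inverse>) y x)\<inverse> = G"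
      by (intro max partial_iso_converse x) auto
    then show ?thesis using adjoin_pair_self[OF partial_iso_converse[OF G(1)], of y x] by blast
  qed
  then have "alg_closed_in (Range G)" using partial_iso_subring[OF G(1)] by (auto simp: alg_closed_in_def)
  then have "W \<subseteq> Range G" using acl_least[of "Range G" "Range G0"] acl(2) G(2) by blast
  ultimately show ?thesis using G sub by blast
qed

section \<open>Solving one difference equation by a generic zero\<close>

lemma monomial_sum_eq_0_imp_coeff_sums_eq_0:
  fixes g :: "nat \<Rightarrow> 'a::field"
  assumes B: "is_subring B"
  shows "(\<And>i. i < m \<Longrightarrow> \<not> alg_over (ring_gen (B \<union> g ` {..<i})) (g i)) \<Longrightarrow> finite S \<Longrightarrow>
     (\<And>\<alpha>. \<alpha> \<in> S \<Longrightarrow> c \<alpha> \<in> B) \<Longrightarrow> (\<Sum>\<alpha>\<in>S. c \<alpha> * (\<Prod>j<m. g j ^ \<alpha> j)) = 0 \<Longrightarrow>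
     (\<Sum>\<alpha> | \<alpha> \<in> S \<and> (\<forall>j<m. \<alpha> j = \<beta> j). c \<alpha>) = 0"
proof (induction m arbitrary: S)
  case 0
  then show ?case by simp
next
  case (Suc m)
  define R where "R = ring_gen (B \<union> g ` {..<m})"
  have R: "is_subring R" "B \<union> g ` {..<m} \<subseteq> R"
    unfolding R_def by (rule ring_gen_subring, rule ring_gen_superset)
  \<comment> \<open>As a polynomial in the last variable \<open>g m\<close>, the sum has
    coefficients in \<open>R\<close>, over which \<open>g m\<close> is not algebraic; so every
    coefficient vanishes, and the induction continues with the exponents having a fixed entry at
    \<open>m\<close>. Members of \<open>S\<close> may agree below \<open>m\<close>, which is why
    only grouped sums vanish.\<close>
  define p where "p = (\<Sum>\<alpha>\<in>S. monom (c \<alpha> * (\<Prod>j<m. g j ^ \<alpha> j)) (\<alpha> m))"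
  have "poly_over R p"
    unfolding p_def
  proof (intro poly_over_sum poly_over_basic R(1) is_subringD(4)[OF R(1)] is_subring_prod is_subring_power)
    show "c \<alpha> \<in> R" if "\<alpha> \<in> S" for \<alpha> using Suc.prems(3)[OF that] R(2) by blast
    show "g j \<in> R" if "j \<in> {..<m}" for j using that R(2) by blast
  qed
  moreover have "poly p (g m) = 0" using Suc.prems(4) by (simp add: p_def poly_sum poly_monom mult_ac)
  ultimately have p0: "p = 0" using Suc.prems(1)[of m] by (auto simp: R_def alg_over_def)
  define S' where "S' = {\<alpha>\<in>S. \<alpha> m = \<beta> m}"
  have "0 = coeff p (\<beta> m)" by (simp add: p0)
  also have "\<dots> = (\<Sum>\<alpha>\<in>S'. c \<alpha> * (\<Prod>j<m. g j ^ \<alpha> j))"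
    unfolding p_def coeff_sum coeff_monom S'_def using Suc.prems(2)
    by (subst sum.If_cases) (auto intro!: sum.cong simp: Int_def)
  finally have "(\<Sum>\<alpha> | \<alpha> \<in> S' \<and> (\<forall>j<m. \<alpha> j = \<beta> j). c \<alpha>) = 0"
    using Suc.prems by (intro Suc.IH) (auto simp: S'_def)
  moreover have "{\<alpha>. \<alpha> \<in> S' \<and> (\<forall>j<m. \<alpha> j = \<beta> j)} = {\<alpha>. \<alpha> \<in> S \<and> (\<forall>j<Suc m. \<alpha> j = \<beta> j)}"
    by (auto simp: S'_def less_Suc_eq)
  ultimately show ?case by simp
qed

text \<open>Two nonzero coefficients mean that \<open>p\<close> is not a monomial: after the largest
  power of the variable is divided out, a nonconstant polynomial with nonzero constant term
  remains.\<close>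

lemma nonzero_root_exists:
  fixes p :: "'a::alg_closed_field poly"
  assumes "coeff p i \<noteq> 0" "coeff p j \<noteq> 0" "i < j"
  shows "\<exists>b. b \<noteq> 0 \<and> poly p b = 0"
proof -
  define n where "n = (LEAST i. coeff p i \<noteq> 0)"
  have n: "coeff p n \<noteq> 0" "n \<le> i" "\<And>k. k < n \<Longrightarrow> coeff p k = 0"
    unfolding n_def using LeastI[of "\<lambda>i. coeff p i \<noteq> 0", OF assms(1)]
      Least_le[of "\<lambda>i. coeff p i \<noteq> 0", OF assms(1)] not_less_Least[of _ "\<lambda>i. coeff p i \<noteq> 0"]
    by blast+
  define q where "q = poly_shift n p"
  have pq: "p = monom 1 n * q"
    by (rule poly_eqI) (use n(3) in \<open>auto simp: q_def coeff_monom_mult coeff_poly_shift\<close>)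
  have "coeff q (j - n) \<noteq> 0" using assms n(2) by (simp add: q_def coeff_poly_shift)
  then have "j - n \<le> degree q" by (rule le_degree)
  then have "0 < degree q" using assms(3) n(2) by linarith
  then obtain b where b: "poly q b = 0" using alg_closed_imp_poly_has_root by blast
  have "poly q 0 \<noteq> 0" using n(1) by (simp add: q_def poly_0_coeff_0 coeff_poly_shift)
  then have "b \<noteq> 0" using b by auto
  then show ?thesis using b pq by auto
qed

lemma bij_betw_funpow_carrier: "bij_betw f W W \<Longrightarrow> bij_betw (f ^^ n) W W"
  by (induction n) (auto intro: bij_betw_trans simp: bij_betw_id)

text \<open>
  Let \<open>M\<close> be the last variable that the equation involves genuinely, let \<open>z\<^sub>0, \<dots>, z\<^sub>M\<^sub>-\<^sub>1\<close> be
  independent and let \<open>b\<close> solve the equation for the variable \<open>M\<close>. If \<open>b\<close> is algebraic over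
  \<open>z\<^sub>m, \<dots>, z\<^sub>M\<^sub>-\<^sub>1\<close> with \<open>m\<close> maximal, then the shift \<open>z\<^sub>m \<mapsto> z\<^sub>m\<^sub>+\<^sub>1 \<mapsto> \<dots> \<mapsto> b\<close> extends to an
  automorphism, and the values of the variables below \<open>m\<close> do not matter for the equation.
\<close>

lemma difference_equation_solvable:
  fixes \<iota> :: "'k::field \<Rightarrow> 'b::alg_closed_field" and z :: "nat \<Rightarrow> 'b"
  assumes \<iota>: "\<iota> 1 = 1" "\<And>x y. \<iota> (x - y) = \<iota> x - \<iota> y" "\<And>x y. \<iota> (x * y) = \<iota> x * \<iota> y"
    and inf: "infinite (UNIV :: 'k set)"
    and \<sigma>: "field_automorphism \<sigma>"
    and z: "\<And>i. \<not> alg_over (ring_gen (range \<iota> \<union> z ` (- {i}))) (z i)"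
    and S: "finite S" "\<alpha>0 \<in> S" "\<beta>0 \<in> S" "\<alpha>0 \<noteq> \<beta>0"
      "\<And>\<alpha> \<beta>. \<alpha> \<in> S \<Longrightarrow> \<beta> \<in> S \<Longrightarrow> (\<forall>j\<le>d. \<alpha> j = \<beta> j) \<Longrightarrow> \<alpha> = \<beta>"
    and c: "\<And>\<alpha>. \<alpha> \<in> S \<Longrightarrow> c \<alpha> \<noteq> 0"
  shows "\<exists>W \<phi> x. alg_closed_in W \<and> range \<iota> \<subseteq> W \<and> bij_betw \<phi> W W \<and> (\<forall>a. \<phi> (\<iota> a) = \<iota> (\<sigma> a)) \<and>
    (\<forall>x\<in>W. \<forall>y\<in>W. \<phi> (x + y) = \<phi> x + \<phi> y \<and> \<phi> (x * y) = \<phi> x * \<phi> y) \<and> x \<in> W \<and> x \<noteq> 0 \<and>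
    (\<Sum>\<alpha>\<in>S. \<iota> (c \<alpha>) * (\<Prod>j\<le>d. (\<phi> ^^ j) x ^ \<alpha> j)) = 0"
proof -
  define K where "K = range \<iota>"
  have \<iota>0: "\<iota> 0 = 0" using \<iota>(2)[of 0 0] by simp
  have \<iota>nz: "\<iota> u = 0 \<longleftrightarrow> u = 0" for u
    using \<iota>(3)[of u "inverse u"] \<iota>(1) \<iota>0 by (cases "u = 0") auto
  have \<iota>inj: "inj \<iota>" using \<iota>(2) \<iota>nz by (metis injI eq_iff_diff_eq_0)
  have K: "is_subring K"
    unfolding is_subring_def K_def using \<iota> by (metis (no_types, lifting) imageE rangeI)
  have Kinf: "infinite K" unfolding K_def using inf \<iota>inj by (simp add: finite_image_iff)
  have za: "\<not> alg_over (ring_gen (K \<union> T)) (z i)" if "T \<subseteq> z ` (- {i})" for T i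
  proof
    assume "alg_over (ring_gen (K \<union> T)) (z i)"
    then have "alg_over (ring_gen (range \<iota> \<union> z ` (- {i}))) (z i)"
      by (rule alg_over_mono) (intro ring_gen_mono, use that K_def in auto)
    then show False using z by blast
  qed
  \<comment> \<open>The variables whose exponent varies over \<open>S\<close>. Above
    \<open>M = Max D\<close> all exponents agree, so those variables only contribute a common
    factor.\<close>
  define D where "D = {j. j \<le> d \<and> (\<exists>\<alpha>\<in>S. \<exists>\<beta>\<in>S. \<alpha> j \<noteq> \<beta> j)}"
  define M where "M = Max D"
  have D: "finite D" unfolding D_def by (rule finite_subset[of _ "{..d}"]) auto
  have "D \<noteq> {}" using S(2-4) S(5)[of \<alpha>0 \<beta>0] unfolding D_def by blast
  then have MD: "M \<in> D" unfolding M_def using D by (rule Max_in[rotated])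
  then have Md: "M \<le> d" by (simp add: D_def)
  have const: "\<alpha> j = \<beta> j" if "\<alpha> \<in> S" "\<beta> \<in> S" "j \<le> d" "M < j" for \<alpha> \<beta> j
  proof (rule ccontr)
    assume "\<alpha> j \<noteq> \<beta> j"
    then have "j \<in> D" using that by (auto simp: D_def)
    then show False using Max_ge[OF D, of j] that(4) by (simp add: M_def)
  qed
  \<comment> \<open>The equation without its common factor, with \<open>z j\<close> put for the
    variables below \<open>M\<close> and the variable \<open>M\<close> as unknown.\<close>
  define p where "p = (\<Sum>\<alpha>\<in>S. monom (\<iota> (c \<alpha>) * (\<Prod>j<M. z j ^ \<alpha> j)) (\<alpha> M))"
  \<comment> \<open>Independence of the \<open>z j\<close> excludes cancellation: exponents that
    agree at \<open>M\<close> and below it agree everywhere, since above \<open>M\<close> they agree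
    by the choice of \<open>M\<close>.\<close>
  have cp: "coeff p (\<gamma> M) \<noteq> 0" if \<gamma>: "\<gamma> \<in> S" for \<gamma>
  proof
    assume "coeff p (\<gamma> M) = 0"
    define S' where "S' = {\<alpha>\<in>S. \<alpha> M = \<gamma> M}"
    have "coeff p (\<gamma> M) = (\<Sum>\<alpha>\<in>S'. \<iota> (c \<alpha>) * (\<Prod>j<M. z j ^ \<alpha> j))"
      unfolding p_def coeff_sum coeff_monom S'_def using S(1)
      by (subst sum.If_cases) (auto intro!: sum.cong simp: Int_def)
    with \<open>coeff p (\<gamma> M) = 0\<close> have "(\<Sum>\<alpha>\<in>S'. \<iota> (c \<alpha>) * (\<Prod>j<M. z j ^ \<alpha> j)) = 0" by simp
    then have "(\<Sum>\<alpha> | \<alpha> \<in> S' \<and> (\<forall>j<M. \<alpha> j = \<gamma> j). \<iota> (c \<alpha>)) = 0"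
      by (intro monomial_sum_eq_0_imp_coeff_sums_eq_0[OF K, of M z] za)
        (use S(1) in \<open>auto simp: S'_def K_def\<close>)
    moreover have "{\<alpha>. \<alpha> \<in> S' \<and> (\<forall>j<M. \<alpha> j = \<gamma> j)} = {\<gamma>}"
    proof -
      have "\<alpha> = \<gamma>" if "\<alpha> \<in> S'" "\<forall>j<M. \<alpha> j = \<gamma> j" for \<alpha>
      proof (rule S(5))
        have "\<alpha> j = \<gamma> j" if "j \<le> d" for j
          using \<open>\<alpha> \<in> S'\<close> \<open>\<forall>j<M. \<alpha> j = \<gamma> j\<close> const[of \<alpha> \<gamma> j] \<gamma> that
          by (cases j M rule: linorder_cases) (auto simp: S'_def)
        then show "\<forall>j\<le>d. \<alpha> j = \<gamma> j" by blast
      qed (use that \<gamma> in \<open>auto simp: S'_def\<close>)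
      then show ?thesis using \<gamma> by (auto simp: S'_def)
    qed
    ultimately show False using c[OF \<gamma>] by (simp add: \<iota>nz)
  qed
  obtain \<gamma> \<delta> where \<gamma>: "\<gamma> \<in> S" "\<delta> \<in> S" "\<gamma> M < \<delta> M"
    using MD unfolding D_def by (auto simp: neq_iff)
  obtain b where b: "b \<noteq> 0" "poly p b = 0"
    using nonzero_root_exists[OF cp[OF \<gamma>(1)] cp[OF \<gamma>(2)] \<gamma>(3)] by blast
  have "poly_over (ring_gen (K \<union> z ` {0..<M})) p"
    unfolding p_def
  proof (intro poly_over_sum poly_over_basic ring_gen_subring is_subringD(4)[OF ring_gen_subring]
      is_subring_prod is_subring_power)
    show "\<iota> (c \<alpha>) \<in> ring_gen (K \<union> z ` {0..<M})" for \<alpha>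
      using ring_gen_superset[of "K \<union> z ` {0..<M}"] by (auto simp: K_def)
    show "z j \<in> ring_gen (K \<union> z ` {0..<M})" if "j \<in> {..<M}" for j
      using ring_gen_superset[of "K \<union> z ` {0..<M}"] that by auto
  qed
  moreover have "p \<noteq> 0" using cp[OF \<gamma>(1)] by auto
  ultimately have b0: "alg_over (ring_gen (K \<union> z ` {0..<M})) b" using b by (auto simp: alg_over_def)
  \<comment> \<open>A larger index leaves fewer variables for \<open>b\<close> to depend on; in the
    extreme case \<open>m = M\<close>, \<open>b\<close> is algebraic over \<open>K\<close>
    alone.\<close>
  define E where "E = {m. m \<le> M \<and> alg_over (ring_gen (K \<union> z ` {m..<M})) b}"
  define m where "m = Max E"
  have Efin: "finite E" unfolding E_def by (rule finite_subset[of _ "{..M}"]) auto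
  have "0 \<in> E" using b0 by (simp add: E_def)
  then have "m \<in> E" unfolding m_def using Efin by (intro Max_in) auto
  then have mM: "m \<le> M" and bm: "alg_over (ring_gen (K \<union> z ` {m..<M})) b" by (auto simp: E_def)
  have mmax: "\<not> alg_over (ring_gen (K \<union> z ` {Suc m..<M})) b" if "m < M"
  proof
    assume "alg_over (ring_gen (K \<union> z ` {Suc m..<M})) b"
    then have "Suc m \<in> E" using that by (simp add: E_def)
    then show False using Max_ge[OF Efin, of "Suc m"] by (simp add: m_def)
  qed
  define s where "s i = (if i < M then z i else b)" for i
  \<comment> \<open>The shift is built one variable at a time from \<open>\<sigma>\<close> on
    \<open>K\<close>; each step sends an element transcendental over the domain to one
    transcendental over the range.\<close>
  have chain: "\<exists>G. partial_iso G \<and> (\<forall>a. (\<iota> a, \<iota> (\<sigma> a)) \<in> G) \<and> (\<forall>i\<in>{m..<r}. (s i, s (Suc i)) \<in> G) \<and>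
     G \<subseteq> ring_gen (K \<union> z ` {m..<r}) \<times> ring_gen (K \<union> s ` {Suc m..r})" if "m \<le> r" "r \<le> M" for r
    using that
  proof (induction r rule: dec_induct)
    case base
    have sig: "\<sigma> (x - y) = \<sigma> x - \<sigma> y" "\<sigma> x = 0 \<longleftrightarrow> x = 0" for x y
    proof -
      have add: "\<And>x y. \<sigma> (x + y) = \<sigma> x + \<sigma> y" using \<sigma> by (auto simp: field_automorphism_def)
      show "\<sigma> (x - y) = \<sigma> x - \<sigma> y" using add[of "x - y" y] by simp
      have "\<sigma> 0 + \<sigma> 0 = \<sigma> 0 + 0" using add[of 0 0] by (simp only: add_0_left add_0_right)
      then have "\<sigma> 0 = 0" by (simp only: add_left_cancel)
      moreover have "inj \<sigma>" using \<sigma> by (auto simp: field_automorphism_def bij_def)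
      ultimately show "\<sigma> x = 0 \<longleftrightarrow> x = 0" by (metis injD)
    qed
    have \<sigma>1: "\<sigma> 1 = 1" "\<And>x y. \<sigma> (x * y) = \<sigma> x * \<sigma> y" using \<sigma> by (auto simp: field_automorphism_def)
    define G where "G = {(\<iota> a, \<iota> (\<sigma> a)) | a. True}"
    have "partial_iso G"
      unfolding partial_iso_def
    proof (intro conjI allI impI)
      show "(1, 1) \<in> G" using \<iota>(1) \<sigma>1(1) unfolding G_def by (metis (mono_tags, lifting) mem_Collect_eq)
      fix x y assume "(x, y) \<in> G"
      then obtain a where a: "x = \<iota> a" "y = \<iota> (\<sigma> a)" by (auto simp: G_def)
      show "x = 0 \<longleftrightarrow> y = 0" by (simp add: a \<iota>nz sig(2))
      fix x' y' assume "(x', y') \<in> G"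
      then obtain a' where a': "x' = \<iota> a'" "y' = \<iota> (\<sigma> a')" by (auto simp: G_def)
      have "(x - x', y - y') = (\<iota> (a - a'), \<iota> (\<sigma> (a - a')))" by (simp add: a a' \<iota> sig)
      then show "(x - x', y - y') \<in> G" unfolding G_def by blast
      have "(x * x', y * y') = (\<iota> (a * a'), \<iota> (\<sigma> (a * a')))" by (simp add: a a' \<iota> \<sigma>1)
      then show "(x * x', y * y') \<in> G" unfolding G_def by blast
    qed
    moreover have "G \<subseteq> ring_gen K \<times> ring_gen K"
      using ring_gen_superset[of K] by (auto simp: G_def K_def)
    ultimately show ?case by (intro exI[of _ G]) (auto simp: G_def)
  next
    case (step r)
    then obtain G where G: "partial_iso G" "\<And>a. (\<iota> a, \<iota> (\<sigma> a)) \<in> G"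
      "\<And>i. i \<in> {m..<r} \<Longrightarrow> (s i, s (Suc i)) \<in> G"
      "G \<subseteq> ring_gen (K \<union> z ` {m..<r}) \<times> ring_gen (K \<union> s ` {Suc m..r})" by auto
    have rM: "r < M" using step by simp
    have "\<not> alg_over (Domain G) (s r)"
    proof
      assume "alg_over (Domain G) (s r)"
      then have "alg_over (Domain G) (z r)" using rM by (simp add: s_def)
      moreover have "Domain G \<subseteq> ring_gen (K \<union> z ` {m..<r})" using G(4) by blast
      ultimately have "alg_over (ring_gen (K \<union> z ` {m..<r})) (z r)" by (rule alg_over_mono)
      moreover have "z ` {m..<r} \<subseteq> z ` (- {r})" by auto
      ultimately show False using za by blast
    qed
    moreover have "\<not> alg_over (Range G) (s (Suc r))"
    proof
      assume a: "alg_over (Range G) (s (Suc r))"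
      have "s ` {Suc m..r} = z ` {Suc m..r}" using rM by (auto simp: s_def)
      then have "Range G \<subseteq> ring_gen (K \<union> z ` {Suc m..r})" using G(4) by auto
      with a have a2: "alg_over (ring_gen (K \<union> z ` {Suc m..r})) (s (Suc r))" by (rule alg_over_mono)
      show False
      proof (cases "Suc r < M")
        case True
        then have "s (Suc r) = z (Suc r)" by (simp add: s_def)
        moreover have "z ` {Suc m..r} \<subseteq> z ` (- {Suc r})" by auto
        ultimately show False using a2 za by fastforce
      next
        case False
        \<comment> \<open>Here the image is \<open>b\<close>, and maximality of \<open>m\<close>
          says exactly that \<open>b\<close> is transcendental over the images adjoined
          before.\<close>
        then have "M = Suc r" using rM by simp
        moreover have "m < M" using rM step(1) by simp
        ultimately show False using a2 mmax by (simp add: s_def atLeastLessThanSuc_atLeastAtMost)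
      qed
    qed
    ultimately have "partial_iso (adjoin_pair G (s r) (s (Suc r)))" (is "partial_iso ?G")
      by (rule partial_iso_extend_transcendental[OF G(1)])
    moreover have sub: "G \<subseteq> ?G" by (rule adjoin_pair_superset[OF G(1)])
    moreover have self: "(s r, s (Suc r)) \<in> ?G" by (rule adjoin_pair_self[OF G(1)])
    moreover have "(s i, s (Suc i)) \<in> ?G" if "i \<in> {m..<Suc r}" for i
      using self subsetD[OF sub G(3)[of i]] that by (cases "i = r") auto
    moreover have "?G \<subseteq> ring_gen (K \<union> z ` {m..<Suc r}) \<times> ring_gen (K \<union> s ` {Suc m..Suc r})" (is "_ \<subseteq> ?V \<times> ?U")
    proof (rule adjoin_pair_subset)
      have 1: "ring_gen (K \<union> z ` {m..<r}) \<subseteq> ?V" "ring_gen (K \<union> s ` {Suc m..r}) \<subseteq> ?U"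
        by (intro ring_gen_mono; force)+
      show "G \<subseteq> ?V \<times> ?U" using G(4) 1 by blast
      show "s r \<in> ?V" using ring_gen_superset[of "K \<union> z ` {m..<Suc r}"] rM step(1) by (auto simp: s_def)
      show "s (Suc r) \<in> ?U" using ring_gen_superset[of "K \<union> s ` {Suc m..Suc r}"] step(1) by auto
    qed (rule ring_gen_subring)+
    ultimately show ?case using G(2) by (intro exI[of _ ?G] conjI ballI allI) blast+
  qed
  obtain G where G: "partial_iso G" "\<And>a. (\<iota> a, \<iota> (\<sigma> a)) \<in> G"
      "\<And>i. i \<in> {m..<M} \<Longrightarrow> (s i, s (Suc i)) \<in> G"
      "G \<subseteq> ring_gen (K \<union> z ` {m..<M}) \<times> ring_gen (K \<union> s ` {Suc m..M})"
    using chain[OF mM order_refl] by blast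
  define W where "W = acl (K \<union> z ` {m..<M})"
  have W: "alg_closed_in W" unfolding W_def by (rule acl_alg_closed_in)
  have Wr: "is_subring W" using W by (simp add: alg_closed_in_def)
  have KW: "K \<union> z ` {m..<M} \<subseteq> W" unfolding W_def by (rule acl_superset)
  have bW: "b \<in> W" by (rule alg_closed_inD[OF W bm ring_gen_least[OF Wr KW]])
  have sW: "s i \<in> W" if "m \<le> i" "i \<le> M" for i using KW bW that by (auto simp: s_def)
  have GW: "G \<subseteq> W \<times> W"
  proof -
    have "ring_gen (K \<union> z ` {m..<M}) \<subseteq> W" by (rule ring_gen_least[OF Wr KW])
    moreover have "ring_gen (K \<union> s ` {Suc m..M}) \<subseteq> W"
      using KW sW by (intro ring_gen_least[OF Wr]) auto
    ultimately show ?thesis using G(4) by blast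
  qed
  have aclD: "W \<subseteq> acl (Domain G)"
    unfolding W_def
  proof (rule acl_least[OF acl_alg_closed_in])
    have "z i \<in> Domain G" if "i \<in> {m..<M}" for i using G(3)[OF that] that by (auto simp: s_def)
    then have "K \<union> z ` {m..<M} \<subseteq> Domain G" using G(2) by (auto simp: K_def)
    then show "K \<union> z ` {m..<M} \<subseteq> acl (Domain G)" using acl_superset by blast
  qed
  \<comment> \<open>The range contains \<open>b\<close> but possibly not \<open>z m\<close>. Since
    by maximality \<open>b\<close> really depends on \<open>z m\<close>, exchange makes
    \<open>z m\<close> algebraic over \<open>b\<close> and the remaining variables.\<close>
  have aclR: "W \<subseteq> acl (Range G)"
    unfolding W_def
  proof (rule acl_least[OF acl_alg_closed_in])
    let ?V = "acl (Range G)"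
    have V: "alg_closed_in ?V" "is_subring ?V"
      using acl_alg_closed_in[of "Range G"] by (auto simp: alg_closed_in_def)
    have RV: "Range G \<subseteq> ?V" by (rule acl_superset)
    have KV: "K \<subseteq> ?V"
    proof -
      have "\<iota> a \<in> Range G" for a
      proof -
        obtain a' where "a = \<sigma> a'" using \<sigma> by (meson field_automorphism_def bij_def surj_def)
        then show ?thesis using G(2)[of a'] by auto
      qed
      then show ?thesis using RV by (auto simp: K_def)
    qed
    have sV: "s i \<in> ?V" if "Suc m \<le> i" "i \<le> M" for i
    proof -
      have "i - 1 \<in> {m..<M}" "Suc (i - 1) = i" using that by auto
      then have "s i \<in> Range G" using G(3)[of "i - 1"] by auto
      then show ?thesis using RV by blast
    qed
    have zV: "z i \<in> ?V" if "Suc m \<le> i" "i < M" for i using sV[of i] that by (simp add: s_def)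
    have "z m \<in> ?V" if "m < M"
    proof -
      let ?A = "ring_gen (K \<union> z ` {Suc m..<M})"
      have "insert (z m) (K \<union> z ` {Suc m..<M}) = K \<union> z ` {m..<M}"
        using ivl_disj_un_singleton(3)[of m M] atLeastSucLessThan_greaterThanLessThan[of m M] that
        by (metis Un_insert_right image_insert insert_is_Un)
      then have "alg_over (adjoin_to ?A (z m)) b" using bm by (simp flip: ring_gen_insert)
      from algebraic_exchange[OF ring_gen_subring this mmax[OF that]]
      have "alg_over (ring_gen (insert b (K \<union> z ` {Suc m..<M}))) (z m)" by (simp add: ring_gen_insert)
      moreover have "ring_gen (insert b (K \<union> z ` {Suc m..<M})) \<subseteq> ?V"
        using sV[of M] KV zV that by (intro ring_gen_least V) (auto simp: s_def)
      ultimately show ?thesis by (rule alg_closed_inD[OF V(1)])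
    qed
    then have "z i \<in> ?V" if "i \<in> {m..<M}" for i using zV[of i] that by (cases "i = m") auto
    then show "K \<union> z ` {m..<M} \<subseteq> ?V" using KV by blast
  qed
  obtain H where H: "partial_iso H" "G \<subseteq> H" "Domain H = W" "Range H = W"
    using partial_iso_extend_acl[OF G(1) W GW aclD aclR] by blast
  define \<phi> where "\<phi> x = (SOME y. (x, y) \<in> H)" for x
  have \<phi>1: "(x, \<phi> x) \<in> H" if xW: "x \<in> W" for x
  proof -
    obtain y where "(x, y) \<in> H" using xW H(3) by blast
    then show ?thesis unfolding \<phi>_def by (rule someI)
  qed
  have \<phi>: "\<phi> x = y" if "(x, y) \<in> H" for x y
  proof -
    have "x \<in> W" using that H(3) by blast
    then show ?thesis using partial_iso_unique[OF H(1) \<phi>1 that, of x] by simp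
  qed
  have \<phi>bij: "bij_betw \<phi> W W"
  proof (rule bij_betw_imageI)
    show "inj_on \<phi> W"
      unfolding inj_on_def using partial_iso_unique[OF H(1) \<phi>1 \<phi>1] by blast
    have "y \<in> \<phi> ` W" if yW: "y \<in> W" for y
    proof -
      obtain x where "(x, y) \<in> H" using yW H(4) by blast
      then show ?thesis using \<phi> H(3) by blast
    qed
    moreover have "\<phi> x \<in> W" if "x \<in> W" for x using \<phi>1[OF that] H(4) by blast
    ultimately show "\<phi> ` W = W" by blast
  qed
  have \<phi>hom: "\<phi> (x + y) = \<phi> x + \<phi> y" "\<phi> (x * y) = \<phi> x * \<phi> y" if "x \<in> W" "y \<in> W" for x y
    by (rule \<phi>[OF partial_isoD(5)[OF H(1) \<phi>1[OF that(1)] \<phi>1[OF that(2)]]],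
        rule \<phi>[OF partial_isoD(4)[OF H(1) \<phi>1[OF that(1)] \<phi>1[OF that(2)]]])
  have \<phi>\<iota>: "\<phi> (\<iota> a) = \<iota> (\<sigma> a)" for a using G(2) H(2) by (intro \<phi>) blast
  have \<phi>s: "\<phi> (s i) = s (Suc i)" if "m \<le> i" "i < M" for i
    using G(3)[of i] H(2) that by (intro \<phi>) auto
  \<comment> \<open>Going back \<open>m\<close> steps from \<open>s m\<close> aligns the orbit of
    \<open>x\<close> with \<open>s\<close> on the indices from \<open>m\<close> to \<open>M\<close>;
    below \<open>m\<close> its values are uncontrolled.\<close>
  have "s m \<in> (\<phi> ^^ m) ` W"
    using bij_betw_funpow_carrier[OF \<phi>bij, of m] sW[of m] mM by (auto simp: bij_betw_def)
  then obtain x where x: "x \<in> W" "(\<phi> ^^ m) x = s m" by auto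
  have "s m \<noteq> 0"
  proof (cases "m < M")
    case True
    have "alg_over (ring_gen (K \<union> {})) 0"
      unfolding alg_over_def
      by (rule exI[of _ "[:0, 1:]"]) (auto intro!: poly_over_basic is_subringD ring_gen_subring)
    then show ?thesis using za[of "{}" m] True by (auto simp: s_def)
  qed (use b in \<open>simp add: s_def\<close>)
  moreover have "(\<phi> ^^ m) 0 = 0"
  proof -
    have "\<phi> 0 = 0" by (rule \<phi>[OF partial_isoD(2)[OF H(1)]])
    then show ?thesis by (induction m) auto
  qed
  ultimately have x0: "x \<noteq> 0" using x by auto
  define y where "y j = (\<phi> ^^ j) x" for j
  have ys: "y (m + i) = s (m + i)" if "m + i \<le> M" for i
    using that by (induction i) (auto simp: y_def x(2) \<phi>s)
  then have ys: "y i = s i" if "m \<le> i" "i \<le> M" for i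
    using that by (metis le_iff_add)
  define C where "C \<alpha> = \<iota> (c \<alpha>) * (\<Prod>j\<in>{m..M}. s j ^ \<alpha> j)" for \<alpha>
  define B where "B = ring_gen (insert b (K \<union> z ` {m..<M}))"
  have Bsup: "insert b (K \<union> z ` {m..<M}) \<subseteq> B" unfolding B_def by (rule ring_gen_superset)
  have B: "is_subring B" unfolding B_def by (rule ring_gen_subring)
  \<comment> \<open>The variables below \<open>m\<close> stay independent over \<open>B\<close>,
    although \<open>B\<close> contains \<open>b\<close>, because \<open>b\<close> is algebraic over
    the others. So the equation satisfied by the \<open>z j\<close> and \<open>b\<close> splits into
    groups with equal exponents below \<open>m\<close>, each with vanishing coefficient sum, and any
    values may be inserted there.\<close>
  have groups: "(\<Sum>\<alpha> | \<alpha> \<in> S \<and> (\<forall>j<m. \<alpha> j = \<beta> j). C \<alpha>) = 0" for \<beta>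
  proof (rule monomial_sum_eq_0_imp_coeff_sums_eq_0[OF B, of m z])
    fix i assume i: "i < m"
    let ?A = "ring_gen (K \<union> z ` (- {i}))"
    have A: "is_subring ?A" by (rule ring_gen_subring)
    have KA: "K \<union> z ` (- {i}) \<subseteq> ?A" by (rule ring_gen_superset)
    have "infinite ?A" using Kinf KA finite_subset by blast
    moreover have "alg_over ?A b"
      by (rule alg_over_mono[OF bm], rule ring_gen_mono) (use i in auto)
    ultimately have n: "\<not> alg_over (adjoin_to ?A b) (z i)"
      using za[of "z ` (- {i})" i] by (intro not_alg_over_adjoin_algebraic A) auto
    have ab: "adjoin_to ?A b = ring_gen (insert b (K \<union> z ` (- {i})))" by (simp add: ring_gen_insert)
    have "ring_gen (B \<union> z ` {..<i}) \<subseteq> adjoin_to ?A b"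
    proof (rule ring_gen_least)
      show "is_subring (adjoin_to ?A b)" by (rule adjoin_to_subring[OF A])
      have "B \<subseteq> adjoin_to ?A b" unfolding B_def ab by (rule ring_gen_mono) (use i in auto)
      moreover have "z ` {..<i} \<subseteq> adjoin_to ?A b"
        using KA adjoin_to_superset[OF A, of b] by auto
      ultimately show "B \<union> z ` {..<i} \<subseteq> adjoin_to ?A b" by blast
    qed
    then show "\<not> alg_over (ring_gen (B \<union> z ` {..<i})) (z i)" using n alg_over_mono by blast
  next
    show "C \<alpha> \<in> B" for \<alpha>
      unfolding C_def
    proof (intro is_subringD(4)[OF B] is_subring_prod is_subring_power B)
      show "\<iota> (c \<alpha>) \<in> B" using Bsup by (auto simp: K_def)
      show "s j \<in> B" if "j \<in> {m..M}" for j using Bsup that by (auto simp: s_def)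
    qed
    have "C \<alpha> * (\<Prod>j<m. z j ^ \<alpha> j) = \<iota> (c \<alpha>) * (\<Prod>j<M. z j ^ \<alpha> j) * b ^ \<alpha> M" for \<alpha>
    proof -
      have "{m..M} = insert M {m..<M}" using mM by auto
      then have "(\<Prod>j\<in>{m..M}. s j ^ \<alpha> j) = b ^ \<alpha> M * (\<Prod>j\<in>{m..<M}. z j ^ \<alpha> j)"
        by (simp add: s_def)
      moreover have "(\<Prod>j<M. z j ^ \<alpha> j) = (\<Prod>j<m. z j ^ \<alpha> j) * (\<Prod>j\<in>{m..<M}. z j ^ \<alpha> j)"
        using prod.atLeastLessThan_concat[of 0 m M "\<lambda>j. z j ^ \<alpha> j"] mM by (simp add: atLeast0LessThan)
      ultimately show ?thesis by (simp add: C_def mult_ac)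
    qed
    then have "(\<Sum>\<alpha>\<in>S. C \<alpha> * (\<Prod>j<m. z j ^ \<alpha> j)) = poly p b"
      by (simp add: p_def poly_sum poly_monom)
    then show "(\<Sum>\<alpha>\<in>S. C \<alpha> * (\<Prod>j<m. z j ^ \<alpha> j)) = 0" using b by simp
  qed (rule S(1))
  define r where "r \<alpha> = (\<lambda>j. if j < m then \<alpha> j else 0)" for \<alpha> :: "nat \<Rightarrow> nat"
  have r_eq: "r \<alpha> = r \<beta> \<longleftrightarrow> (\<forall>j<m. \<alpha> j = \<beta> j)" for \<alpha> \<beta>
    by (force simp: r_def fun_eq_iff)
  have "(\<Sum>\<alpha>\<in>S. C \<alpha> * (\<Prod>j<m. y j ^ \<alpha> j)) =
      (\<Sum>\<beta>\<in>r ` S. \<Sum>\<alpha> | \<alpha> \<in> S \<and> r \<alpha> = \<beta>. C \<alpha> * (\<Prod>j<m. y j ^ \<alpha> j))"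
    by (rule sum.image_gen[OF S(1)])
  also have "\<dots> = 0"
  proof (rule sum.neutral, rule ballI)
    fix \<beta> assume "\<beta> \<in> r ` S"
    then obtain \<epsilon> where \<epsilon>: "\<beta> = r \<epsilon>" by auto
    have "(\<Sum>\<alpha> | \<alpha> \<in> S \<and> r \<alpha> = \<beta>. C \<alpha> * (\<Prod>j<m. y j ^ \<alpha> j)) =
        (\<Sum>\<alpha> | \<alpha> \<in> S \<and> (\<forall>j<m. \<alpha> j = \<epsilon> j). C \<alpha> * (\<Prod>j<m. y j ^ \<epsilon> j))"
      by (rule sum.cong) (auto simp: \<epsilon> r_eq)
    also have "\<dots> = 0" by (simp add: groups flip: sum_distrib_right)
    finally show "(\<Sum>\<alpha> | \<alpha> \<in> S \<and> r \<alpha> = \<beta>. C \<alpha> * (\<Prod>j<m. y j ^ \<alpha> j)) = 0" .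
  qed
  finally have sum0: "(\<Sum>\<alpha>\<in>S. C \<alpha> * (\<Prod>j<m. y j ^ \<alpha> j)) = 0" .
  \<comment> \<open>The factor for the indices above \<open>M\<close> is common to all of
    \<open>S\<close>, so it may be written with the exponent \<open>\<gamma>\<close>.\<close>
  have "\<iota> (c \<alpha>) * (\<Prod>j\<le>d. y j ^ \<alpha> j) = C \<alpha> * (\<Prod>j<m. y j ^ \<alpha> j) * (\<Prod>j\<in>{M<..d}. y j ^ \<gamma> j)"
    if \<alpha>: "\<alpha> \<in> S" for \<alpha>
  proof -
    have un: "{..d} = ({..<m} \<union> {m..M}) \<union> {M<..d}" using mM Md by auto
    have "(\<Prod>j\<le>d. y j ^ \<alpha> j) = (\<Prod>j<m. y j ^ \<alpha> j) * (\<Prod>j\<in>{m..M}. y j ^ \<alpha> j) * (\<Prod>j\<in>{M<..d}. y j ^ \<alpha> j)"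
      unfolding un by (subst prod.union_disjoint; (subst prod.union_disjoint)?; use mM in auto)
    also have "(\<Prod>j\<in>{m..M}. y j ^ \<alpha> j) = (\<Prod>j\<in>{m..M}. s j ^ \<alpha> j)"
      by (intro prod.cong) (auto simp: ys)
    also have "(\<Prod>j\<in>{M<..d}. y j ^ \<alpha> j) = (\<Prod>j\<in>{M<..d}. y j ^ \<gamma> j)"
      using const[OF \<alpha> \<gamma>(1)] by (intro prod.cong) auto
    finally show ?thesis by (simp add: C_def mult_ac)
  qed
  then have "(\<Sum>\<alpha>\<in>S. \<iota> (c \<alpha>) * (\<Prod>j\<le>d. y j ^ \<alpha> j)) =
      (\<Sum>\<alpha>\<in>S. C \<alpha> * (\<Prod>j<m. y j ^ \<alpha> j)) * (\<Prod>j\<in>{M<..d}. y j ^ \<gamma> j)"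
    by (simp add: sum_distrib_right)
  also have "\<dots> = 0" by (simp add: sum0)
  finally have "(\<Sum>\<alpha>\<in>S. \<iota> (c \<alpha>) * (\<Prod>j\<le>d. (\<phi> ^^ j) x ^ \<alpha> j)) = 0" unfolding y_def .
  then show ?thesis using W KW \<phi>bij \<phi>\<iota> \<phi>hom x(1) x0
    by (intro exI[of _ W] exI[of _ \<phi>] exI[of _ x]) (auto simp: K_def)
qed

section \<open>Independent variables in an algebraically closed field\<close>

lemma poly_mapping_eq_sum_single:
  "(\<Sum>m\<in>Poly_Mapping.keys p. Poly_Mapping.single m (Poly_Mapping.lookup p m)) = p"
  by (rule poly_mapping_eqI) (auto simp: lookup_sum lookup_single when_def in_keys_iff)

lemma lookup_times_single_one:
  fixes q :: "'m::cancel_comm_monoid_add \<Rightarrow>\<^sub>0 'k::comm_semiring_1"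
  shows "Poly_Mapping.lookup (q * Poly_Mapping.single \<kappa> 1) \<nu> =
    (\<Sum>\<mu>\<in>Poly_Mapping.keys q. if \<mu> + \<kappa> = \<nu> then Poly_Mapping.lookup q \<mu> else 0)"
proof -
  have "q * Poly_Mapping.single \<kappa> 1 =
      (\<Sum>\<mu>\<in>Poly_Mapping.keys q. Poly_Mapping.single \<mu> (Poly_Mapping.lookup q \<mu>)) * Poly_Mapping.single \<kappa> 1"
    by (simp add: poly_mapping_eq_sum_single)
  also have "\<dots> = (\<Sum>\<mu>\<in>Poly_Mapping.keys q. Poly_Mapping.single (\<mu> + \<kappa>) (Poly_Mapping.lookup q \<mu>))"
    by (simp add: sum_distrib_right mult_single)
  finally show ?thesis by (simp add: lookup_sum lookup_single when_def)
qed

text \<open>The ambient field of the construction: an algebraic closure of the fraction field of the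
  polynomials over \<open>'k\<close> in countably many variables.\<close>

definition mpoly_embed :: "((nat \<Rightarrow>\<^sub>0 nat) \<Rightarrow>\<^sub>0 'k::field) \<Rightarrow> ((nat \<Rightarrow>\<^sub>0 nat) \<Rightarrow>\<^sub>0 'k) fract alg_closure" where
  "mpoly_embed p = to_ac (Fract p 1)"

lemma mpoly_embed_hom:
  "mpoly_embed 1 = 1" "mpoly_embed 0 = 0" "mpoly_embed (p - q) = mpoly_embed p - mpoly_embed q"
  "mpoly_embed (p + q) = mpoly_embed p + mpoly_embed q"
  "mpoly_embed (p * q) = mpoly_embed p * mpoly_embed q" "mpoly_embed p = 0 \<longleftrightarrow> p = 0"
proof -
  show "mpoly_embed 1 = 1" "mpoly_embed 0 = 0"
    by (simp_all add: mpoly_embed_def flip: One_fract_def Zero_fract_def)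
  have "Fract (p - q) 1 = Fract p 1 - Fract q 1" "Fract (p + q) 1 = Fract p 1 + Fract q 1"
    "Fract (p * q) 1 = Fract p 1 * Fract q 1" by simp_all
  then show "mpoly_embed (p - q) = mpoly_embed p - mpoly_embed q" "mpoly_embed (p + q) = mpoly_embed p + mpoly_embed q"
    "mpoly_embed (p * q) = mpoly_embed p * mpoly_embed q"
    by (simp_all only: mpoly_embed_def to_ac_diff to_ac_add to_ac_mult)
  show "mpoly_embed p = 0 \<longleftrightarrow> p = 0"
    by (simp add: mpoly_embed_def Zero_fract_def eq_fract)
qed

lemma mpoly_embed_sum: "mpoly_embed (sum f A) = (\<Sum>i\<in>A. mpoly_embed (f i))"
  by (induction A rule: infinite_finite_induct) (auto simp: mpoly_embed_hom)

lemma mpoly_embed_power: "mpoly_embed (p ^ n) = mpoly_embed p ^ n"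
  by (induction n) (auto simp: mpoly_embed_hom)

text \<open>The generated ring lies in the image of the polynomials without variable
  \<open>i\<close>. An algebraic relation for \<open>z i\<close> is then a polynomial identity,
  which fails at a monomial with the top power of variable \<open>i\<close>.\<close>

lemma variables_independent:
  fixes i :: nat
  defines "\<iota> \<equiv> \<lambda>a::'k::field. mpoly_embed (Poly_Mapping.single 0 a)"
    and "z \<equiv> \<lambda>i. mpoly_embed (Poly_Mapping.single (Poly_Mapping.single i 1) 1)"
  shows "\<not> alg_over (ring_gen (range \<iota> \<union> z ` (- {i}))) (z i)"
proof
  define R :: "((nat \<Rightarrow>\<^sub>0 nat) \<Rightarrow>\<^sub>0 'k) set"
    where "R = {p. \<forall>\<mu>\<in>Poly_Mapping.keys p. Poly_Mapping.lookup \<mu> i = 0}"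
  have "is_subring (mpoly_embed ` R)"
    unfolding is_subring_def
  proof (intro conjI ballI)
    have "(1 :: (nat \<Rightarrow>\<^sub>0 nat) \<Rightarrow>\<^sub>0 'k) \<in> R" by (auto simp: R_def)
    then show "1 \<in> mpoly_embed ` R" by (force simp flip: mpoly_embed_hom(1))
    fix x y assume "x \<in> mpoly_embed ` R" "y \<in> mpoly_embed ` R"
    then obtain p q where pq: "p \<in> R" "q \<in> R" "x = mpoly_embed p" "y = mpoly_embed q" by auto
    have "p - q \<in> R"
      using pq(1,2) unfolding R_def by (auto simp: in_keys_iff lookup_minus)
    moreover have "p * q \<in> R"
      using pq(1,2) keys_mult[of p q] unfolding R_def by (force simp: lookup_add)
    ultimately show "x - y \<in> mpoly_embed ` R" "x * y \<in> mpoly_embed ` R"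
      by (auto simp: pq(3,4) simp flip: mpoly_embed_hom)
  qed
  moreover have "range \<iota> \<union> z ` (- {i}) \<subseteq> mpoly_embed ` R"
    unfolding \<iota>_def z_def R_def by (auto intro!: imageI split: if_splits simp: lookup_single when_def)
  ultimately have sub: "ring_gen (range \<iota> \<union> z ` (- {i})) \<subseteq> mpoly_embed ` R" by (rule ring_gen_least)
  assume "alg_over (ring_gen (range \<iota> \<union> z ` (- {i}))) (z i)"
  then obtain p where p: "p \<noteq> 0" "poly_over (mpoly_embed ` R) p" "poly p (z i) = 0"
    using alg_over_mono[OF _ sub] by (auto simp: alg_over_def)
  then have "\<forall>n. \<exists>q. q \<in> R \<and> coeff p n = mpoly_embed q" by (auto simp: poly_over_def)
  then obtain q where q: "\<And>n. q n \<in> R" "\<And>n. coeff p n = mpoly_embed (q n)" by metis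
  let ?x = "\<lambda>n. Poly_Mapping.single i n :: nat \<Rightarrow>\<^sub>0 nat"
  have pow: "Poly_Mapping.single (?x 1) (1::'k) ^ n = Poly_Mapping.single (?x n) 1" for n
    by (induction n) (auto simp: mult_single single_add[symmetric])
  have zp: "z i ^ n = mpoly_embed (Poly_Mapping.single (?x n) 1)" for n
    unfolding z_def mpoly_embed_power[symmetric] pow ..
  have "mpoly_embed (\<Sum>n\<le>degree p. q n * Poly_Mapping.single (?x n) 1) = poly p (z i)"
    by (simp only: poly_altdef q(2) zp mpoly_embed_sum mpoly_embed_hom(5))
  then have s0: "(\<Sum>n\<le>degree p. q n * Poly_Mapping.single (?x n) 1) = 0" using p(3) mpoly_embed_hom(6) by auto
  have "q (degree p) \<noteq> 0" using p(1) q(2)[of "degree p"] by (auto simp: mpoly_embed_hom)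
  then obtain \<mu> where \<mu>: "\<mu> \<in> Poly_Mapping.keys (q (degree p))" by fastforce
  then have \<mu>0: "Poly_Mapping.lookup \<mu> i = 0" using q(1) by (auto simp: R_def)
  \<comment> \<open>In this monomial, variable \<open>i\<close> has exponent
    \<open>degree p\<close>, which occurs only in the summand \<open>n = degree p\<close>.\<close>
  let ?\<nu> = "\<mu> + ?x (degree p)"
  have "Poly_Mapping.lookup (q n * Poly_Mapping.single (?x n) 1) ?\<nu> =
      (if n = degree p then Poly_Mapping.lookup (q n) \<mu> else 0)" for n
  proof (cases "n = degree p")
    case True
    have "(\<Sum>\<mu>'\<in>Poly_Mapping.keys (q n). if \<mu>' + ?x n = ?\<nu> then Poly_Mapping.lookup (q n) \<mu>' else 0)
       = (\<Sum>\<mu>'\<in>Poly_Mapping.keys (q n). if \<mu>' = \<mu> then Poly_Mapping.lookup (q n) \<mu>' else 0)"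
      unfolding True by (intro sum.cong refl) auto
    then show ?thesis using \<mu> True by (simp add: lookup_times_single_one)
  next
    case False
    have "\<mu>' + ?x n \<noteq> ?\<nu>" if "\<mu>' \<in> Poly_Mapping.keys (q n)" for \<mu>'
    proof
      assume "\<mu>' + ?x n = ?\<nu>"
      then have "Poly_Mapping.lookup (\<mu>' + ?x n) i = Poly_Mapping.lookup ?\<nu> i" by simp
      moreover have "Poly_Mapping.lookup \<mu>' i = 0" using that q(1)[of n] by (auto simp: R_def)
      ultimately show False using False \<mu>0 by (simp add: lookup_add)
    qed
    then show ?thesis using False by (simp add: lookup_times_single_one sum.neutral)
  qed
  then have "Poly_Mapping.lookup (\<Sum>n\<le>degree p. q n * Poly_Mapping.single (?x n) 1) ?\<nu> =
      Poly_Mapping.lookup (q (degree p)) \<mu>"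
    by (simp add: lookup_sum)
  then show False using s0 \<mu> by (simp add: in_keys_iff)
qed

section \<open>Coding a small difference field by lists\<close>

lemma inj_flatten_pairs:
  "concat (map (\<lambda>p. [fst p, snd p]) l) = concat (map (\<lambda>p. [fst p, snd p]) l') \<Longrightarrow> l = l'"
proof (induction l arbitrary: l')
  case Nil
  then show ?case by (cases l') auto
next
  case (Cons p l)
  then show ?case by (cases l') (auto simp: prod_eq_iff)
qed

text \<open>The closure of the image of \<open>\<iota>\<close> under the operations \<open>f\<close> is enumerated by programs for a stack
  machine, which are lists over \<open>'k\<close>.\<close>

lemma small_closure:
  fixes \<iota> :: "'k::zero_neq_one \<Rightarrow> 'b" and f :: "'k \<Rightarrow> 'b \<Rightarrow> 'b \<Rightarrow> 'b"
  shows "\<exists>C (g :: 'b \<Rightarrow> 'k list). range \<iota> \<subseteq> C \<and> (\<forall>a. \<forall>u\<in>C. \<forall>v\<in>C. f a u v \<in> C) \<and> inj_on g C"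
proof -
  \<comment> \<open>The instruction \<open>(0, b)\<close> pushes \<open>\<iota> b\<close>; with a
    nonzero flag, \<open>b\<close> selects the operation that replaces the two topmost
    entries.\<close>
  define st where "st = (\<lambda>s (a, b). if a = (0::'k) then \<iota> b # s
    else case s of u # v # r \<Rightarrow> f b u v # r | _ \<Rightarrow> s)"
  \<comment> \<open>The program must work on every initial stack, so that programs can be
    concatenated. An element can be recovered from its program, which gives injectivity
    below.\<close>
  define C where "C = {x. \<exists>l. \<forall>s. foldl st s l = x # s}"
  have "\<iota> b \<in> C" for b
    unfolding C_def by (auto intro!: exI[of _ "[(0, b)]"] simp: st_def)
  moreover have "f a u v \<in> C" if uv: "u \<in> C" "v \<in> C" for a u v
  proof -
    obtain l l' where "\<And>s. foldl st s l = u # s" "\<And>s. foldl st s l' = v # s"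
      using uv by (auto simp: C_def)
    \<comment> \<open>The program for \<open>v\<close> runs first, so that \<open>u\<close> ends up
      on top.\<close>
    then have "foldl st s (l' @ l @ [(1, a)]) = f a u v # s" for s by (simp add: st_def)
    then show ?thesis unfolding C_def by blast
  qed
  moreover have "\<exists>g :: 'b \<Rightarrow> 'k list. inj_on g C"
  proof -
    have "\<forall>x\<in>C. \<exists>l. \<forall>s. foldl st s l = x # s" by (simp add: C_def)
    then obtain l where l: "\<And>x s. x \<in> C \<Longrightarrow> foldl st s (l x) = x # s" by metis
    have "inj_on l C"
    proof (rule inj_onI)
      fix x y assume xy: "x \<in> C" "y \<in> C" "l x = l y"
      have "[x] = foldl st [] (l x)" by (rule l[OF xy(1), symmetric])
      also have "\<dots> = foldl st [] (l y)" by (simp only: xy(3))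
      also have "\<dots> = [y]" by (rule l[OF xy(2)])
      finally show "x = y" by (rule list.inject[THEN iffD1, THEN conjunct1])
    qed
    then have "inj_on ((\<lambda>l. concat (map (\<lambda>p. [fst p, snd p]) l)) \<circ> l) C"
      by (rule comp_inj_on) (rule inj_onI, rule inj_flatten_pairs)
    then show ?thesis by blast
  qed
  ultimately show ?thesis by (intro exI[of _ C]) auto
qed

text \<open>Moves evaluation in a ring with explicit carrier to ordinary sums and products. It
  serves for the coded extension, with \<open>h\<close> the decoding map, and for \<open>'k\<close>
  itself, with \<open>h\<close> the identity.\<close>

lemma diff_poly_eval_transport:
  fixes h :: "'l \<Rightarrow> 'b::field" and \<iota> :: "'k::zero \<Rightarrow> 'l"
  assumes L: "cring L"
    and h: "\<And>x y. x \<in> carrier L \<Longrightarrow> y \<in> carrier L \<Longrightarrow> h (x \<oplus>\<^bsub>L\<^esub> y) = h x + h y"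
      "\<And>x y. x \<in> carrier L \<Longrightarrow> y \<in> carrier L \<Longrightarrow> h (x \<otimes>\<^bsub>L\<^esub> y) = h x * h y"
      "h \<one>\<^bsub>L\<^esub> = 1" "h \<zero>\<^bsub>L\<^esub> = 0"
    and c: "\<And>c. \<iota> c \<in> carrier L" "\<And>i. a i \<in> carrier L" "\<And>x. x \<in> carrier L \<Longrightarrow> \<tau> x \<in> carrier L"
    and \<tau>: "\<And>x. x \<in> carrier L \<Longrightarrow> h (\<tau> x) = \<phi> (h x)"
  shows "diff_poly_eval L \<tau> \<iota> p a \<in> carrier L"
    "h (diff_poly_eval L \<tau> \<iota> p a) = (\<Sum>m\<in>Poly_Mapping.keys p. h (\<iota> (Poly_Mapping.lookup p m)) *
      (\<Prod>q\<in>Poly_Mapping.keys m. (\<phi> ^^ snd q) (h (a (fst q))) ^ Poly_Mapping.lookup m q))"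
proof -
  interpret L: cring L by (rule L)
  have fs: "h (finsum L f A) = (\<Sum>i\<in>A. h (f i))" if "finite A" "\<And>i. i \<in> A \<Longrightarrow> f i \<in> carrier L" for f A
    using that by (induction A rule: finite_induct) (auto simp: h L.finsum_insert Pi_def L.finsum_closed)
  have fp: "h (finprod L f A) = (\<Prod>i\<in>A. h (f i))" if "finite A" "\<And>i. i \<in> A \<Longrightarrow> f i \<in> carrier L" for f A
    using that by (induction A rule: finite_induct) (auto simp: h L.finprod_insert Pi_def L.finprod_closed)
  have pw: "h (x [^]\<^bsub>L\<^esub> n) = h x ^ n" if "x \<in> carrier L" for x and n :: nat
    using that by (induction n) (auto simp: h mult_ac)
  have it: "(\<tau> ^^ j) x \<in> carrier L \<and> h ((\<tau> ^^ j) x) = (\<phi> ^^ j) (h x)" if "x \<in> carrier L" for x j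
    using that by (induction j) (auto simp: c \<tau>)
  have e: "diff_poly_eval L \<tau> \<iota> p a = finsum L (\<lambda>m. \<iota> (Poly_Mapping.lookup p m) \<otimes>\<^bsub>L\<^esub>
      finprod L (\<lambda>q. (\<tau> ^^ snd q) (a (fst q)) [^]\<^bsub>L\<^esub> Poly_Mapping.lookup m q)
           (Poly_Mapping.keys m)) (Poly_Mapping.keys p)"
    by (simp add: diff_poly_eval_def split_beta')
  have t: "(\<tau> ^^ j) (a i) [^]\<^bsub>L\<^esub> n \<in> carrier L" for i j and n :: nat
    by (rule L.nat_pow_closed[OF it[OF c(2), THEN conjunct1]])
  have ht: "h ((\<tau> ^^ j) (a i) [^]\<^bsub>L\<^esub> n) = (\<phi> ^^ j) (h (a i)) ^ n" for i j and n :: nat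
    using pw[OF it[OF c(2), THEN conjunct1]] it[OF c(2), THEN conjunct2] by simp
  have fpc: "finprod L (\<lambda>q. (\<tau> ^^ snd q) (a (fst q)) [^]\<^bsub>L\<^esub> Poly_Mapping.lookup m q)
           (Poly_Mapping.keys m) \<in> carrier L" for m :: "nat \<times> nat \<Rightarrow>\<^sub>0 nat"
    by (intro L.finprod_closed Pi_I t)
  have hfp: "h (finprod L (\<lambda>q. (\<tau> ^^ snd q) (a (fst q)) [^]\<^bsub>L\<^esub> Poly_Mapping.lookup m q)
      (Poly_Mapping.keys m)) = (\<Prod>q\<in>Poly_Mapping.keys m. (\<phi> ^^ snd q) (h (a (fst q))) ^ Poly_Mapping.lookup m q)" for m :: "nat \<times> nat \<Rightarrow>\<^sub>0 nat"
    by (subst fp[OF finite_keys t]) (simp only: ht)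
  have tc: "\<iota> u \<otimes>\<^bsub>L\<^esub> finprod L (\<lambda>q. (\<tau> ^^ snd q) (a (fst q)) [^]\<^bsub>L\<^esub> Poly_Mapping.lookup m q)
      (Poly_Mapping.keys m) \<in> carrier L" for u and m :: "nat \<times> nat \<Rightarrow>\<^sub>0 nat"
    by (rule L.m_closed[OF c(1) fpc])
  show "diff_poly_eval L \<tau> \<iota> p a \<in> carrier L"
    unfolding e by (intro L.finsum_closed Pi_I tc)
  show "h (diff_poly_eval L \<tau> \<iota> p a) = (\<Sum>m\<in>Poly_Mapping.keys p. h (\<iota> (Poly_Mapping.lookup p m)) *
      (\<Prod>q\<in>Poly_Mapping.keys m. (\<phi> ^^ snd q) (h (a (fst q))) ^ Poly_Mapping.lookup m q))"
    unfolding e by (subst fs[OF finite_keys tc]) (simp only: h(2)[OF c(1) fpc] hfp)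
qed

lemma monomial_value_add:
  fixes y :: "'q \<Rightarrow> 'b::comm_semiring_1" and m m' :: "'q \<Rightarrow>\<^sub>0 nat"
  defines "V \<equiv> \<lambda>m. \<Prod>q\<in>Poly_Mapping.keys m. y q ^ Poly_Mapping.lookup m q"
  shows "V (m + m') = V m * V m'"
proof -
  let ?U = "Poly_Mapping.keys m \<union> Poly_Mapping.keys m'"
  have V: "V l = (\<Prod>q\<in>?U. y q ^ Poly_Mapping.lookup l q)" if "Poly_Mapping.keys l \<subseteq> ?U" for l
    unfolding V_def using that by (intro prod.mono_neutral_left) (auto simp: in_keys_iff)
  have k: "Poly_Mapping.keys (m + m') \<subseteq> ?U" by (rule keys_add)
  show ?thesis by (simp add: V[OF k] V lookup_add power_add prod.distrib)
qed

lemma monomial_value_sum_single: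
  fixes y :: "'q \<Rightarrow> 'b::comm_semiring_1"
  shows "finite A \<Longrightarrow> (\<Prod>q\<in>Poly_Mapping.keys (\<Sum>j\<in>A. Poly_Mapping.single (v j) (e j :: nat)).
      y q ^ Poly_Mapping.lookup (\<Sum>j\<in>A. Poly_Mapping.single (v j) (e j)) q) = (\<Prod>j\<in>A. y (v j) ^ e j)"
  by (induction A rule: finite_induct) (auto simp: monomial_value_add)

text \<open>The \<open>M j\<close> may coincide and coefficients may cancel, so the keys of the sum
  are not known; additivity of \<open>\<iota>\<close> makes this harmless, by summing over a common
  superset of the keys.\<close>

lemma poly_value_sum_single:
  fixes \<iota> :: "'k::comm_monoid_add \<Rightarrow> 'b::comm_semiring_1"
  assumes \<iota>: "\<iota> 0 = 0" "\<And>x y. \<iota> (x + y) = \<iota> x + \<iota> y" and "finite A"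
  shows "(\<Sum>m\<in>Poly_Mapping.keys (\<Sum>j\<in>A. Poly_Mapping.single (M j) (e j)).
      \<iota> (Poly_Mapping.lookup (\<Sum>j\<in>A. Poly_Mapping.single (M j) (e j)) m) * V m) = (\<Sum>j\<in>A. \<iota> (e j) * V (M j))"
  using assms(3)
proof (induction A rule: finite_induct)
  case (insert j A)
  let ?p = "\<Sum>j\<in>A. Poly_Mapping.single (M j) (e j)" and ?s = "Poly_Mapping.single (M j) (e j)"
  let ?U = "Poly_Mapping.keys ?p \<union> {M j}"
  have E: "(\<Sum>m\<in>Poly_Mapping.keys l. \<iota> (Poly_Mapping.lookup l m) * V m) =
      (\<Sum>m\<in>?U. \<iota> (Poly_Mapping.lookup l m) * V m)" if "Poly_Mapping.keys l \<subseteq> ?U" for l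
    using that by (intro sum.mono_neutral_left) (auto simp: in_keys_iff \<iota>)
  have k: "Poly_Mapping.keys (?s + ?p) \<subseteq> ?U" using keys_add[of ?s ?p] by (auto split: if_splits)
  have ks: "Poly_Mapping.keys ?s \<subseteq> ?U" by auto
  have "(\<Sum>m\<in>Poly_Mapping.keys (?s + ?p). \<iota> (Poly_Mapping.lookup (?s + ?p) m) * V m) =
      (\<Sum>m\<in>?U. \<iota> (Poly_Mapping.lookup ?s m) * V m) + (\<Sum>m\<in>?U. \<iota> (Poly_Mapping.lookup ?p m) * V m)"
    by (subst E[OF k]) (simp only: lookup_add \<iota>(2) distrib_right sum.distrib)
  also have "\<dots> = (\<Sum>m\<in>Poly_Mapping.keys ?s. \<iota> (Poly_Mapping.lookup ?s m) * V m) + (\<Sum>j\<in>A. \<iota> (e j) * V (M j))"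
    by (simp only: E[OF ks, symmetric] insert.IH[symmetric] E[OF Un_upper1, symmetric])
  also have "(\<Sum>m\<in>Poly_Mapping.keys ?s. \<iota> (Poly_Mapping.lookup ?s m) * V m) = \<iota> (e j) * V (M j)"
    by (cases "e j = 0") (auto simp: \<iota>)
  finally show ?case using insert.hyps by simp
qed auto

text \<open>The generic construction yields a nonzero solution in a large field. It is restricted to
  a difference subfield small enough to be coded by lists, where the equation
  \<open>x_0 * x_1 = 1\<close> records that the solution is nonzero.\<close>

lemma ACFA_single_equation:
  fixes \<sigma> :: "'k::field_char_0 \<Rightarrow> 'k"
  assumes A: "ACFA \<sigma>"
    and S: "finite S" "\<alpha>0 \<in> S" "\<beta>0 \<in> S" "\<alpha>0 \<noteq> \<beta>0"
      "\<And>\<alpha> \<beta>. \<alpha> \<in> S \<Longrightarrow> \<beta> \<in> S \<Longrightarrow> (\<forall>j\<le>d. \<alpha> j = \<beta> j) \<Longrightarrow> \<alpha> = \<beta>"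
    and c: "\<And>\<alpha>. \<alpha> \<in> S \<Longrightarrow> c \<alpha> \<noteq> 0"
  shows "\<exists>x. x \<noteq> 0 \<and> (\<Sum>\<alpha>\<in>S. c \<alpha> * (\<Prod>j\<le>d. (\<sigma> ^^ j) x ^ \<alpha> j)) = 0"
proof -
  define \<iota> where "\<iota> = (\<lambda>a::'k. mpoly_embed (Poly_Mapping.single 0 a))"
  define z where "z = (\<lambda>i. mpoly_embed (Poly_Mapping.single (Poly_Mapping.single i 1) (1::'k)))"
  have aut: "field_automorphism \<sigma>" using A by (simp add: ACFA_def)
  have \<iota>: "\<iota> 1 = 1" "\<And>x y. \<iota> (x - y) = \<iota> x - \<iota> y" "\<And>x y. \<iota> (x * y) = \<iota> x * \<iota> y" "\<iota> 0 = 0"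
    "\<And>x y. \<iota> (x + y) = \<iota> x + \<iota> y"
    unfolding \<iota>_def by (simp_all add: single_diff single_add mpoly_embed_hom)
       (simp_all add: mult_single flip: mpoly_embed_hom)
  have inf: "infinite (UNIV :: 'k set)" by (rule infinite_UNIV_char_0)
  have zi: "\<not> alg_over (ring_gen (range \<iota> \<union> z ` (- {i}))) (z i)" for i
    unfolding \<iota>_def z_def by (rule variables_independent)
  have "\<exists>W \<phi> x. alg_closed_in W \<and> range \<iota> \<subseteq> W \<and> bij_betw \<phi> W W \<and> (\<forall>a. \<phi> (\<iota> a) = \<iota> (\<sigma> a)) \<and>
    (\<forall>x\<in>W. \<forall>y\<in>W. \<phi> (x + y) = \<phi> x + \<phi> y \<and> \<phi> (x * y) = \<phi> x * \<phi> y) \<and> x \<in> W \<and> x \<noteq> 0 \<and>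
    (\<Sum>\<alpha>\<in>S. \<iota> (c \<alpha>) * (\<Prod>j\<le>d. (\<phi> ^^ j) x ^ \<alpha> j)) = 0"
    by (rule difference_equation_solvable[OF \<iota>(1-3) inf aut zi S(1-4)]; (rule S(5) c; assumption)?)
  then obtain W \<phi> x where D: "alg_closed_in W \<and> range \<iota> \<subseteq> W \<and> bij_betw \<phi> W W \<and> (\<forall>a. \<phi> (\<iota> a) = \<iota> (\<sigma> a)) \<and>
    (\<forall>x\<in>W. \<forall>y\<in>W. \<phi> (x + y) = \<phi> x + \<phi> y \<and> \<phi> (x * y) = \<phi> x * \<phi> y) \<and> x \<in> W \<and> x \<noteq> 0 \<and>
    (\<Sum>\<alpha>\<in>S. \<iota> (c \<alpha>) * (\<Prod>j\<le>d. (\<phi> ^^ j) x ^ \<alpha> j)) = 0"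
    by (elim exE)
  from D have W: "alg_closed_in W" "range \<iota> \<subseteq> W" "bij_betw \<phi> W W" "\<And>a. \<phi> (\<iota> a) = \<iota> (\<sigma> a)"
    "\<And>x y. x \<in> W \<Longrightarrow> y \<in> W \<Longrightarrow> \<phi> (x + y) = \<phi> x + \<phi> y" "\<And>x y. x \<in> W \<Longrightarrow> y \<in> W \<Longrightarrow> \<phi> (x * y) = \<phi> x * \<phi> y"
    and x: "x \<in> W" "x \<noteq> 0" "(\<Sum>\<alpha>\<in>S. \<iota> (c \<alpha>) * (\<Prod>j\<le>d. (\<phi> ^^ j) x ^ \<alpha> j)) = 0"
    by simp_all
  \<comment> \<open>Closing the subfield under the inverse as well keeps \<open>\<phi>\<close>
    surjective on it.\<close>
  define \<psi> where "\<psi> = inv_into W \<phi>"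
  have \<psi>: "\<psi> u \<in> W" "\<phi> (\<psi> u) = u" if "u \<in> W" for u
    using W(3) that unfolding \<psi>_def by (auto simp: bij_betw_def inv_into_into f_inv_into_f)
  have \<phi>W: "\<phi> u \<in> W" if "u \<in> W" for u using W(3) that by (auto simp: bij_betw_def)
  \<comment> \<open>The operations are numbered by elements of \<open>'k\<close>; \<open>0\<close>
    to \<open>6\<close> are distinct in characteristic zero. Unary operations ignore the second
    argument, and code \<open>0\<close> is the constant \<open>x\<close>.\<close>
  define f where "f = (\<lambda>(a::'k) u v. if a = 0 then x else if a = 1 then u + v else if a = 2 then u * v
    else if a = 3 then - u else if a = 4 then inverse u else if a = 5 then \<phi> u else \<psi> u)"
  obtain C' and g :: "_ \<Rightarrow> 'k list" where C': "range \<iota> \<subseteq> C'" "\<And>a u v. u \<in> C' \<Longrightarrow> v \<in> C' \<Longrightarrow> f a u v \<in> C'" "inj_on g C'"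
    using small_closure[of \<iota> f] by blast
  \<comment> \<open>\<open>\<phi>\<close> and \<open>\<psi>\<close> behave well only on
    \<open>W\<close>, which is closed under all these operations.\<close>
  define C where "C = C' \<inter> W"
  have Wr: "is_subring W" using W(1) by (simp add: alg_closed_in_def)
  have Winv: "inverse u \<in> W" if "u \<in> W" for u
  proof (cases "u = 0")
    case False
    have "poly_over W [:-1, u:]"
      using that is_subringD[OF Wr] by (auto intro!: poly_over_basic Wr)
    moreover have "poly [:-1, u:] (inverse u) = 0" "[:-1, u:] \<noteq> 0" using False by auto
    ultimately have "alg_over W (inverse u)" unfolding alg_over_def by blast
    then show ?thesis using W(1) by (simp add: alg_closed_in_def)
  qed (use that in auto)
  have Cc: "\<iota> a \<in> C" "x \<in> C" "u \<in> C \<Longrightarrow> v \<in> C \<Longrightarrow> u + v \<in> C" "u \<in> C \<Longrightarrow> v \<in> C \<Longrightarrow> u * v \<in> C"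
    "u \<in> C \<Longrightarrow> - u \<in> C" "u \<in> C \<Longrightarrow> inverse u \<in> C" "u \<in> C \<Longrightarrow> \<phi> u \<in> C" "u \<in> C \<Longrightarrow> \<psi> u \<in> C" for a u v
    using W(2) C'(1) C'(2)[of "\<iota> 0" "\<iota> 0" 0] x(1) C'(2)[of u v 1] C'(2)[of u v 2] C'(2)[of u u 3] C'(2)[of u u 4]
      C'(2)[of u u 5] C'(2)[of u u 6] is_subringD[OF Wr] Winv \<psi>(1) \<phi>W
    unfolding C_def f_def by auto
  have C01: "0 \<in> C" "1 \<in> C" using Cc(1)[of 0] Cc(1)[of 1] \<iota> by auto
  have CW: "C \<subseteq> W" by (auto simp: C_def)
  have ginj: "inj_on g C" using C'(3) by (auto simp: C_def inj_on_def)
  define h where "h = inv_into C g"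
  have hg: "h (g u) = u" if "u \<in> C" for u unfolding h_def using ginj that by simp
  have hC: "h w \<in> C" "g (h w) = w" if "w \<in> g ` C" for w
    using that unfolding h_def by (auto simp: inv_into_into f_inv_into_f)
  \<comment> \<open>The field operations of \<open>C\<close> are transported to the lists along
    \<open>g\<close>.\<close>
  define L :: "'k list ring" where "L = \<lparr>carrier = g ` C, monoid.mult = (\<lambda>u v. g (h u * h v)), one = g 1,
    ring.zero = g 0, add = (\<lambda>u v. g (h u + h v))\<rparr>"
  have Lsimp: "carrier L = g ` C" "u \<otimes>\<^bsub>L\<^esub> v = g (h u * h v)" "u \<oplus>\<^bsub>L\<^esub> v = g (h u + h v)"
    "\<one>\<^bsub>L\<^esub> = g 1" "\<zero>\<^bsub>L\<^esub> = g 0" for u v by (simp_all add: L_def)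
  have Lcring: "cring L"
  proof (rule cringI)
    show "abelian_group L"
    proof (rule abelian_groupI)
      fix u assume "u \<in> carrier L"
      then show "\<exists>v\<in>carrier L. v \<oplus>\<^bsub>L\<^esub> u = \<zero>\<^bsub>L\<^esub>"
        by (intro bexI[of _ "g (- h u)"]) (auto simp: Lsimp hg Cc)
    qed (auto simp: Lsimp hg Cc C01 add_ac)
    show "comm_monoid L"
      by (rule comm_monoidI) (auto simp: Lsimp hg Cc C01 mult_ac)
  qed (auto simp: Lsimp hg Cc C01 algebra_simps)
  then interpret L: cring L .
  have Lfield: "field L"
  proof (rule L.cring_fieldI2)
    show "\<zero>\<^bsub>L\<^esub> \<noteq> \<one>\<^bsub>L\<^esub>" using inj_onD[OF ginj _ C01] zero_neq_one unfolding Lsimp by blast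
    fix u assume u: "u \<in> carrier L" "u \<noteq> \<zero>\<^bsub>L\<^esub>"
    then have "h u \<noteq> 0" using hC(2)[of u] by (auto simp: Lsimp)
    then show "\<exists>v\<in>carrier L. u \<otimes>\<^bsub>L\<^esub> v = \<one>\<^bsub>L\<^esub>"
      using u(1) by (intro bexI[of _ "g (inverse (h u))"]) (auto simp: Lsimp hg Cc)
  qed
  define \<tau> where "\<tau> = (\<lambda>w. g (\<phi> (h w)))"
  have \<tau>: "\<tau> \<in> ring_iso L L"
    unfolding ring_iso_def
  proof (intro CollectI conjI ring_hom_memI)
    have "\<phi> 1 = 1" using W(4)[of 1] \<iota>(1) aut by (simp add: field_automorphism_def)
    then show "\<tau> \<one>\<^bsub>L\<^esub> = \<one>\<^bsub>L\<^esub>" by (simp add: \<tau>_def Lsimp hg C01)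
    fix u v assume u: "u \<in> carrier L"
    then show "\<tau> u \<in> carrier L" by (auto simp: \<tau>_def Lsimp hg Cc)
    assume v: "v \<in> carrier L"
    have hW: "h u \<in> W" "h v \<in> W" using hC u v CW by (auto simp: Lsimp hg)
    show "\<tau> (u \<otimes>\<^bsub>L\<^esub> v) = \<tau> u \<otimes>\<^bsub>L\<^esub> \<tau> v" "\<tau> (u \<oplus>\<^bsub>L\<^esub> v) = \<tau> u \<oplus>\<^bsub>L\<^esub> \<tau> v"
      using u v hW by (auto simp: \<tau>_def Lsimp hg Cc W(5,6))
  next
    show "bij_betw \<tau> (carrier L) (carrier L)"
    proof (rule bij_betw_imageI)
      show "inj_on \<tau> (carrier L)"
      proof (rule inj_onI)
        fix u v assume uv: "u \<in> carrier L" "v \<in> carrier L" "\<tau> u = \<tau> v"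
        then have hh: "h u \<in> C" "h v \<in> C" by (auto simp: Lsimp hC)
        have "\<phi> (h u) = \<phi> (h v)" using inj_onD[OF ginj] uv(3) hh Cc(7) by (auto simp: \<tau>_def)
        moreover have "inj_on \<phi> W" using W(3) by (simp add: bij_betw_def)
        ultimately have "h u = h v" using hh CW by (meson inj_onD subsetD)
        moreover have "g (h u) = u" "g (h v) = v" using hC(2) uv(1,2) unfolding Lsimp by blast+
        ultimately show "u = v" by metis
      qed
      have "\<tau> u \<in> carrier L" if "u \<in> carrier L" for u using that by (auto simp: \<tau>_def Lsimp hg Cc)
      moreover have "u \<in> \<tau> ` carrier L" if "u \<in> carrier L" for u
      proof (rule image_eqI[of _ _ "g (\<psi> (h u))"])
        have hh: "h u \<in> C" using that by (simp add: Lsimp hC)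
        then show "u = \<tau> (g (\<psi> (h u)))" using \<psi>(2)[of "h u"] CW that hC(2)[of u]
          by (auto simp: \<tau>_def hg Cc Lsimp)
        show "g (\<psi> (h u)) \<in> carrier L" using hh by (simp add: Lsimp Cc)
      qed
      ultimately show "\<tau> ` carrier L = carrier L" by blast
    qed
  qed
  define \<iota>' where "\<iota>' a = g (\<iota> a)" for a
  have ext: "difference_field_extension \<sigma> L \<tau> \<iota>'"
    unfolding difference_field_extension_def
    by (intro conjI Lfield \<tau> ring_hom_memI allI)
      (auto simp: ring_of_type_algebra_def \<iota>'_def Lsimp Cc hg \<iota> \<tau>_def W(4))
  define a where "a = (\<lambda>i::nat. if i = 0 then g x else g (inverse x))"
  have aL: "a i \<in> carrier L" for i by (auto simp: a_def Lsimp Cc)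
  define mon where "mon \<alpha> = (\<Sum>j\<in>{..d}. Poly_Mapping.single (0::nat, j) (\<alpha> j))" for \<alpha> :: "nat \<Rightarrow> nat"
  define p1 where "p1 = (\<Sum>\<alpha>\<in>S. Poly_Mapping.single (mon \<alpha>) (c \<alpha>))"
  \<comment> \<open>\<open>pr True\<close> is the monomial \<open>x_0 * x_1\<close> and
    \<open>pr False\<close> is \<open>1\<close>, so \<open>p2\<close> is
    \<open>x_0 * x_1 - 1\<close>.\<close>
  define pr :: "bool \<Rightarrow> (nat \<times> nat) \<Rightarrow>\<^sub>0 nat"
    where "pr b = (\<Sum>i\<in>(if b then {0, 1} else {}). Poly_Mapping.single (i, 0) 1)" for b
  define p2 where "p2 = (\<Sum>b\<in>UNIV. Poly_Mapping.single (pr b) (if b then 1 else - 1 :: 'k))"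
  have ev1: "(\<Sum>m\<in>Poly_Mapping.keys p1. \<kappa> (Poly_Mapping.lookup p1 m) *
      (\<Prod>q\<in>Poly_Mapping.keys m. (F ^^ snd q) (y (fst q)) ^ Poly_Mapping.lookup m q)) =
      (\<Sum>\<alpha>\<in>S. \<kappa> (c \<alpha>) * (\<Prod>j\<le>d. (F ^^ j) (y 0) ^ \<alpha> j))"
    if "\<kappa> 0 = 0" "\<And>x y. \<kappa> (x + y) = \<kappa> x + \<kappa> y" for \<kappa> :: "'k \<Rightarrow> 'c::field" and F y
    unfolding p1_def by (subst poly_value_sum_single[OF that S(1)]) (simp add: mon_def monomial_value_sum_single)
  have ev2: "(\<Sum>m\<in>Poly_Mapping.keys p2. \<kappa> (Poly_Mapping.lookup p2 m) *
      (\<Prod>q\<in>Poly_Mapping.keys m. (F ^^ snd q) (y (fst q)) ^ Poly_Mapping.lookup m q)) =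
      \<kappa> 1 * (y 0 * y 1) + \<kappa> (- 1)"
    if "\<kappa> 0 = 0" "\<And>x y. \<kappa> (x + y) = \<kappa> x + \<kappa> y" for \<kappa> :: "'k \<Rightarrow> 'c::field" and F y
    unfolding p2_def by (subst poly_value_sum_single[OF that])
      (simp_all add: UNIV_bool pr_def monomial_value_sum_single del: sum.insert, simp)
  note tr = diff_poly_eval_transport[OF Lcring, of h \<iota>' a \<tau> \<phi>]
  have trc: "diff_poly_eval L \<tau> \<iota>' p a \<in> carrier L \<and> h (diff_poly_eval L \<tau> \<iota>' p a) =
     (\<Sum>m\<in>Poly_Mapping.keys p. h (\<iota>' (Poly_Mapping.lookup p m)) *
      (\<Prod>q\<in>Poly_Mapping.keys m. (\<phi> ^^ snd q) (h (a (fst q))) ^ Poly_Mapping.lookup m q))" for p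
    by (intro conjI tr) (auto simp: Lsimp hg Cc C01 \<iota>'_def aL[unfolded Lsimp] \<tau>_def)
  have h\<iota>: "h (\<iota>' u) = \<iota> u" for u by (simp add: \<iota>'_def hg Cc)
  have "h (diff_poly_eval L \<tau> \<iota>' p1 a) = 0" "h (diff_poly_eval L \<tau> \<iota>' p2 a) = 0"
    using trc ev1[of \<iota> \<phi> "\<lambda>i. h (a i)"] ev2[of \<iota> \<phi> "\<lambda>i. h (a i)"] x \<iota>(2)[of 0 1]
    by (simp_all add: h\<iota> \<iota> a_def hg Cc)
  then have "diff_poly_eval L \<tau> \<iota>' p a = \<zero>\<^bsub>L\<^esub>" if "p \<in> {p1, p2}" for p
    using that trc[of p] hC(2)[of "diff_poly_eval L \<tau> \<iota>' p a"] by (auto simp: Lsimp)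
  then have sol: "has_solution L \<tau> \<iota>' {p1, p2}" unfolding has_solution_def using aL by blast
  have "has_solution ring_of_type_algebra \<sigma> id {p1, p2}"
    by (rule A[unfolded ACFA_def, THEN conjunct2, THEN spec, THEN mp, THEN mp])
      (simp, intro exI conjI, rule ext, rule sol)
  then obtain y :: "nat \<Rightarrow> 'k" where y: "\<And>p. p \<in> {p1, p2} \<Longrightarrow> diff_poly_eval ring_of_type_algebra \<sigma> id p y = 0"
    unfolding has_solution_def by (auto simp: ring_of_type_algebra_def)
  have "diff_poly_eval ring_of_type_algebra \<sigma> id p y =
     (\<Sum>m\<in>Poly_Mapping.keys p. id (Poly_Mapping.lookup p m) *
      (\<Prod>q\<in>Poly_Mapping.keys m. (\<sigma> ^^ snd q) (y (fst q)) ^ Poly_Mapping.lookup m q))" for p :: "'k diff_poly"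
    using diff_poly_eval_transport(2)[OF cring_from_type_algebra, of id id y \<sigma> \<sigma> p]
    by (simp add: ring_of_type_algebra_def)
  then have "(\<Sum>\<alpha>\<in>S. c \<alpha> * (\<Prod>j\<le>d. (\<sigma> ^^ j) (y 0) ^ \<alpha> j)) = 0" "y 0 * y 1 - 1 = 0"
    using y[of p1] y[of p2] ev1[of id \<sigma> y] ev2[of id \<sigma> y] by simp_all
  then show ?thesis by (intro exI[of _ "y 0"]) auto
qed

section \<open>Taylor expansion of difference polynomials\<close>

text \<open>Extensional functions give one representative per exponent in the variables up to
  \<open>d\<close>, so the box is finite and its members are determined by these entries.\<close>

definition exp_box :: "nat \<Rightarrow> nat \<Rightarrow> (nat \<Rightarrow> nat) set" where
  "exp_box d N = PiE {..d} (\<lambda>_. {..N})"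

lemma finite_exp_box: "finite (exp_box d N)"
  unfolding exp_box_def by (rule finite_PiE) auto

lemma exp_box_le: "\<alpha> \<in> exp_box d N \<Longrightarrow> j \<le> d \<Longrightarrow> \<alpha> j \<le> N"
  unfolding exp_box_def by (auto simp: PiE_iff)

lemma exp_box_eqI: "\<alpha> \<in> exp_box d N \<Longrightarrow> \<beta> \<in> exp_box d N \<Longrightarrow> (\<And>j. j \<le> d \<Longrightarrow> \<alpha> j = \<beta> j) \<Longrightarrow> \<alpha> = \<beta>"
  unfolding exp_box_def by (rule PiE_ext) auto

definition box_zero :: "nat \<Rightarrow> nat \<Rightarrow> nat" where
  "box_zero d = (\<lambda>j\<in>{..d}. 0)"

lemma box_zero_in: "box_zero d \<in> exp_box d N"
  unfolding exp_box_def box_zero_def by auto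

lemma box_zero_eq: "j \<le> d \<Longrightarrow> box_zero d j = 0"
  by (simp add: box_zero_def)

text \<open>The divided partial derivatives of \<open>\<Sum> c\<^sub>\<alpha> y\<^sup>\<alpha>\<close> in the variables \<open>y\<^sub>0, \<dots>, y\<^sub>d\<close>.\<close>

definition taylor :: "nat \<Rightarrow> nat \<Rightarrow> ((nat \<Rightarrow> nat) \<Rightarrow> 'a::field) \<Rightarrow> (nat \<Rightarrow> 'a) \<Rightarrow> (nat \<Rightarrow> nat) \<Rightarrow> 'a" where
  "taylor d N c y I = (\<Sum>\<alpha>\<in>exp_box d N. c \<alpha> * (\<Prod>j\<le>d. of_nat (\<alpha> j choose I j) * y j ^ (\<alpha> j - I j)))"

text \<open>By \<open>(a choose i) * (i choose l) = (a choose l) * ((a - l) choose (i - l))\<close>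
  this is the binomial theorem. Summing up to \<open>N\<close> adds only zero terms and gives all
  variables one range.\<close>

lemma binomial_taylor:
  fixes y h :: "'a::field"
  assumes "a \<le> N"
  shows "(\<Sum>i\<le>N. of_nat (a choose i) * y ^ (a - i) * (of_nat (i choose l) * h ^ (i - l))) =
    of_nat (a choose l) * (y + h) ^ (a - l)"
proof (cases "l \<le> a")
  case False
  have "(a choose i) = 0 \<or> (i choose l) = 0" for i
    using False by (cases "i \<le> a") (auto simp: binomial_eq_0)
  then have "of_nat (a choose i) * y ^ (a - i) * (of_nat (i choose l) * h ^ (i - l)) = 0" for i
    by (metis mult_zero_left mult_zero_right of_nat_0)
  then show ?thesis using False by (simp add: binomial_eq_0 not_le sum.neutral)
next
  case True
  have "(\<Sum>i\<le>N. of_nat (a choose i) * y ^ (a - i) * (of_nat (i choose l) * h ^ (i - l))) =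
    (\<Sum>i\<in>{l..a}. of_nat (a choose i) * y ^ (a - i) * (of_nat (i choose l) * h ^ (i - l)))"
    using assms by (intro sum.mono_neutral_right) (auto simp: binomial_eq_0 not_le)
  also have "\<dots> = (\<Sum>k\<in>{0..a - l}. of_nat (a choose (k + l)) * y ^ (a - (k + l)) * (of_nat ((k + l) choose l) * h ^ k))"
    using True sum.shift_bounds_cl_nat_ivl[of "\<lambda>i. of_nat (a choose i) * y ^ (a - i) * (of_nat (i choose l) * h ^ (i - l))" 0 l "a - l"]
    by simp
  also have "\<dots> = (\<Sum>k\<in>{0..a - l}. of_nat (a choose l) * (of_nat ((a - l) choose k) * h ^ k * y ^ (a - l - k)))"
  proof (intro sum.cong refl)
    fix k assume "k \<in> {0..a - l}"
    then have "(a choose (k + l)) * ((k + l) choose l) = (a choose l) * ((a - l) choose k)"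
      using choose_mult[of l "k + l" a] True by simp
    then have e: "of_nat (a choose (k + l)) * of_nat ((k + l) choose l) =
        (of_nat (a choose l) * of_nat ((a - l) choose k) :: 'a)"
      by (metis of_nat_mult)
    have "a - (k + l) = a - l - k" by simp
    then have "of_nat (a choose (k + l)) * y ^ (a - (k + l)) * (of_nat ((k + l) choose l) * h ^ k) =
      of_nat (a choose (k + l)) * of_nat ((k + l) choose l) * h ^ k * y ^ (a - l - k)" by simp
    then show "of_nat (a choose (k + l)) * y ^ (a - (k + l)) * (of_nat ((k + l) choose l) * h ^ k) =
      of_nat (a choose l) * (of_nat ((a - l) choose k) * h ^ k * y ^ (a - l - k))" by (simp add: e mult_ac)
  qed
  also have "\<dots> = of_nat (a choose l) * (y + h) ^ (a - l)"
    by (simp add: add.commute[of y h] binomial_ring atLeast0AtMost flip: sum_distrib_left)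
  finally show ?thesis .
qed

text \<open>The one-variable identity \<open>binomial_taylor\<close> is multiplied over all
  coordinates; the product of sums becomes a sum over the box.\<close>

lemma taylor_shift:
  "taylor d N c (\<lambda>j. y j + h j) L =
    (\<Sum>I\<in>exp_box d N. taylor d N c y I * (\<Prod>j\<le>d. of_nat (I j choose L j) * h j ^ (I j - L j)))"
proof -
  let ?g = "\<lambda>\<alpha> j i. of_nat (\<alpha> j choose i) * y j ^ (\<alpha> j - i) * (of_nat (i choose L j) * h j ^ (i - L j))"
  have "(\<Sum>I\<in>exp_box d N. taylor d N c y I * (\<Prod>j\<le>d. of_nat (I j choose L j) * h j ^ (I j - L j))) =
    (\<Sum>I\<in>exp_box d N. \<Sum>\<alpha>\<in>exp_box d N. c \<alpha> * (\<Prod>j\<le>d. ?g \<alpha> j (I j)))"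
    by (simp only: taylor_def sum_distrib_right mult.assoc prod.distrib[symmetric])
  also have "\<dots> = (\<Sum>\<alpha>\<in>exp_box d N. c \<alpha> * (\<Sum>I\<in>exp_box d N. \<Prod>j\<le>d. ?g \<alpha> j (I j)))"
    by (subst sum.swap) (simp only: sum_distrib_left)
  also have "\<dots> = (\<Sum>\<alpha>\<in>exp_box d N. c \<alpha> * (\<Prod>j\<le>d. \<Sum>i\<le>N. ?g \<alpha> j i))"
    unfolding exp_box_def by (subst prod_sum_PiE) auto
  also have "\<dots> = (\<Sum>\<alpha>\<in>exp_box d N. c \<alpha> * (\<Prod>j\<le>d. of_nat (\<alpha> j choose L j) * (y j + h j) ^ (\<alpha> j - L j)))"
    by (intro sum.cong refl arg_cong2[of _ _ _ _ "(*)"] prod.cong binomial_taylor) (auto intro: exp_box_le)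
  finally show ?thesis by (simp add: taylor_def)
qed

lemma taylor_zero: "taylor d N c y (box_zero d) = (\<Sum>\<alpha>\<in>exp_box d N. c \<alpha> * (\<Prod>j\<le>d. y j ^ \<alpha> j))"
  unfolding taylor_def by (intro sum.cong refl arg_cong2[of _ _ _ _ "(*)"] prod.cong) (auto simp: box_zero_eq)

section \<open>Integer polynomials evaluated at \<open>\<rho>\<close>\<close>

abbreviation int_poly_at :: "real \<Rightarrow> int poly \<Rightarrow> real" where
  "int_poly_at \<rho> u \<equiv> poly (map_poly of_int u) \<rho>"

lemma int_poly_at_add: "int_poly_at \<rho> (p + q) = int_poly_at \<rho> p + int_poly_at \<rho> q"
proof -
  have "map_poly of_int (p + q) = map_poly of_int p + (map_poly of_int q :: real poly)"
    by (rule poly_eqI) (simp add: coeff_map_poly)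
  then show ?thesis by simp
qed

lemma int_poly_at_diff: "int_poly_at \<rho> (p - q) = int_poly_at \<rho> p - int_poly_at \<rho> q"
  using int_poly_at_add[of "p - q" q] by simp

lemma int_poly_at_mult: "int_poly_at \<rho> (p * q) = int_poly_at \<rho> p * int_poly_at \<rho> q"
proof -
  have "map_poly of_int (p * q) = map_poly of_int p * (map_poly of_int q :: real poly)"
    by (rule poly_eqI) (simp add: coeff_map_poly coeff_mult)
  then show ?thesis by simp
qed

lemma int_poly_at_monom: "int_poly_at \<rho> (monom a n) = of_int a * \<rho> ^ n"
  by (simp add: map_poly_monom poly_monom)

lemma int_poly_at_sum: "int_poly_at \<rho> (sum f A) = (\<Sum>i\<in>A. int_poly_at \<rho> (f i))"
  by (induction A rule: infinite_finite_induct) (auto simp: int_poly_at_add)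

lemma int_poly_quotient_in_rational_function_field:
  assumes "int_poly_at \<rho> q \<noteq> 0"
  shows "int_poly_at \<rho> p / int_poly_at \<rho> q \<in> rational_function_field \<rho>"
proof -
  have e: "map_poly real_of_int r = map_poly of_rat (map_poly of_int r :: rat poly)" for r
    by (rule poly_eqI) (simp add: coeff_map_poly)
  show ?thesis using assms unfolding e rational_function_field_def by blast
qed

section \<open>Multiplicative valued difference fields\<close>

locale multiplicative_vdf =
  fixes v :: "'a::field_char_0 \<Rightarrow> real" and \<sigma> :: "'a \<Rightarrow> 'a"
    and res :: "'a \<Rightarrow> 'k::field_char_0" and \<sigma>k :: "'k \<Rightarrow> 'k"
    and \<rho> :: real and t :: "real \<Rightarrow> 'a"
  assumes vdf: "valued_difference_field v \<sigma>"
    and scaling: "scaling_exponent v \<sigma> \<rho>"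
    and nontrivial: "value_group v \<noteq> {0}"
    and complete: "spherically_complete v"
    and residue: "difference_residue_field v \<sigma> res \<sigma>k"
    and acfa: "ACFA \<sigma>k"
    and transcendental: "\<not> algebraic \<rho>"
    and splitting: "compatible_splitting v \<sigma> \<rho> t"
    and module: "\<forall>q\<in>rational_function_field \<rho>. \<forall>\<gamma>\<in>value_group v. q * \<gamma> \<in> value_group v"
begin

lemma \<sigma>_hom: "\<sigma> (x + y) = \<sigma> x + \<sigma> y" "\<sigma> (x * y) = \<sigma> x * \<sigma> y" "\<sigma> 1 = 1" "\<sigma> 0 = 0" "\<sigma> x = 0 \<longleftrightarrow> x = 0"
proof -
  have a: "field_automorphism \<sigma>" using vdf by (simp add: valued_difference_field_def)
  then show add: "\<And>x y. \<sigma> (x + y) = \<sigma> x + \<sigma> y" and "\<sigma> (x * y) = \<sigma> x * \<sigma> y" "\<sigma> 1 = 1"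
    by (auto simp: field_automorphism_def)
  have "\<sigma> 0 + \<sigma> 0 = \<sigma> 0 + 0" using add[of 0 0] by (simp only: add_0_left add_0_right)
  then show "\<sigma> 0 = 0" by (simp only: add_left_cancel)
  moreover have "inj \<sigma>" using a by (auto simp: field_automorphism_def bij_def)
  ultimately show "\<sigma> x = 0 \<longleftrightarrow> x = 0" by (metis injD)
qed

lemma \<sigma>_pow_hom: "(\<sigma> ^^ j) (x + y) = (\<sigma> ^^ j) x + (\<sigma> ^^ j) y" "(\<sigma> ^^ j) (x * y) = (\<sigma> ^^ j) x * (\<sigma> ^^ j) y"
  "(\<sigma> ^^ j) 1 = 1" "(\<sigma> ^^ j) x = 0 \<longleftrightarrow> x = 0"
  by (induction j) (auto simp: \<sigma>_hom)

lemma \<rho>_pos: "0 < \<rho>" using scaling by (simp add: scaling_exponent_def)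

lemma v_mult: "x \<noteq> 0 \<Longrightarrow> y \<noteq> 0 \<Longrightarrow> v (x * y) = v x + v y"
  using vdf by (auto simp: valued_difference_field_def valuation_def)

lemma v_add: "x \<noteq> 0 \<Longrightarrow> y \<noteq> 0 \<Longrightarrow> x + y \<noteq> 0 \<Longrightarrow> min (v x) (v y) \<le> v (x + y)"
  using vdf by (auto simp: valued_difference_field_def valuation_def)

lemma v_one: "v 1 = 0" using v_mult[of 1 1] by simp

lemma v_minus: "v (- x) = v x"
proof (cases "x = 0")
  case False
  have "v (- 1) = 0" using v_mult[of "- 1" "- 1"] v_one by simp
  then show ?thesis using v_mult[of "- 1" x] False by simp
qed simp

lemma v_inverse: "x \<noteq> 0 \<Longrightarrow> v (inverse x) = - v x"
  using v_mult[of x "inverse x"] v_one by simp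

lemma v_power: "x \<noteq> 0 \<Longrightarrow> v (x ^ n) = real n * v x"
  by (induction n) (auto simp: v_one v_mult algebra_simps)

lemma v_prod: "(\<And>i. i \<in> A \<Longrightarrow> f i \<noteq> 0) \<Longrightarrow> v (prod f A) = (\<Sum>i\<in>A. v (f i))"
  by (induction A rule: infinite_finite_induct) (auto simp: v_one v_mult)

lemma v_\<sigma>_pow: "x \<noteq> 0 \<Longrightarrow> v ((\<sigma> ^^ j) x) = \<rho> ^ j * v x"
  by (induction j) (use scaling in \<open>auto simp: scaling_exponent_def \<sigma>_pow_hom\<close>)

lemma value_group_v: "x \<noteq> 0 \<Longrightarrow> v x \<in> value_group v"
  by (auto simp: value_group_def)

lemma value_group_add:
  assumes "g \<in> value_group v" "h \<in> value_group v"
  shows "g + h \<in> value_group v" "- g \<in> value_group v" "g - h \<in> value_group v"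
proof -
  obtain x y where xy: "x \<noteq> 0" "y \<noteq> 0" "g = v x" "h = v y" using assms by (auto simp: value_group_def)
  show "g + h \<in> value_group v" using v_mult[OF xy(1,2)] value_group_v[of "x * y"] xy by simp
  show "- g \<in> value_group v" using v_inverse[OF xy(1)] value_group_v[of "inverse x"] xy by simp
  have "v (x * inverse y) = g - h" using v_mult[of x "inverse y"] v_inverse xy by simp
  then show "g - h \<in> value_group v" using value_group_v[of "x * inverse y"] xy by simp
qed

lemma value_group_zero: "0 \<in> value_group v"
  using value_group_v[of 1] v_one by simp

text \<open>The form in which the module structure enters: slopes are divided by the weights
  \<open>ev I\<close>, and relations between coordinates are solved for one of them.\<close>

lemma value_group_scale:
  "g \<in> value_group v \<Longrightarrow> int_poly_at \<rho> q \<noteq> 0 \<Longrightarrow> int_poly_at \<rho> p / int_poly_at \<rho> q * g \<in> value_group v"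
  using module int_poly_quotient_in_rational_function_field by blast

lemma value_group_int_poly: "g \<in> value_group v \<Longrightarrow> int_poly_at \<rho> p * g \<in> value_group v"
  using value_group_scale[of g 1 p] by (simp add: map_poly_1)

lemma value_group_\<rho>_pow: "g \<in> value_group v \<Longrightarrow> \<rho> ^ j * g \<in> value_group v"
  using value_group_int_poly[of g "monom 1 j"] by (simp add: int_poly_at_monom)

lemma t_nonzero: "g \<in> value_group v \<Longrightarrow> t g \<noteq> 0"
  and v_t: "g \<in> value_group v \<Longrightarrow> v (t g) = g"
  and \<sigma>_t: "g \<in> value_group v \<Longrightarrow> \<sigma> (t g) = t (\<rho> * g)"
  using splitting by (auto simp: compatible_splitting_def)

text \<open>\<open>v 0\<close> is an arbitrary real, so bounds are stated through \<open>vge\<close>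
  and \<open>vgt\<close>, which give zero infinite valuation.\<close>

definition vge :: "'a \<Rightarrow> real \<Rightarrow> bool" where "vge x g \<longleftrightarrow> x = 0 \<or> g \<le> v x"
definition vgt :: "'a \<Rightarrow> real \<Rightarrow> bool" where "vgt x g \<longleftrightarrow> x = 0 \<or> g < v x"

lemma vge_zero: "vge 0 g" and vgt_zero: "vgt 0 g" by (auto simp: vge_def vgt_def)

lemma vge_mono: "vge x g \<Longrightarrow> h \<le> g \<Longrightarrow> vge x h"
  and vge_imp_vgt: "vge x g \<Longrightarrow> h < g \<Longrightarrow> vgt x h"
  by (auto simp: vge_def vgt_def)

lemma vge_self: "vge x (v x)" by (simp add: vge_def)

lemma vge_add: "vge x g \<Longrightarrow> vge y g \<Longrightarrow> vge (x + y) g"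
  using v_add[of x y] by (cases "x = 0"; cases "y = 0"; cases "x + y = 0") (auto simp: vge_def min_le_iff_disj)

lemma vgt_add: "vgt x g \<Longrightarrow> vgt y g \<Longrightarrow> vgt (x + y) g"
  using v_add[of x y] by (cases "x = 0"; cases "y = 0"; cases "x + y = 0") (auto simp: vgt_def min_le_iff_disj)

lemma vge_sum: "(\<And>i. i \<in> A \<Longrightarrow> vge (f i) g) \<Longrightarrow> vge (sum f A) g"
  by (induction A rule: infinite_finite_induct) (auto intro: vge_add vge_zero)

lemma vgt_sum: "(\<And>i. i \<in> A \<Longrightarrow> vgt (f i) g) \<Longrightarrow> vgt (sum f A) g"
  by (induction A rule: infinite_finite_induct) (auto intro: vgt_add vgt_zero)

lemma vge_mult: "vge x g \<Longrightarrow> vge y h \<Longrightarrow> vge (x * y) (g + h)"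
  using v_mult[of x y] by (cases "x = 0"; cases "y = 0") (auto simp: vge_def)

lemma vgt_mult: "vgt x g \<Longrightarrow> vge y h \<Longrightarrow> vgt (x * y) (g + h)"
  using v_mult[of x y] by (cases "x = 0"; cases "y = 0") (auto simp: vge_def vgt_def)

lemma vge_power: "vge x g \<Longrightarrow> vge (x ^ n) (real n * g)"
  by (cases "x = 0"; cases "n = 0") (auto simp: vge_def v_power v_one mult_left_mono)

lemma vge_one: "vge 1 0" by (simp add: vge_def v_one)

lemma vge_prod: "(\<And>i. i \<in> A \<Longrightarrow> vge (f i) (g i)) \<Longrightarrow> vge (prod f A) (sum g A)"
  by (induction A rule: infinite_finite_induct) (simp_all add: vge_mult vge_one)

lemma vge_of_nat: "vge (of_nat n) 0"
proof (induction n)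
  case (Suc n)
  then show ?case using vge_add[of 1 0 "of_nat n"] by (simp add: vge_def v_one)
qed (simp add: vge_zero)

lemma vge_\<sigma>_pow: "vge x g \<Longrightarrow> vge ((\<sigma> ^^ j) x) (\<rho> ^ j * g)"
  using \<rho>_pos by (cases "x = 0") (simp_all add: vge_def \<sigma>_pow_hom v_\<sigma>_pow mult_left_mono)

lemma v_add_dominant:
  assumes "x \<noteq> 0" "vgt y (v x)"
  shows "x + y \<noteq> 0" "v (x + y) = v x"
proof -
  show nz: "x + y \<noteq> 0"
  proof
    assume "x + y = 0"
    then have "y = - x" by (simp add: eq_neg_iff_add_eq_0 add.commute)
    then show False using assms by (auto simp: vgt_def v_minus)
  qed
  show "v (x + y) = v x"
  proof (cases "y = 0")
    case False
    then have y: "v x < v y" using assms by (simp add: vgt_def)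
    have "v x \<le> v (x + y)" using v_add[OF assms(1) False nz] y by simp
    moreover have "min (v (x + y)) (v (- y)) \<le> v x"
      using v_add[of "x + y" "- y"] nz False assms(1) by simp
    ultimately show ?thesis using y by (simp add: v_minus min_def split: if_splits)
  qed simp
qed

lemma res_add: "vge x 0 \<Longrightarrow> vge y 0 \<Longrightarrow> res (x + y) = res x + res y"
  and res_mult: "vge x 0 \<Longrightarrow> vge y 0 \<Longrightarrow> res (x * y) = res x * res y"
  and res_one: "res 1 = 1"
  and res_\<sigma>: "vge x 0 \<Longrightarrow> res (\<sigma> x) = \<sigma>k (res x)"
  using residue by (auto simp: difference_residue_field_def vge_def valuation_ring_def)

lemma res_eq_zero: "vge x 0 \<Longrightarrow> res x = 0 \<longleftrightarrow> vgt x 0"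
proof -
  assume x: "vge x 0"
  have *: "{a \<in> valuation_ring v. res a = 0} = valuation_ideal v"
    using residue by (simp add: difference_residue_field_def)
  have "x \<in> {a \<in> valuation_ring v. res a = 0} \<longleftrightarrow> x \<in> valuation_ideal v" by (simp only: *)
  then show ?thesis using x by (simp add: valuation_ring_def valuation_ideal_def vge_def vgt_def)
qed

lemma res_zero: "res 0 = 0" using res_eq_zero[OF vge_zero] vgt_zero by simp

lemma res_sum: "(\<And>i. i \<in> A \<Longrightarrow> vge (f i) 0) \<Longrightarrow> res (sum f A) = (\<Sum>i\<in>A. res (f i))"
  by (induction A rule: infinite_finite_induct) (auto simp: res_zero res_add vge_sum)

lemma res_prod: "(\<And>i. i \<in> A \<Longrightarrow> vge (f i) 0) \<Longrightarrow> res (prod f A) = (\<Prod>i\<in>A. res (f i))"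
proof (induction A rule: infinite_finite_induct)
  case (insert a A)
  have "vge (prod f A) 0" using vge_prod[of A f "\<lambda>_. 0"] insert.prems by simp
  then show ?case using insert by (simp add: res_mult)
qed (auto simp: res_one)

lemma res_power: "vge x 0 \<Longrightarrow> res (x ^ n) = res x ^ n"
  using res_prod[of "{..<n}" "\<lambda>_. x"] by simp

lemma res_\<sigma>_pow: "vge x 0 \<Longrightarrow> res ((\<sigma> ^^ j) x) = (\<sigma>k ^^ j) (res x)"
proof (induction j)
  case (Suc j)
  have "vge ((\<sigma> ^^ j) x) 0" using vge_\<sigma>_pow[OF Suc.prems, of j] by simp
  then show ?case using Suc by (simp add: res_\<sigma>)
qed simp

lemma res_surj: "\<exists>x. vge x 0 \<and> res x = y"
proof -
  have "y \<in> res ` valuation_ring v" using residue by (simp add: difference_residue_field_def)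
  then show ?thesis by (auto simp: valuation_ring_def vge_def)
qed

text \<open>The two unit coefficients survive in the residue field, so the reduced equation has a
  nonzero root there. Any lift of this root is a unit, and the value of the equation at the lift has
  residue zero.\<close>

lemma residual_root:
  assumes e: "\<And>I. I \<in> exp_box d N \<Longrightarrow> vge (e I) 0"
    and u: "I0 \<in> exp_box d N" "I1 \<in> exp_box d N" "I0 \<noteq> I1" "e I0 \<noteq> 0" "v (e I0) = 0" "e I1 \<noteq> 0" "v (e I1) = 0"
  shows "\<exists>s. s \<noteq> 0 \<and> v s = 0 \<and> vgt (\<Sum>I\<in>exp_box d N. e I * (\<Prod>j\<le>d. (\<sigma> ^^ j) s ^ I j)) 0"
proof -
  define S where "S = {I \<in> exp_box d N. res (e I) \<noteq> 0}"
  have un: "I \<in> S" if "I \<in> exp_box d N" "e I \<noteq> 0" "v (e I) = 0" for I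
    using res_eq_zero[OF e[OF that(1)]] that by (auto simp: S_def vgt_def)
  have "\<exists>x. x \<noteq> 0 \<and> (\<Sum>I\<in>S. res (e I) * (\<Prod>j\<le>d. (\<sigma>k ^^ j) x ^ I j)) = 0"
  proof (rule ACFA_single_equation[OF acfa])
    show "finite S" by (simp add: S_def finite_exp_box)
    show "I0 \<in> S" "I1 \<in> S" "I0 \<noteq> I1" using un u by auto
    show "\<alpha> = \<beta>" if "\<alpha> \<in> S" "\<beta> \<in> S" "\<forall>j\<le>d. \<alpha> j = \<beta> j" for \<alpha> \<beta>
      using that by (intro exp_box_eqI[of \<alpha> d N \<beta>]) (auto simp: S_def)
    show "res (e I) \<noteq> 0" if "I \<in> S" for I using that by (simp add: S_def)
  qed
  then obtain x where x: "x \<noteq> 0" "(\<Sum>I\<in>S. res (e I) * (\<Prod>j\<le>d. (\<sigma>k ^^ j) x ^ I j)) = 0" by blast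
  obtain s where s: "vge s 0" "res s = x" using res_surj by blast
  have s0: "\<not> vgt s 0" using res_eq_zero[OF s(1)] s(2) x(1) by simp
  have sj: "vge ((\<sigma> ^^ j) s ^ n) 0" for j n
    using vge_power[OF vge_\<sigma>_pow[OF s(1)], of j n] by simp
  have sp: "vge (\<Prod>j\<le>d. (\<sigma> ^^ j) s ^ I j) 0" for I
    using vge_prod[of "{..d}" "\<lambda>j. (\<sigma> ^^ j) s ^ I j" "\<lambda>_. 0"] sj by simp
  have eI: "vge (e I * (\<Prod>j\<le>d. (\<sigma> ^^ j) s ^ I j)) 0" if "I \<in> exp_box d N" for I
    using vge_mult[OF e[OF that] sp] by simp
  have pr: "res (\<Prod>j\<le>d. (\<sigma> ^^ j) s ^ I j) = (\<Prod>j\<le>d. (\<sigma>k ^^ j) x ^ I j)" for I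
  proof -
    have "vge ((\<sigma> ^^ j) s) 0" for j using sj[of j 1] by simp
    then show ?thesis by (subst res_prod[OF sj]) (simp add: res_power res_\<sigma>_pow s)
  qed
  have "res (\<Sum>I\<in>exp_box d N. e I * (\<Prod>j\<le>d. (\<sigma> ^^ j) s ^ I j)) =
      (\<Sum>I\<in>exp_box d N. res (e I) * (\<Prod>j\<le>d. (\<sigma>k ^^ j) x ^ I j))"
    by (subst res_sum[OF eI]) (auto simp: res_mult e sp pr)
  also have "\<dots> = (\<Sum>I\<in>S. res (e I) * (\<Prod>j\<le>d. (\<sigma>k ^^ j) x ^ I j))"
    by (intro sum.mono_neutral_right finite_exp_box) (auto simp: S_def)
  finally have "res (\<Sum>I\<in>exp_box d N. e I * (\<Prod>j\<le>d. (\<sigma> ^^ j) s ^ I j)) = 0" using x(2) by simp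
  then have "vgt (\<Sum>I\<in>exp_box d N. e I * (\<Prod>j\<le>d. (\<sigma> ^^ j) s ^ I j)) 0"
    by (rule iffD1[OF res_eq_zero, rotated]) (rule vge_sum, rule eI)
  moreover have "s \<noteq> 0" "v s = 0" using s0 s(1) by (auto simp: vgt_def vge_def)
  ultimately show ?thesis by blast
qed

lemma \<sigma>_pow_t: "g \<in> value_group v \<Longrightarrow> (\<sigma> ^^ j) (t g) = t (\<rho> ^ j * g)"
  by (induction j) (simp_all add: \<sigma>_t value_group_\<rho>_pow mult.assoc)

end

section \<open>Newton iteration for a unit root\<close>

lemma taylor_at_zero:
  assumes "I \<in> exp_box d N"
  shows "taylor d N c (\<lambda>_. 0) I = c I"
proof -
  have "c \<alpha> * (\<Prod>j\<le>d. of_nat (\<alpha> j choose I j) * 0 ^ (\<alpha> j - I j)) = (if \<alpha> = I then c I else 0)"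
    if \<alpha>: "\<alpha> \<in> exp_box d N" for \<alpha>
  proof (cases "\<alpha> = I")
    case False
    then obtain j where j: "j \<le> d" "\<alpha> j \<noteq> I j" using exp_box_eqI[OF \<alpha> assms] by blast
    then have "of_nat (\<alpha> j choose I j) * 0 ^ (\<alpha> j - I j) = (0 :: 'a)"
      by (cases "\<alpha> j < I j") (auto simp: binomial_eq_0)
    then have "(\<Prod>j\<le>d. of_nat (\<alpha> j choose I j) * 0 ^ (\<alpha> j - I j)) = (0 :: 'a)"
      using j(1) by (intro prod_zero) auto
    then show ?thesis using False by simp
  qed simp
  then show ?thesis using assms unfolding taylor_def by (simp add: finite_exp_box)
qed

locale unit_root_problem = multiplicative_vdf v \<sigma> res \<sigma>k \<rho> t
  for v :: "'a::field_char_0 \<Rightarrow> real" and \<sigma> :: "'a \<Rightarrow> 'a"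
    and res :: "'a \<Rightarrow> 'k::field_char_0" and \<sigma>k :: "'k \<Rightarrow> 'k" and \<rho> :: real and t :: "real \<Rightarrow> 'a" +
  fixes d N :: nat and c :: "(nat \<Rightarrow> nat) \<Rightarrow> 'a" and I0 I1 :: "nat \<Rightarrow> nat"
  assumes c_integral: "\<And>\<alpha>. \<alpha> \<in> exp_box d N \<Longrightarrow> vge (c \<alpha>) 0"
    and units: "I0 \<in> exp_box d N" "I1 \<in> exp_box d N" "I0 \<noteq> I1" "c I0 \<noteq> 0" "v (c I0) = 0" "c I1 \<noteq> 0" "v (c I1) = 0"
begin

abbreviation "Bx \<equiv> exp_box d N"
abbreviation "Z \<equiv> box_zero d"

text \<open>The weight of an index: the product of the powers \<open>(\<sigma> ^^ j) h ^ I j\<close>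
  has valuation \<open>ev I * v h\<close> for nonzero \<open>h\<close>.\<close>

definition ev :: "(nat \<Rightarrow> nat) \<Rightarrow> real" where "ev I = (\<Sum>j\<le>d. real (I j) * \<rho> ^ j)"

definition P :: "'a \<Rightarrow> (nat \<Rightarrow> nat) \<Rightarrow> 'a" where "P a = taylor d N c (\<lambda>j. (\<sigma> ^^ j) a)"

definition f :: "'a \<Rightarrow> 'a" where "f a = P a Z"

lemma ev_Z: "ev Z = 0" by (simp add: ev_def box_zero_eq)

lemma ev_pos:
  assumes "I \<in> Bx" "I \<noteq> Z"
  shows "0 < ev I"
proof -
  obtain j where j: "j \<le> d" "I j \<noteq> 0"
    using exp_box_eqI[OF assms(1) box_zero_in] assms(2) by (auto simp: box_zero_eq)
  show ?thesis unfolding ev_def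
    by (rule sum_pos2[of _ j]) (use j \<rho>_pos in auto)
qed

lemma ev_int_poly: "ev I = int_poly_at \<rho> (\<Sum>j\<le>d. monom (int (I j)) j)"
  by (simp add: ev_def int_poly_at_sum int_poly_at_monom)

text \<open>The contribution of the Taylor coefficient with index \<open>I\<close> at a point to the
  coefficient with index \<open>L\<close> at the point shifted by \<open>h\<close>.\<close>

definition term_shift :: "((nat \<Rightarrow> nat) \<Rightarrow> 'a) \<Rightarrow> 'a \<Rightarrow> (nat \<Rightarrow> nat) \<Rightarrow> (nat \<Rightarrow> nat) \<Rightarrow> 'a" where
  "term_shift p h L I = p I * (\<Prod>j\<le>d. of_nat (I j choose L j) * (\<sigma> ^^ j) h ^ (I j - L j))"

lemma P_shift: "P (a + h) L = (\<Sum>I\<in>Bx. term_shift (P a) h L I)"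
  unfolding P_def term_shift_def \<sigma>_pow_hom(1) by (rule taylor_shift)

lemma f_shift: "f (a + h) = (\<Sum>I\<in>Bx. P a I * (\<Prod>j\<le>d. (\<sigma> ^^ j) h ^ I j))"
  unfolding f_def P_shift term_shift_def
  by (intro sum.cong refl arg_cong2[of _ _ _ _ "(*)"] prod.cong) (auto simp: box_zero_eq)

lemma f_eq: "f a = (\<Sum>\<alpha>\<in>Bx. c \<alpha> * (\<Prod>j\<le>d. (\<sigma> ^^ j) a ^ \<alpha> j))"
  unfolding f_def P_def by (rule taylor_zero)

lemma term_shift_self: "term_shift p h L L = p L"
  by (simp add: term_shift_def)

lemma term_shift_eq_0: "j \<le> d \<Longrightarrow> I j < L j \<Longrightarrow> term_shift p h L I = 0"
proof -
  assume j: "j \<le> d" "I j < L j"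
  then have "(\<Prod>j\<le>d. of_nat (I j choose L j) * (\<sigma> ^^ j) h ^ (I j - L j)) = 0"
    by (intro prod_zero bexI[of _ j]) (auto simp: binomial_eq_0)
  then show ?thesis by (simp add: term_shift_def)
qed

lemma term_shift_factor:
  assumes h: "vge h g" and IL: "\<And>j. j \<le> d \<Longrightarrow> L j \<le> I j"
  shows "vge (\<Prod>j\<le>d. of_nat (I j choose L j) * (\<sigma> ^^ j) h ^ (I j - L j)) (ev I * g - ev L * g)"
proof -
  have "vge (of_nat (I j choose L j) * (\<sigma> ^^ j) h ^ (I j - L j)) (0 + real (I j - L j) * (\<rho> ^ j * g))" for j
    by (intro vge_mult vge_of_nat vge_power vge_\<sigma>_pow h)
  then have "vge (\<Prod>j\<le>d. of_nat (I j choose L j) * (\<sigma> ^^ j) h ^ (I j - L j))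
      (\<Sum>j\<le>d. 0 + real (I j - L j) * (\<rho> ^ j * g))"
    by (intro vge_prod)
  also have "(\<Sum>j\<le>d. 0 + real (I j - L j) * (\<rho> ^ j * g)) = (\<Sum>j\<le>d. real (I j) * \<rho> ^ j * g - real (L j) * \<rho> ^ j * g)"
    by (intro sum.cong refl) (simp add: IL of_nat_diff algebra_simps)
  also have "\<dots> = ev I * g - ev L * g" by (simp add: ev_def sum_subtractf sum_distrib_right)
  finally show ?thesis .
qed

text \<open>The powers of \<open>h\<close> contribute \<open>(ev I - ev L) * g\<close>, which turns
  the bound at \<open>I\<close> into the bound at \<open>L\<close>. So the whole family of bounds
  \<open>m - ev I * g\<close> survives shifts by elements of valuation at least
  \<open>g\<close>.\<close>

lemma term_shift_vge:
  assumes "vge h g" "vge (p I) (m - ev I * g)"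
  shows "vge (term_shift p h L I) (m - ev L * g)"
proof (cases "\<exists>j\<le>d. I j < L j")
  case True
  then show ?thesis using term_shift_eq_0 vge_zero by auto
next
  case False
  then have "vge (\<Prod>j\<le>d. of_nat (I j choose L j) * (\<sigma> ^^ j) h ^ (I j - L j)) (ev I * g - ev L * g)"
    by (intro term_shift_factor assms) (auto simp: not_less)
  from vge_mult[OF assms(2) this] show ?thesis by (simp add: term_shift_def)
qed

lemma term_shift_vgt:
  assumes "vge h g" "vgt (p I) (m - ev I * g)"
  shows "vgt (term_shift p h L I) (m - ev L * g)"
proof (cases "\<exists>j\<le>d. I j < L j")
  case True
  then show ?thesis using term_shift_eq_0 vgt_zero by auto
next
  case False
  then have "vge (\<Prod>j\<le>d. of_nat (I j choose L j) * (\<sigma> ^^ j) h ^ (I j - L j)) (ev I * g - ev L * g)"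
    by (intro term_shift_factor assms) (auto simp: not_less)
  from vgt_mult[OF assms(2) this] show ?thesis by (simp add: term_shift_def)
qed

text \<open>The Taylor coefficients that attain the bound survive a shift at an index of maximal degree.\<close>

lemma P_shift_attained:
  assumes h: "vge h g" and all: "\<And>I. I \<in> Bx \<Longrightarrow> vge (P a I) (m - ev I * g)"
    and ex: "\<exists>I\<in>Bx. I \<noteq> Z \<and> P a I \<noteq> 0 \<and> v (P a I) = m - ev I * g"
  shows "\<exists>L\<in>Bx. L \<noteq> Z \<and> P (a + h) L \<noteq> 0 \<and> v (P (a + h) L) = m - ev L * g"
proof -
  define M where "M = {I \<in> Bx. I \<noteq> Z \<and> P a I \<noteq> 0 \<and> v (P a I) = m - ev I * g}"
  define dg where "dg I = (\<Sum>j\<le>d. I j)" for I :: "nat \<Rightarrow> nat"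
  have M: "finite M" "M \<noteq> {}" using ex by (auto simp: M_def finite_exp_box)
  have "Max (dg ` M) \<in> dg ` M" using M by (intro Max_in) auto
  then obtain L where L: "L \<in> M" "dg L = Max (dg ` M)" by auto
  have LM: "dg I \<le> dg L" if "I \<in> M" for I using that M L(2) by (simp add: Max_ge)
  have LB: "L \<in> Bx" "L \<noteq> Z" "P a L \<noteq> 0" "v (P a L) = m - ev L * g" using L(1) by (auto simp: M_def)
  \<comment> \<open>Only indices that are at least \<open>L\<close> in every coordinate contribute.
    Other than \<open>L\<close> itself they have larger total degree, so they do not attain the
    bound.\<close>
  have small: "vgt (term_shift (P a) h L I) (m - ev L * g)" if I: "I \<in> Bx - {L}" for I
  proof (cases "\<exists>j\<le>d. I j < L j")
    case True
    then show ?thesis using term_shift_eq_0 vgt_zero by auto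
  next
    case False
    then have le: "L j \<le> I j" if "j \<le> d" for j using that by (auto simp: not_less)
    obtain j where "j \<le> d" "I j \<noteq> L j" using exp_box_eqI[of I d N L] I LB(1) by blast
    then have "j \<le> d" "L j < I j" using le[of j] by auto
    then have dg: "dg L < dg I" unfolding dg_def using le by (intro sum_strict_mono_ex1) auto
    then have "I \<notin> M" using LM[of I] by auto
    moreover have "I \<noteq> Z" using dg by (auto simp: dg_def box_zero_eq)
    ultimately have "vgt (P a I) (m - ev I * g)" using all[of I] I by (auto simp: M_def vgt_def vge_def)
    then show ?thesis by (rule term_shift_vgt[OF h])
  qed
  have "P (a + h) L = P a L + (\<Sum>I\<in>Bx - {L}. term_shift (P a) h L I)"
    unfolding P_shift using LB(1) by (subst sum.remove[of _ L]) (auto simp: finite_exp_box term_shift_self)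
  moreover have "vgt (\<Sum>I\<in>Bx - {L}. term_shift (P a) h L I) (v (P a L))"
    unfolding LB(4) by (rule vgt_sum) (rule small)
  ultimately have "P (a + h) L \<noteq> 0 \<and> v (P (a + h) L) = m - ev L * g"
    using v_add_dominant[OF LB(3)] LB(4) by simp
  then show ?thesis using LB(1,2) by blast
qed

lemma P_shift_bound:
  assumes "vge h g" "\<And>I. I \<in> Bx \<Longrightarrow> vge (P a I) (m - ev I * g)"
  shows "vge (P (a + h) L) (m - ev L * g)"
  unfolding P_shift by (rule vge_sum, rule term_shift_vge[OF assms(1)], rule assms(2))

text \<open>Shift from the point \<open>0\<close>, where the Taylor coefficients are the
  \<open>c \<alpha>\<close>, with \<open>m = 0\<close> and \<open>g = 0\<close>. Of the two unit
  coefficients at least one has an index other than \<open>Z\<close>.\<close>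

lemma P_integral:
  assumes "vge a 0"
  shows "vge (P a L) 0" "\<exists>L\<in>Bx. L \<noteq> Z \<and> P a L \<noteq> 0 \<and> v (P a L) = 0"
proof -
  have P0: "P 0 I = c I" if "I \<in> Bx" for I
  proof -
    have "(\<sigma> ^^ j) 0 = 0" for j by (simp add: \<sigma>_pow_hom)
    then show ?thesis by (simp add: P_def taylor_at_zero[OF that])
  qed
  have 1: "vge (P 0 I) (0 - ev I * 0)" if "I \<in> Bx" for I using c_integral[OF that] by (simp add: P0[OF that])
  have 2: "\<exists>I\<in>Bx. I \<noteq> Z \<and> P 0 I \<noteq> 0 \<and> v (P 0 I) = 0 - ev I * 0"
  proof (cases "I0 = Z")
    case True
    show ?thesis by (rule bexI[of _ I1]) (use True units in \<open>auto simp: P0\<close>)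
  next
    case False
    show ?thesis by (rule bexI[of _ I0]) (use False units in \<open>auto simp: P0\<close>)
  qed
  show "vge (P a L) 0" using P_shift_bound[OF assms 1, of L] by simp
  show "\<exists>L\<in>Bx. L \<noteq> Z \<and> P a L \<noteq> 0 \<and> v (P a L) = 0" using P_shift_attained[OF assms 1 2] by simp
qed

definition approx :: "'a set" where "approx = {a. a \<noteq> 0 \<and> v a = 0 \<and> vgt (f a) 0}"

text \<open>The valuation that a correction of the approximate root \<open>a\<close> must have.\<close>

definition \<gamma> :: "'a \<Rightarrow> real" where
  "\<gamma> a = Max ((\<lambda>I. (v (f a) - v (P a I)) / ev I) ` {I \<in> Bx. I \<noteq> Z \<and> P a I \<noteq> 0})"

lemma \<gamma>_ge: "I \<in> Bx \<Longrightarrow> I \<noteq> Z \<Longrightarrow> P a I \<noteq> 0 \<Longrightarrow> (v (f a) - v (P a I)) / ev I \<le> \<gamma> a"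
  unfolding \<gamma>_def by (intro Max_ge) (auto simp: finite_exp_box)

text \<open>Each slope solves \<open>v (P a I) + ev I * g = v (f a)\<close> for \<open>g\<close>. At
  the largest slope all terms have valuation at least \<open>v (f a)\<close>, with equality for some
  \<open>I\<close> besides \<open>Z\<close>. It is positive because some higher Taylor coefficient
  is a unit.\<close>

lemma \<gamma>_props:
  assumes a: "a \<in> approx" and nz: "f a \<noteq> 0"
  shows "0 < \<gamma> a" "\<gamma> a \<in> value_group v" "\<And>I. I \<in> Bx \<Longrightarrow> vge (P a I) (v (f a) - ev I * \<gamma> a)"
    "\<exists>I\<in>Bx. I \<noteq> Z \<and> P a I \<noteq> 0 \<and> v (P a I) = v (f a) - ev I * \<gamma> a"
proof -
  have a0: "vge a 0" "0 < v (f a)" using a nz by (auto simp: approx_def vge_def vgt_def)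
  obtain L where L: "L \<in> Bx" "L \<noteq> Z" "P a L \<noteq> 0" "v (P a L) = 0" using P_integral(2)[OF a0(1)] by blast
  have "0 < (v (f a) - v (P a L)) / ev L" using ev_pos[OF L(1,2)] a0 L by simp
  then show "0 < \<gamma> a" using \<gamma>_ge[OF L(1-3)] by linarith
  let ?M = "{I \<in> Bx. I \<noteq> Z \<and> P a I \<noteq> 0}"
  have "\<gamma> a \<in> (\<lambda>I. (v (f a) - v (P a I)) / ev I) ` ?M"
    unfolding \<gamma>_def using L by (intro Max_in) (auto simp: finite_exp_box)
  then obtain I where I: "I \<in> Bx" "I \<noteq> Z" "P a I \<noteq> 0" "\<gamma> a = (v (f a) - v (P a I)) / ev I" by auto
  have "v (P a I) = v (f a) - ev I * \<gamma> a" using ev_pos[OF I(1,2)] I(4) by (simp add: field_simps)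
  then show "\<exists>I\<in>Bx. I \<noteq> Z \<and> P a I \<noteq> 0 \<and> v (P a I) = v (f a) - ev I * \<gamma> a" using I by blast
  have "v (f a) - v (P a I) \<in> value_group v" using nz I(3) by (intro value_group_add value_group_v)
  then have "int_poly_at \<rho> 1 / ev I * (v (f a) - v (P a I)) \<in> value_group v"
    using ev_pos[OF I(1,2)] unfolding ev_int_poly by (intro value_group_scale) auto
  then show "\<gamma> a \<in> value_group v" by (simp add: I(4) map_poly_1)
  show "vge (P a I) (v (f a) - ev I * \<gamma> a)" if "I \<in> Bx" for I
  proof (cases "I = Z \<or> P a I = 0")
    case True
    then show ?thesis using vge_self[of "f a"] by (auto simp: ev_Z f_def vge_zero)
  next
    case False
    then have "(v (f a) - v (P a I)) / ev I \<le> \<gamma> a" using \<gamma>_ge that by blast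
    then show ?thesis using ev_pos[OF that] False by (simp add: vge_def field_simps)
  qed
qed

text \<open>A bound attained at some \<open>L\<close> other than \<open>Z\<close> is still attained
  after the shift, by \<open>P_shift_attained\<close>. This one coefficient already yields the slope
  \<open>\<gamma> a + (v (f (a + h)) - v (f a)) / ev L\<close> at \<open>a + h\<close>.\<close>

lemma approx_shift:
  assumes a: "a \<in> approx" "f a \<noteq> 0" and h: "vge h (\<gamma> a)"
  shows "a + h \<in> approx" "f (a + h) \<noteq> 0 \<Longrightarrow> \<gamma> a \<le> \<gamma> (a + h)"
    "f (a + h) \<noteq> 0 \<Longrightarrow> vgt (f (a + h)) (v (f a)) \<Longrightarrow> \<gamma> a < \<gamma> (a + h)"
proof -
  note g = \<gamma>_props[OF a]
  have fa: "vge (f (a + h)) (v (f a))"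
    using P_shift_bound[OF h g(3), of Z] by (simp add: f_def ev_Z)
  have a0: "a \<noteq> 0" "v a = 0" "0 < v (f a)" using a by (auto simp: approx_def vgt_def)
  have "vgt h (v a)" using vge_imp_vgt[OF h g(1)] a0 by simp
  then have "a + h \<noteq> 0" "v (a + h) = 0" using v_add_dominant[OF a0(1)] a0(2) by auto
  then show "a + h \<in> approx" using vge_imp_vgt[OF fa a0(3)] by (simp add: approx_def)
  assume nz: "f (a + h) \<noteq> 0"
  obtain L where L: "L \<in> Bx" "L \<noteq> Z" "P (a + h) L \<noteq> 0" "v (P (a + h) L) = v (f a) - ev L * \<gamma> a"
    using P_shift_attained[OF h g(3,4)] by blast
  have ge: "(v (f (a + h)) - (v (f a) - ev L * \<gamma> a)) / ev L \<le> \<gamma> (a + h)"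
    using \<gamma>_ge[OF L(1-3)] L(4) by simp
  have eL: "0 < ev L" by (rule ev_pos[OF L(1,2)])
  have eq: "(v (f (a + h)) - (v (f a) - ev L * \<gamma> a)) / ev L = (v (f (a + h)) - v (f a)) / ev L + \<gamma> a"
    using eL by (simp add: field_simps)
  have "0 \<le> (v (f (a + h)) - v (f a)) / ev L" using fa nz eL by (simp add: vge_def)
  then show "\<gamma> a \<le> \<gamma> (a + h)" using ge eq by linarith
  assume "vgt (f (a + h)) (v (f a))"
  then have "0 < (v (f (a + h)) - v (f a)) / ev L" using nz eL by (simp add: vgt_def)
  then show "\<gamma> a < \<gamma> (a + h)" using ge eq by linarith
qed

text \<open>With \<open>h = t (\<gamma> a) * s\<close> and division by \<open>t (v (f a))\<close>,
  the expansion of \<open>f (a + h)\<close> becomes an integral equation in \<open>s\<close> in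
  which the constant coefficient and one more are units. A residual root \<open>s\<close> cancels
  the leading parts.\<close>

lemma newton_step:
  assumes a: "a \<in> approx" "f a \<noteq> 0"
  shows "\<exists>h. h \<noteq> 0 \<and> v h = \<gamma> a \<and> vgt (f (a + h)) (v (f a))"
proof -
  note g = \<gamma>_props[OF a]
  let ?m = "v (f a)"
  have m: "?m \<in> value_group v" by (rule value_group_v[OF a(2)])
  \<comment> \<open>\<open>T I\<close> is what the factor \<open>t (\<gamma> a)\<close> of
    \<open>h\<close> contributes to the term with index \<open>I\<close>.\<close>
  define T where "T I = (\<Prod>j\<le>d. t (\<rho> ^ j * \<gamma> a) ^ I j)" for I
  define e where "e I = inverse (t ?m) * (P a I * T I)" for I
  have tj: "t (\<rho> ^ j * \<gamma> a) \<noteq> 0" "v (t (\<rho> ^ j * \<gamma> a)) = \<rho> ^ j * \<gamma> a" for j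
    using t_nonzero v_t value_group_\<rho>_pow[OF g(2)] by auto
  have T: "T I \<noteq> 0" "v (T I) = ev I * \<gamma> a" for I
  proof -
    show "T I \<noteq> 0" using tj by (simp add: T_def)
    have "v (T I) = (\<Sum>j\<le>d. v (t (\<rho> ^ j * \<gamma> a) ^ I j))"
      unfolding T_def by (rule v_prod) (use tj in auto)
    then show "v (T I) = ev I * \<gamma> a" using tj by (simp add: v_power ev_def sum_distrib_right mult.assoc)
  qed
  have tm: "t ?m \<noteq> 0" "v (inverse (t ?m)) = - ?m" using t_nonzero[OF m] v_t[OF m] v_inverse by auto
  have ve: "v (e I) = - ?m + (v (P a I) + ev I * \<gamma> a)" if "P a I \<noteq> 0" for I
    using that tm T by (simp add: e_def v_mult)
  obtain I where I: "I \<in> Bx" "I \<noteq> Z" "P a I \<noteq> 0" "v (P a I) = ?m - ev I * \<gamma> a" using g(4) by blast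
  have "\<exists>s. s \<noteq> 0 \<and> v s = 0 \<and> vgt (\<Sum>I\<in>Bx. e I * (\<Prod>j\<le>d. (\<sigma> ^^ j) s ^ I j)) 0"
  proof (rule residual_root)
    show "vge (e J) 0" if "J \<in> Bx" for J
      using g(3)[OF that] ve[of J] by (cases "P a J = 0") (auto simp: vge_def e_def)
    show "Z \<in> Bx" "I \<in> Bx" "Z \<noteq> I" using I box_zero_in by auto
    have PZ: "P a Z \<noteq> 0" "v (P a Z) = ?m" using a(2) by (simp_all add: f_def)
    show "e Z \<noteq> 0" "e I \<noteq> 0" using PZ I(3) tm T by (auto simp: e_def)
    show "v (e Z) = 0" "v (e I) = 0" using ve[OF PZ(1)] ve[OF I(3)] PZ I by (auto simp: ev_Z)
  qed
  then obtain s where s: "s \<noteq> 0" "v s = 0" "vgt (\<Sum>I\<in>Bx. e I * (\<Prod>j\<le>d. (\<sigma> ^^ j) s ^ I j)) 0" by blast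
  define h where "h = t (\<gamma> a) * s"
  have tg: "t (\<gamma> a) \<noteq> 0" "v (t (\<gamma> a)) = \<gamma> a" using t_nonzero[OF g(2)] v_t[OF g(2)] by auto
  have h: "h \<noteq> 0" "v h = \<gamma> a" using tg s by (simp_all add: h_def v_mult)
  have "(\<sigma> ^^ j) h = t (\<rho> ^ j * \<gamma> a) * (\<sigma> ^^ j) s" for j
    by (simp add: h_def \<sigma>_pow_hom \<sigma>_pow_t[OF g(2)])
  then have "P a I * (\<Prod>j\<le>d. (\<sigma> ^^ j) h ^ I j) = t ?m * (e I * (\<Prod>j\<le>d. (\<sigma> ^^ j) s ^ I j))" for I
    using tm(1) by (simp add: e_def T_def power_mult_distrib prod.distrib)
  then have "f (a + h) = t ?m * (\<Sum>I\<in>Bx. e I * (\<Prod>j\<le>d. (\<sigma> ^^ j) s ^ I j))"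
    by (simp only: f_shift sum_distrib_left)
  moreover have "vgt ((\<Sum>I\<in>Bx. e I * (\<Prod>j\<le>d. (\<sigma> ^^ j) s ^ I j)) * t ?m) (0 + ?m)"
    using vge_self[of "t ?m"] v_t[OF m] by (intro vgt_mult s) simp
  ultimately have "vgt (f (a + h)) ?m" by (simp add: mult_ac)
  then show ?thesis using h by blast
qed

text \<open>If there were no root, every approximate root \<open>a\<close> would carry a ball of
  radius \<open>\<gamma> a\<close> consisting of approximate roots. A point common to a maximal
  chain of these balls admits one more Newton step, which leads to a smaller ball avoiding that
  point.\<close>

theorem unit_root: "\<exists>s. s \<noteq> 0 \<and> v s = 0 \<and> (\<Sum>\<alpha>\<in>Bx. c \<alpha> * (\<Prod>j\<le>d. (\<sigma> ^^ j) s ^ \<alpha> j)) = 0"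
proof (rule ccontr)
  assume no: "\<not> ?thesis"
  then have nz: "f a \<noteq> 0" if "a \<in> approx" for a using that by (auto simp: f_eq approx_def)
  define ball where "ball a = {x. vge (x - a) (\<gamma> a)}" for a
  have ball_shift: "x \<in> approx" "\<gamma> a \<le> \<gamma> x" if "a \<in> approx" "x \<in> ball a" for a x
  proof -
    have "vge (x - a) (\<gamma> a)" using that(2) by (simp add: ball_def)
    from approx_shift[OF that(1) nz[OF that(1)] this] nz
    show "x \<in> approx" "\<gamma> a \<le> \<gamma> x" by simp_all
  qed
  have ball_mono: "ball x \<subseteq> ball a" if "a \<in> approx" "x \<in> ball a" for a x
  proof
    fix y assume "y \<in> ball x"
    then have "vge (y - x) (\<gamma> a)" using ball_shift(2)[OF that] vge_mono by (auto simp: ball_def)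
    moreover have "vge (x - a) (\<gamma> a)" using that(2) by (simp add: ball_def)
    ultimately have "vge ((y - x) + (x - a)) (\<gamma> a)" by (rule vge_add)
    then show "y \<in> ball a" by (simp add: ball_def)
  qed
  obtain \<C> where C: "subset.maxchain (ball ` approx) \<C>" using subset.Hausdorff by blast
  then have Csub: "\<C> \<subseteq> ball ` approx" and Cch: "\<And>B B'. B \<in> \<C> \<Longrightarrow> B' \<in> \<C> \<Longrightarrow> B \<subseteq> B' \<or> B' \<subseteq> B"
    by (auto simp: subset.maxchain_def subset.chain_def)
  \<comment> \<open>A ball below every member of the chain could be added to it, so by maximality it
    belongs to the chain already.\<close>
  have Cmax: "B \<in> \<C>" if "B \<in> ball ` approx" "\<And>B'. B' \<in> \<C> \<Longrightarrow> B \<subseteq> B'" for B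
  proof (rule ccontr)
    assume "B \<notin> \<C>"
    have "subset.chain (ball ` approx) (insert B \<C>)"
      using that Csub Cch unfolding subset.chain_def by blast
    then show False using C \<open>B \<notin> \<C>\<close> unfolding subset.maxchain_def by blast
  qed
  obtain a0 where a0: "a0 \<in> approx"
  proof -
    obtain s where "s \<noteq> 0 \<and> v s = 0 \<and> vgt (\<Sum>I\<in>Bx. c I * (\<Prod>j\<le>d. (\<sigma> ^^ j) s ^ I j)) 0"
      using residual_root[OF c_integral units] by blast
    then have "s \<in> approx" by (simp add: approx_def f_eq)
    then show thesis by (rule that)
  qed
  have "\<C> \<noteq> {}" using Cmax[of "ball a0"] a0 by auto
  have "valuation_ball v (ball a)" if "a \<in> approx" for a
    unfolding valuation_ball_def
    by (rule exI[of _ a], rule bexI[of _ "\<gamma> a"])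
      (use \<gamma>_props(2)[OF that nz[OF that]] in \<open>auto simp: ball_def vge_def\<close>)
  then have "\<forall>B\<in>\<C>. valuation_ball v B" using Csub by auto
  then have "\<Inter>\<C> \<noteq> {}" using complete Cch unfolding spherically_complete_def by blast
  then obtain b where b: "\<And>B. B \<in> \<C> \<Longrightarrow> b \<in> B" by blast
  have bC: "b \<in> approx \<and> ball b \<subseteq> B" if BC: "B \<in> \<C>" for B
  proof -
    obtain a where a: "a \<in> approx" "B = ball a" using Csub BC by blast
    then show ?thesis using ball_shift(1)[OF a(1)] ball_mono[OF a(1)] b[OF BC] by blast
  qed
  then have bA: "b \<in> approx" using \<open>\<C> \<noteq> {}\<close> by blast
  obtain h where h: "h \<noteq> 0" "v h = \<gamma> b" "vgt (f (b + h)) (v (f b))"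
    using newton_step[OF bA nz[OF bA]] by blast
  have vh: "vge h (\<gamma> b)" using h by (simp add: vge_def)
  have bh: "b + h \<in> approx" by (rule approx_shift(1)[OF bA nz[OF bA] vh])
  have lt: "\<gamma> b < \<gamma> (b + h)" by (rule approx_shift(3)[OF bA nz[OF bA] vh nz[OF bh] h(3)])
  \<comment> \<open>The new ball lies below the whole chain, so it is a member and contains
    \<open>b\<close>; but \<open>b\<close> has distance \<open>v h = \<gamma> b\<close> from the
    centre, less than the radius \<open>\<gamma> (b + h)\<close>.\<close>
  have "ball (b + h) \<subseteq> ball b" by (rule ball_mono[OF bA]) (use vh in \<open>simp add: ball_def\<close>)
  then have "ball (b + h) \<in> \<C>" using bC bh by (intro Cmax) blast+
  then have "b \<in> ball (b + h)" by (rule b)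
  then have "vge (- h) (\<gamma> (b + h))" by (simp add: ball_def)
  then show False using h lt by (simp add: vge_def v_minus)
qed

end

section \<open>Tropical hypersurfaces\<close>

context multiplicative_vdf
begin

lemma v_powi: "x \<noteq> 0 \<Longrightarrow> v (x powi k) = of_int k * v x"
  by (cases "k \<ge> 0") (simp_all add: power_int_def v_power v_inverse)

lemma monomial_eval_extend:
  fixes u :: "int poly ^ 'n::finite" and y :: "'a ^ 'n"
  assumes "\<And>i. degree (u $ i) < D"
  shows "monomial_eval \<sigma> u y = (\<Prod>i\<in>UNIV. \<Prod>j<D. (\<sigma> ^^ j) (y $ i) powi coeff (u $ i) j)"
  unfolding monomial_eval_def
  by (intro prod.cong refl prod.mono_neutral_left) (use assms in \<open>auto simp: coeff_eq_0 intro: le_less_trans\<close>)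

lemma exponent_at_inner:
  fixes u :: "int poly ^ 'n::finite" and w :: "real ^ 'n"
  shows "exponent_at \<rho> u \<bullet> w = (\<Sum>i\<in>UNIV. int_poly_at \<rho> (u $ i) * w $ i)"
  by (simp add: exponent_at_def inner_vec_def)

lemma int_poly_at_altdef: "degree p < D \<Longrightarrow> int_poly_at \<rho> p = (\<Sum>j<D. of_int (coeff p j) * \<rho> ^ j)"
proof -
  assume D: "degree p < D"
  have "degree (map_poly real_of_int p) \<le> degree p"
    by (rule degree_le) (simp add: coeff_map_poly coeff_eq_0)
  with D have "degree (map_poly real_of_int p) < D" by linarith
  then have "poly (map_poly real_of_int p) \<rho> = (\<Sum>j<D. coeff (map_poly real_of_int p) j * \<rho> ^ j)"
    unfolding poly_altdef by (intro sum.mono_neutral_left) (auto simp: coeff_eq_0)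
  then show ?thesis by (simp add: coeff_map_poly)
qed

lemma v_monomial_eval:
  fixes u :: "int poly ^ 'n::finite" and y :: "'a ^ 'n"
  assumes y: "\<And>i. y $ i \<noteq> 0"
  shows "monomial_eval \<sigma> u y \<noteq> 0" "v (monomial_eval \<sigma> u y) = exponent_at \<rho> u \<bullet> (\<chi> i. v (y $ i))"
proof -
  have nz: "(\<sigma> ^^ j) (y $ i) powi k \<noteq> 0" for i j k using y by (simp add: \<sigma>_pow_hom)
  then show "monomial_eval \<sigma> u y \<noteq> 0" unfolding monomial_eval_def by simp
  have inner: "v (\<Prod>j\<le>degree (u $ i). (\<sigma> ^^ j) (y $ i) powi coeff (u $ i) j) = int_poly_at \<rho> (u $ i) * v (y $ i)" for i
  proof -
    have "v (\<Prod>j\<le>degree (u $ i). (\<sigma> ^^ j) (y $ i) powi coeff (u $ i) j) =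
        (\<Sum>j\<le>degree (u $ i). v ((\<sigma> ^^ j) (y $ i) powi coeff (u $ i) j))"
      by (rule v_prod) (rule nz)
    also have "\<dots> = (\<Sum>j\<le>degree (u $ i). of_int (coeff (u $ i) j) * \<rho> ^ j * v (y $ i))"
      using y by (intro sum.cong refl) (simp add: v_powi \<sigma>_pow_hom v_\<sigma>_pow)
    also have "\<dots> = int_poly_at \<rho> (u $ i) * v (y $ i)"
      by (simp add: int_poly_at_altdef[of "u $ i" "Suc (degree (u $ i))"] lessThan_Suc_atMost sum_distrib_right)
    finally show ?thesis .
  qed
  have "v (monomial_eval \<sigma> u y) =
      (\<Sum>i\<in>UNIV. v (\<Prod>j\<le>degree (u $ i). (\<sigma> ^^ j) (y $ i) powi coeff (u $ i) j))"
    unfolding monomial_eval_def by (rule v_prod) (simp add: y \<sigma>_pow_hom)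
  then show "v (monomial_eval \<sigma> u y) = exponent_at \<rho> u \<bullet> (\<chi> i. v (y $ i))"
    by (simp add: inner exponent_at_inner)
qed

lemma trop_term_eq:
  fixes f :: "('a, 'n::finite) laurent_diff_poly" and w :: "real ^ 'n"
  shows "trop_term v \<rho> f w u = v (Poly_Mapping.lookup f u) + (\<Sum>i\<in>UNIV. int_poly_at \<rho> (u $ i) * w $ i)"
  by (simp add: trop_term_def exponent_at_inner)

lemma trop_le: "u \<in> Poly_Mapping.keys f \<Longrightarrow> trop v \<rho> f w \<le> trop_term v \<rho> f w u"
  unfolding trop_def by (intro Min_le) auto

lemma trop_attained: "f \<noteq> 0 \<Longrightarrow> \<exists>u\<in>Poly_Mapping.keys f. trop_term v \<rho> f w u = trop v \<rho> f w"
proof -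
  assume "f \<noteq> 0"
  then have "trop v \<rho> f w \<in> trop_term v \<rho> f w ` Poly_Mapping.keys f"
    unfolding trop_def by (intro Min_in) auto
  then show ?thesis by auto
qed

lemma trop_eqI:
  "u \<in> Poly_Mapping.keys f \<Longrightarrow> (\<And>u'. u' \<in> Poly_Mapping.keys f \<Longrightarrow> trop_term v \<rho> f w u \<le> trop_term v \<rho> f w u') \<Longrightarrow>
    trop v \<rho> f w = trop_term v \<rho> f w u"
  unfolding trop_def by (intro Min_eqI) auto

text \<open>If a single term attained the minimum, it would dominate the sum of the others, and the
  value of \<open>f\<close> could not be zero.\<close>

lemma zero_in_trop_hypersurface:
  fixes f :: "('a, 'n::finite) laurent_diff_poly" and y :: "'a ^ 'n"
  assumes "y \<in> zero_set \<sigma> f"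
  shows "(\<chi> i. v (y $ i)) \<in> trop_hypersurface v \<rho> f"
proof (cases "f = 0")
  case False
  let ?w = "\<chi> i. v (y $ i)" and ?K = "Poly_Mapping.keys f"
  let ?T = "\<lambda>u. Poly_Mapping.lookup f u * monomial_eval \<sigma> u y"
  have y: "y $ i \<noteq> 0" for i using assms by (simp add: zero_set_def)
  have T: "?T u \<noteq> 0" "v (?T u) = trop_term v \<rho> f ?w u" if "u \<in> ?K" for u
    using that v_monomial_eval[of y u, OF y] by (auto simp: in_keys_iff v_mult trop_term_def)
  obtain u where u: "u \<in> ?K" "trop_term v \<rho> f ?w u = trop v \<rho> f ?w" using trop_attained[OF False] by blast
  have "\<exists>u'\<in>?K. u \<noteq> u' \<and> trop_term v \<rho> f ?w u' = trop v \<rho> f ?w"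
  proof (rule ccontr)
    assume no: "\<not> ?thesis"
    have big: "vgt (?T u') (v (?T u))" if "u' \<in> ?K - {u}" for u'
    proof -
      have "trop v \<rho> f ?w < trop_term v \<rho> f ?w u'" using no that trop_le[of u' f ?w] by force
      then show ?thesis using T that u by (simp add: vgt_def)
    qed
    have "vgt (\<Sum>u'\<in>?K - {u}. ?T u') (v (?T u))" by (rule vgt_sum) (rule big)
    then have "?T u + (\<Sum>u'\<in>?K - {u}. ?T u') \<noteq> 0" using v_add_dominant(1) T(1)[OF u(1)] by blast
    moreover have "?T u + (\<Sum>u'\<in>?K - {u}. ?T u') = laurent_eval \<sigma> f y"
      unfolding laurent_eval_def using u(1) by (simp add: sum.remove)
    ultimately show False using assms by (simp add: zero_set_def)
  qed
  then show ?thesis using u unfolding trop_hypersurface_def by blast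
qed (simp add: trop_hypersurface_def)

lemma continuous_trop_term:
  fixes f :: "('a, 'n::finite) laurent_diff_poly"
  shows "continuous_on UNIV (\<lambda>w. trop_term v \<rho> f w u)"
  unfolding trop_term_def by (intro continuous_intros)

text \<open>For nonzero \<open>f\<close> it is a finite union, over pairs of distinct exponents, of
  sets cut out by equalities and weak inequalities between continuous functions.\<close>

lemma closed_trop_hypersurface:
  fixes f :: "('a, 'n::finite) laurent_diff_poly"
  shows "closed (trop_hypersurface v \<rho> f)"
proof (cases "f = 0")
  case False
  let ?K = "Poly_Mapping.keys f"
  define C where "C = (\<lambda>(u, u'). {w. trop_term v \<rho> f w u = trop_term v \<rho> f w u' \<and>
    (\<forall>u''\<in>?K. trop_term v \<rho> f w u \<le> trop_term v \<rho> f w u'')})"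
  have "trop_hypersurface v \<rho> f = (\<Union>q\<in>{(u, u'). u \<in> ?K \<and> u' \<in> ?K \<and> u \<noteq> u'}. C q)"
  proof (intro equalityI subsetI)
    fix w assume "w \<in> trop_hypersurface v \<rho> f"
    then obtain u u' where u: "u \<in> ?K" "u' \<in> ?K" "u \<noteq> u'" "trop_term v \<rho> f w u = trop v \<rho> f w"
      "trop_term v \<rho> f w u' = trop v \<rho> f w" using False by (auto simp: trop_hypersurface_def)
    then have "w \<in> C (u, u')" using trop_le by (auto simp: C_def)
    then show "w \<in> (\<Union>q\<in>{(u, u'). u \<in> ?K \<and> u' \<in> ?K \<and> u \<noteq> u'}. C q)" using u by blast
  next
    fix w assume "w \<in> (\<Union>q\<in>{(u, u'). u \<in> ?K \<and> u' \<in> ?K \<and> u \<noteq> u'}. C q)"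
    then obtain u u' where u: "u \<in> ?K" "u' \<in> ?K" "u \<noteq> u'" "w \<in> C (u, u')" by blast
    then have "trop v \<rho> f w = trop_term v \<rho> f w u" by (intro trop_eqI) (auto simp: C_def)
    then show "w \<in> trop_hypersurface v \<rho> f"
      using u unfolding trop_hypersurface_def C_def by auto
  qed
  moreover have "finite {(u, u'). u \<in> ?K \<and> u' \<in> ?K \<and> u \<noteq> u'}"
    by (rule finite_subset[of _ "?K \<times> ?K"]) auto
  moreover have "closed (C q)" for q
  proof -
    have "C q = {w. trop_term v \<rho> f w (fst q) = trop_term v \<rho> f w (snd q)} \<inter>
        (\<Inter>u''\<in>?K. {w. trop_term v \<rho> f w (fst q) \<le> trop_term v \<rho> f w u''})"
      by (auto simp: C_def split: prod.splits)
    also have "closed \<dots>"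
      by (intro closed_Int closed_INT ballI closed_Collect_eq closed_Collect_le continuous_trop_term)
    finally show ?thesis .
  qed
  ultimately show ?thesis by (auto intro: closed_UN)
qed (simp add: trop_hypersurface_def)

text \<open>The value group contains all rational multiples of some positive element. Nontriviality
  is essential: for the trivial valuation the closure of \<open>A\<close> has at most one
  point.\<close>

lemma value_group_dense:
  assumes "0 < \<epsilon>"
  shows "\<exists>g\<in>value_group v. \<bar>g - x\<bar> < \<epsilon>"
proof -
  obtain g0 where g0: "g0 \<in> value_group v" "g0 \<noteq> 0" using nontrivial value_group_zero by blast
  then obtain g where g: "g \<in> value_group v" "0 < g"
    using value_group_add(2)[OF g0(1) g0(1)] by (cases "g0 > 0") (auto simp: not_less order_le_less)
  obtain r where r: "r \<in> \<rat>" "(x - \<epsilon>) / g < r" "r < (x + \<epsilon>) / g"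
    using Rats_dense_in_real[of "(x - \<epsilon>) / g" "(x + \<epsilon>) / g"] assms g(2) by (auto simp: divide_strict_right_mono)
  obtain a b :: int where ab: "r = of_int a / of_int b" "b \<noteq> 0" using r(1) by (auto elim!: Rats_cases')
  have "int_poly_at \<rho> [:a:] / int_poly_at \<rho> [:b:] * g \<in> value_group v"
    using ab g by (intro value_group_scale) (simp_all add: map_poly_pCons)
  then have "r * g \<in> value_group v" by (simp add: ab map_poly_pCons)
  moreover have "\<bar>r * g - x\<bar> < \<epsilon>" using r g by (simp add: field_simps abs_less_iff)
  ultimately show ?thesis by blast
qed

section \<open>Approximation by points with coordinates in the value group\<close>

text \<open>Induction on the number of coordinates: the last coordinate is either determined by the others through
  a relation modulo the value group, or it is free to move.\<close>

lemma relation_preserving_approximation: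
  fixes w :: "'i \<Rightarrow> real"
  assumes "finite I" "0 < \<epsilon>"
  shows "\<exists>w'. (\<forall>i\<in>I. w' i \<in> value_group v \<and> \<bar>w' i - w i\<bar> < \<epsilon>) \<and>
    (\<forall>a. (\<Sum>i\<in>I. int_poly_at \<rho> (a i) * w i) \<in> value_group v \<longrightarrow>
      (\<Sum>i\<in>I. int_poly_at \<rho> (a i) * w' i) = (\<Sum>i\<in>I. int_poly_at \<rho> (a i) * w i))"
  using assms
proof (induction I arbitrary: \<epsilon> rule: finite_induct)
  case (insert k I)
  let ?e = "int_poly_at \<rho>"
  let ?S = "\<lambda>a w. \<Sum>i\<in>I. ?e (a i) * w i"
  show ?case
  proof (cases "\<exists>a. ?e (a k) \<noteq> 0 \<and> ?e (a k) * w k + ?S a w \<in> value_group v")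
    case True
    then obtain a where a: "?e (a k) \<noteq> 0" "?e (a k) * w k + ?S a w \<in> value_group v" by blast
    define g where "g = ?e (a k) * w k + ?S a w"
    \<comment> \<open>With accuracy \<open>\<epsilon> / B\<close> in the other coordinates, solving
      for coordinate \<open>k\<close> gives an error of at most
      \<open>(B - 1) * (\<epsilon> / B)\<close>, which is below \<open>\<epsilon>\<close>.\<close>
    define B where "B = 1 + (\<Sum>i\<in>I. \<bar>?e (a i)\<bar>) / \<bar>?e (a k)\<bar>"
    have B: "1 \<le> B" unfolding B_def by (simp add: sum_nonneg)
    have "0 < \<epsilon> / B" using insert.prems B by simp
    from insert.IH[OF this] obtain w1 where w1: "\<And>i. i \<in> I \<Longrightarrow> w1 i \<in> value_group v"
      "\<And>i. i \<in> I \<Longrightarrow> \<bar>w1 i - w i\<bar> < \<epsilon> / B" "\<And>a. ?S a w \<in> value_group v \<Longrightarrow> ?S a w1 = ?S a w" by blast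
    have eB: "\<epsilon> / B \<le> \<epsilon>" using B insert.prems by (simp add: field_simps)
    define w' where "w' = w1(k := (g - ?S a w1) / ?e (a k))"
    have w'I: "w' i = w1 i" if "i \<in> I" for i using that insert.hyps by (auto simp: w'_def)
    have SI: "?S b w' = ?S b w1" for b by (intro sum.cong) (auto simp: w'I)
    have rel: "?e (a k) * w' k + ?S a w' = g" using a(1) unfolding SI by (simp add: w'_def)
    have "?S a w1 \<in> value_group v"
    proof -
      have "sum (\<lambda>i. ?e (a i) * w1 i) J \<in> value_group v" if "finite J" "J \<subseteq> I" for J
        using that by (induction J rule: finite_induct)
          (auto intro!: value_group_add value_group_int_poly w1 simp: value_group_zero)
      then show ?thesis using insert.hyps by blast
    qed
    then have "?e 1 / ?e (a k) * (g - ?S a w1) \<in> value_group v"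
      using a by (intro value_group_scale value_group_add) (auto simp: g_def)
    then have kG: "w' k \<in> value_group v" by (simp add: w'_def map_poly_1)
    have "?e (a k) * (w' k - w k) = ?S a w - ?S a w'" using rel by (simp add: g_def algebra_simps)
    also have "\<dots> = (\<Sum>i\<in>I. ?e (a i) * (w i - w1 i))"
      unfolding SI by (simp add: right_diff_distrib sum_subtractf)
    finally have "\<bar>?e (a k)\<bar> * \<bar>w' k - w k\<bar> = \<bar>\<Sum>i\<in>I. ?e (a i) * (w i - w1 i)\<bar>" by (metis abs_mult)
    also have "\<dots> \<le> (\<Sum>i\<in>I. \<bar>?e (a i)\<bar> * (\<epsilon> / B))"
    proof (rule order_trans[OF sum_abs], rule sum_mono)
      fix i assume "i \<in> I"
      then have "\<bar>w i - w1 i\<bar> \<le> \<epsilon> / B" using w1(2)[of i] by (simp add: abs_minus_commute)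
      then show "\<bar>?e (a i) * (w i - w1 i)\<bar> \<le> \<bar>?e (a i)\<bar> * (\<epsilon> / B)" unfolding abs_mult by (rule mult_left_mono) simp
    qed
    also have "\<dots> = \<bar>?e (a k)\<bar> * ((B - 1) * (\<epsilon> / B))" 
    proof -
      have "(\<Sum>i\<in>I. \<bar>?e (a i)\<bar>) = \<bar>?e (a k)\<bar> * (B - 1)" using a(1) by (simp add: B_def)
      then show ?thesis by (simp only: sum_distrib_right[symmetric] mult.assoc)
    qed
    finally have le: "\<bar>?e (a k)\<bar> * \<bar>w' k - w k\<bar> \<le> \<bar>?e (a k)\<bar> * ((B - 1) * (\<epsilon> / B))" .
    have "\<bar>w' k - w k\<bar> \<le> (B - 1) * (\<epsilon> / B)"
      by (rule mult_left_le_imp_le[OF le]) (use a(1) in simp)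
    also have "\<dots> < \<epsilon>" using B insert.prems by (simp add: field_simps)
    finally have kd: "\<bar>w' k - w k\<bar> < \<epsilon>" .
    have "?e (b k) * w' k + ?S b w' = ?e (b k) * w k + ?S b w"
      if b: "?e (b k) * w k + ?S b w \<in> value_group v" for b
    proof -
      \<comment> \<open>Eliminates coordinate \<open>k\<close> between the relations
        \<open>a\<close> and \<open>b\<close>, so that the induction hypothesis applies to the
        result.\<close>
      define c where "c i = a k * b i - b k * a i" for i
      have Sc: "?S c z = ?e (a k) * ?S b z - ?e (b k) * ?S a z" for z
        unfolding c_def int_poly_at_diff int_poly_at_mult
        by (simp add: sum_distrib_left sum_subtractf algebra_simps)
      have "?S c w = ?e (a k) * (?e (b k) * w k + ?S b w) - ?e (b k) * g"
        unfolding Sc by (simp add: g_def algebra_simps)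
      also have "\<dots> \<in> value_group v" 
        by (rule value_group_add(3); rule value_group_int_poly) (use a b in \<open>simp_all add: g_def\<close>)
      finally have "?S c w' = ?S c w" unfolding SI by (rule w1(3))
      then have "?e (a k) * (?e (b k) * w' k + ?S b w') - ?e (b k) * (?e (a k) * w' k + ?S a w') =
          ?e (a k) * (?e (b k) * w k + ?S b w) - ?e (b k) * (?e (a k) * w k + ?S a w)"
        unfolding Sc by (simp add: algebra_simps)
      then have "?e (a k) * (?e (b k) * w' k + ?S b w') = ?e (a k) * (?e (b k) * w k + ?S b w)"
        unfolding rel by (simp add: g_def)
      then show ?thesis using a(1) by simp
    qed
    moreover have "w' i \<in> value_group v \<and> \<bar>w' i - w i\<bar> < \<epsilon>" if "i \<in> insert k I" for i
    proof (cases "i = k")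
      case False
      then show ?thesis using that w'I w1(1,2)[of i] eB by fastforce
    qed (use kG kd in auto)
    ultimately show ?thesis using insert.hyps by (intro exI[of _ w'] conjI ballI allI impI) auto
  next
    case False
    obtain w1 where w1: "\<And>i. i \<in> I \<Longrightarrow> w1 i \<in> value_group v \<and> \<bar>w1 i - w i\<bar> < \<epsilon>"
      "\<And>a. ?S a w \<in> value_group v \<Longrightarrow> ?S a w1 = ?S a w" using insert.IH[OF insert.prems] by blast
    obtain g where g: "g \<in> value_group v" "\<bar>g - w k\<bar> < \<epsilon>" using value_group_dense[OF insert.prems] by blast
    define w' where "w' = w1(k := g)"
    have w'I: "w' i = w1 i" if "i \<in> I" for i using that insert.hyps by (auto simp: w'_def)
    have SI: "?S b w' = ?S b w1" for b by (intro sum.cong) (auto simp: w'I)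
    have "?e (b k) * w' k + ?S b w' = ?e (b k) * w k + ?S b w"
      if b: "?e (b k) * w k + ?S b w \<in> value_group v" for b
    proof -
      \<comment> \<open>No relation modulo the value group involves coordinate \<open>k\<close>, so
        any nearby \<open>g\<close> may be used for it.\<close>
      have "?e (b k) = 0" using False b by blast
      then show ?thesis using b w1(2)[of b] unfolding SI by simp
    qed
    moreover have "w' i \<in> value_group v \<and> \<bar>w' i - w i\<bar> < \<epsilon>" if "i \<in> insert k I" for i
      using that w'I w1(1)[of i] g by (cases "i = k") (auto simp: w'_def)
    ultimately show ?thesis using insert.hyps by (intro exI[of _ w'] conjI ballI allI impI) auto
  qed
qed auto

text \<open>Strict inequalities between terms persist near \<open>w\<close>. A tie is a relation
  whose value is a difference of coefficient valuations, hence in the value group, and such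
  relations are preserved. So the order of the terms does not change.\<close>

lemma trop_hypersurface_approximation:
  fixes f :: "('a, 'n::finite) laurent_diff_poly" and w :: "real ^ 'n"
  assumes w: "w \<in> trop_hypersurface v \<rho> f" and "0 < \<epsilon>"
  shows "\<exists>w'\<in>trop_hypersurface v \<rho> f. (\<forall>i. w' $ i \<in> value_group v) \<and> dist w' w < \<epsilon>"
proof -
  let ?K = "Poly_Mapping.keys f"
  let ?tt = "\<lambda>w u. trop_term v \<rho> f w u"
  define Op where "Op = (\<Inter>q\<in>{(u, u') \<in> ?K \<times> ?K. ?tt w u < ?tt w u'}. {x. ?tt x (fst q) < ?tt x (snd q)})"
  have "open Op"
    unfolding Op_def
  proof (intro open_INT ballI open_Collect_less continuous_trop_term)
    show "finite {(u, u') \<in> ?K \<times> ?K. ?tt w u < ?tt w u'}" by (rule finite_subset[of _ "?K \<times> ?K"]) auto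
  qed
  moreover have "w \<in> Op" by (auto simp: Op_def)
  ultimately obtain \<delta> where \<delta>: "0 < \<delta>" "ball w \<delta> \<subseteq> Op" by (auto simp: open_contains_ball)
  \<comment> \<open>The distance is bounded by the sum of the coordinate errors, hence the division
    by the dimension.\<close>
  define \<eta> where "\<eta> = min \<epsilon> \<delta> / real CARD('n)"
  have "0 < \<eta>" using \<delta> assms(2) by (simp add: \<eta>_def)
  from relation_preserving_approximation[OF finite_class.finite_UNIV this, of "\<lambda>i. w $ i"] obtain x where
    x: "\<And>i. x i \<in> value_group v" "\<And>i. \<bar>x i - w $ i\<bar> < \<eta>"
      "\<And>a. (\<Sum>i\<in>UNIV. int_poly_at \<rho> (a i) * w $ i) \<in> value_group v \<Longrightarrow>
        (\<Sum>i\<in>UNIV. int_poly_at \<rho> (a i) * x i) = (\<Sum>i\<in>UNIV. int_poly_at \<rho> (a i) * w $ i)"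
    by blast
  define w' :: "real ^ 'n" where "w' = (\<chi> i. x i)"
  have "dist w' w \<le> (\<Sum>i\<in>UNIV. \<bar>(w' - w) $ i\<bar>)" unfolding dist_norm by (rule norm_le_l1_cart)
  also have "\<dots> < (\<Sum>i\<in>(UNIV :: 'n set). \<eta>)" using x(2) by (intro sum_strict_mono) (auto simp: w'_def)
  also have "\<dots> = min \<epsilon> \<delta>" by (simp add: \<eta>_def)
  finally have d: "dist w' w < \<epsilon>" "w' \<in> ball w \<delta>" by (auto simp: dist_commute)
  then have lt: "?tt w' u < ?tt w' u'" if "u \<in> ?K" "u' \<in> ?K" "?tt w u < ?tt w u'" for u u'
    using \<delta>(2) that unfolding Op_def by force
  have eq: "?tt w' u = ?tt w' u'" if u: "u \<in> ?K" "u' \<in> ?K" "?tt w u = ?tt w u'" for u u'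
  proof -
    have df: "(\<Sum>i\<in>UNIV. int_poly_at \<rho> (u $ i - u' $ i) * z i) =
        (\<Sum>i\<in>UNIV. int_poly_at \<rho> (u $ i) * z i) - (\<Sum>i\<in>UNIV. int_poly_at \<rho> (u' $ i) * z i)" for z
      unfolding int_poly_at_diff by (simp add: left_diff_distrib sum_subtractf)
    have vd: "v (Poly_Mapping.lookup f u') - v (Poly_Mapping.lookup f u) \<in> value_group v"
      using u by (intro value_group_add value_group_v) (auto simp: in_keys_iff)
    have e: "(\<Sum>i\<in>UNIV. int_poly_at \<rho> (u $ i - u' $ i) * w $ i) =
        v (Poly_Mapping.lookup f u') - v (Poly_Mapping.lookup f u)"
      using u(3) unfolding df trop_term_eq by simp
    have "(\<Sum>i\<in>UNIV. int_poly_at \<rho> (u $ i - u' $ i) * x i) = (\<Sum>i\<in>UNIV. int_poly_at \<rho> (u $ i - u' $ i) * w $ i)"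
      by (rule x(3)) (use e vd in simp)
    then show ?thesis unfolding e df trop_term_eq w'_def by simp
  qed
  have "w' \<in> trop_hypersurface v \<rho> f"
  proof (cases "f = 0")
    case False
    then obtain u u' where u: "u \<in> ?K" "u' \<in> ?K" "u \<noteq> u'" "?tt w u = trop v \<rho> f w" "?tt w u' = trop v \<rho> f w"
      using w by (auto simp: trop_hypersurface_def)
    have "?tt w' u \<le> ?tt w' u''" if "u'' \<in> ?K" for u''
      using eq[OF u(1) that] lt[OF u(1) that] trop_le[OF that, of w] u(4) by (cases "?tt w u = ?tt w u''") auto
    then have "trop v \<rho> f w' = ?tt w' u" by (intro trop_eqI u)
    moreover have "?tt w' u = ?tt w' u'" using u by (intro eq) auto
    ultimately show ?thesis using u unfolding trop_hypersurface_def by auto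
  qed (simp add: trop_hypersurface_def)
  then show ?thesis using d(1) x(1) by (intro bexI[of _ w']) (auto simp: w'_def)
qed

section \<open>Lifting a point over the value group to a zero\<close>

text \<open>Substituting \<open>y\<^sub>i = t\<^bsup>w\<^sub>i\<^esup> \<sigma>\<^bsup>D e\<^sub>i\<^esup>(s)\<close> with \<open>D\<close> larger than all orders and distinct \<open>e\<^sub>i\<close> reduces
  to one variable \<open>s\<close> of valuation \<open>0\<close> without merging any two exponents.\<close>

lemma value_group_point_lifts:
  fixes f :: "('a, 'n::finite) laurent_diff_poly" and w :: "real ^ 'n"
  assumes w: "w \<in> trop_hypersurface v \<rho> f" and G: "\<And>i. w $ i \<in> value_group v"
  shows "\<exists>y\<in>zero_set \<sigma> f. \<forall>i. v (y $ i) = w $ i"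
proof (cases "f = 0")
  case True
  have "(\<chi> i. t (w $ i)) \<in> zero_set \<sigma> f" using True t_nonzero[OF G] by (simp add: zero_set_def laurent_eval_def)
  then show ?thesis by (rule bexI[rotated]) (simp add: v_t[OF G])
next
  case False
  let ?K = "Poly_Mapping.keys f"
  obtain u0 u1 where u01: "u0 \<in> ?K" "u1 \<in> ?K" "u0 \<noteq> u1" "trop_term v \<rho> f w u0 = trop v \<rho> f w"
    "trop_term v \<rho> f w u1 = trop v \<rho> f w" using w False by (auto simp: trop_hypersurface_def)
  obtain e :: "'n \<Rightarrow> nat" where e: "inj e"
    using finite_imp_inj_to_nat_seg[OF finite_class.finite_UNIV] by blast
  define D where "D = Suc (Max ((\<lambda>(u, i). degree (u $ i)) ` (?K \<times> UNIV)))"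
  have D: "degree (u $ i) < D" if "u \<in> ?K" for u :: "int poly ^ 'n" and i
  proof -
    have "degree (u $ i) \<le> Max ((\<lambda>(u, i). degree (u $ i)) ` (?K \<times> UNIV))"
      using that by (intro Max_ge) (auto intro!: image_eqI[of _ _ "(u, i)"])
    then show ?thesis by (simp add: D_def)
  qed
  define J where "J = (UNIV :: 'n set) \<times> {..<D}"
  \<comment> \<open>The conjugate of index \<open>j\<close> of \<open>y $ i\<close> involves
    \<open>s\<close> through \<open>\<sigma> ^^ (j + D * e i)\<close>. As \<open>j < D\<close>,
    remainder and quotient modulo \<open>D\<close> recover the pair.\<close>
  define pos where "pos q = snd q + D * e (fst q)" for q
  have J: "finite J" "J \<noteq> {}" by (auto simp: J_def D_def)
  have pos_inj: "inj_on pos J"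
  proof (rule inj_onI)
    fix q q' assume q: "q \<in> J" "q' \<in> J" "pos q = pos q'"
    then have lt: "snd q < D" "snd q' < D" by (auto simp: J_def)
    have "pos q mod D = snd q" "pos q div D = e (fst q)" "pos q' mod D = snd q'" "pos q' div D = e (fst q')"
      using lt by (simp_all add: pos_def)
    then have "snd q = snd q'" "e (fst q) = e (fst q')" using q(3) by simp_all
    then show "q = q'" using injD[OF e] by (simp add: prod_eq_iff)
  qed
  define d where "d = Max (pos ` J)"
  have pos_le: "pos q \<le> d" if "q \<in> J" for q using that J by (simp add: d_def)
  \<comment> \<open>\<open>E u k\<close> is the exponent of \<open>(\<sigma> ^^ k) s\<close> in the
    monomial \<open>u\<close> after the substitution.\<close>
  define E where "E u k = (if k \<in> pos ` J then coeff (u $ fst (the_inv_into J pos k)) (snd (the_inv_into J pos k)) else 0)"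
    for u :: "int poly ^ 'n" and k
  have E_pos: "E u (pos q) = coeff (u $ fst q) (snd q)" if "q \<in> J" for u q
    using that by (simp add: E_def the_inv_into_f_f[OF pos_inj])
  \<comment> \<open>Adding \<open>Mx\<close> to every exponent makes all of them natural numbers up
    to \<open>2 * Mx\<close>; the equation is only multiplied by a nonzero monomial in the
    conjugates of \<open>s\<close>.\<close>
  define Mx where "Mx = nat (Max ((\<lambda>(u, k). \<bar>E u k\<bar>) ` (?K \<times> {..d})))"
  have Mx: "\<bar>E u k\<bar> \<le> int Mx" if "u \<in> ?K" "k \<le> d" for u k
  proof -
    have "\<bar>E u k\<bar> \<le> Max ((\<lambda>(u, k). \<bar>E u k\<bar>) ` (?K \<times> {..d}))"
      using that by (intro Max_ge) (auto intro!: image_eqI[of _ _ "(u, k)"])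
    then show ?thesis unfolding Mx_def by linarith
  qed
  define \<alpha> where "\<alpha> u = (\<lambda>k\<in>{..d}. nat (E u k + int Mx))" for u
  have \<alpha>_int: "int (\<alpha> u k) = E u k + int Mx" if "u \<in> ?K" "k \<le> d" for u k
    using Mx[OF that] that by (simp add: \<alpha>_def)
  have \<alpha>_box: "\<alpha> u \<in> exp_box d (2 * Mx)" if "u \<in> ?K" for u
    unfolding exp_box_def
  proof (rule PiE_I)
    fix k assume "k \<in> {..d}"
    then show "\<alpha> u k \<in> {..2 * Mx}" using \<alpha>_int[OF that, of k] Mx[OF that, of k] by simp
  qed (simp add: \<alpha>_def)
  have \<alpha>_inj: "inj_on \<alpha> ?K"
  proof (rule inj_onI)
    fix u u' assume u: "u \<in> ?K" "u' \<in> ?K" "\<alpha> u = \<alpha> u'"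
    have "coeff (u $ i) j = coeff (u' $ i) j" for i j
    proof (cases "j < D")
      case True
      then have q: "(i, j) \<in> J" by (simp add: J_def)
      have "E u (pos (i, j)) = E u' (pos (i, j))"
        using \<alpha>_int[OF u(1) pos_le[OF q]] \<alpha>_int[OF u(2) pos_le[OF q]] u(3) by simp
      then show ?thesis by (simp add: E_pos[OF q])
    next
      case False
      then show ?thesis using D[OF u(1), of i] D[OF u(2), of i] by (simp add: coeff_eq_0)
    qed
    then show "u = u'" by (simp add: vec_eq_iff poly_eq_iff)
  qed
  define yt :: "'a ^ 'n" where "yt = (\<chi> i. t (w $ i))"
  have yt: "yt $ i \<noteq> 0" "v (yt $ i) = w $ i" for i using t_nonzero[OF G] v_t[OF G] by (simp_all add: yt_def)
  define T where "T u = monomial_eval \<sigma> u yt" for u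
  have T: "T u \<noteq> 0" "v (T u) = exponent_at \<rho> u \<bullet> w" for u
  proof -
    have "(\<chi> i. v (yt $ i)) = w" by (simp add: vec_eq_iff yt)
    then show "T u \<noteq> 0" "v (T u) = exponent_at \<rho> u \<bullet> w" using v_monomial_eval[of yt u, OF yt(1)] by (simp_all add: T_def)
  qed
  have vT: "Poly_Mapping.lookup f u * T u \<noteq> 0 \<and> v (Poly_Mapping.lookup f u * T u) = trop_term v \<rho> f w u"
    if "u \<in> ?K" for u using that T[of u] by (simp add: in_keys_iff v_mult trop_term_def)
  let ?\<tau> = "trop v \<rho> f w"
  have \<tau>: "?\<tau> \<in> value_group v"
    using vT[OF u01(1)] u01(4) value_group_v[of "Poly_Mapping.lookup f u0 * T u0"] by simp
  have t\<tau>: "t ?\<tau> \<noteq> 0" "v (inverse (t ?\<tau>)) = - ?\<tau>" using t_nonzero[OF \<tau>] v_t[OF \<tau>] v_inverse by auto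
  \<comment> \<open>Dividing by an element whose valuation is the minimum makes all coefficients
    integral and those of the tied terms units.\<close>
  define C where "C u = inverse (t ?\<tau>) * (Poly_Mapping.lookup f u * T u)" for u
  have C: "C u \<noteq> 0 \<and> v (C u) = trop_term v \<rho> f w u - ?\<tau>" if "u \<in> ?K" for u
    using vT[OF that] t\<tau> v_mult[of "inverse (t ?\<tau>)" "Poly_Mapping.lookup f u * T u"] by (simp add: C_def)
  define c where "c \<beta> = (if \<beta> \<in> \<alpha> ` ?K then C (the_inv_into ?K \<alpha> \<beta>) else 0)" for \<beta>
  have c\<alpha>: "c (\<alpha> u) = C u" if "u \<in> ?K" for u using that by (simp add: c_def the_inv_into_f_f[OF \<alpha>_inj])
  interpret U: unit_root_problem v \<sigma> res \<sigma>k \<rho> t d "2 * Mx" c "\<alpha> u0" "\<alpha> u1"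
  proof unfold_locales
    fix \<beta> assume "\<beta> \<in> exp_box d (2 * Mx)"
    show "vge (c \<beta>) 0"
    proof (cases "\<beta> \<in> \<alpha> ` ?K")
      case True
      then obtain u where u: "u \<in> ?K" "\<beta> = \<alpha> u" by blast
      then show ?thesis using C[OF u(1)] trop_le[OF u(1), of w] by (simp add: c\<alpha> vge_def)
    qed (simp add: c_def vge_zero)
  next
    show "\<alpha> u0 \<noteq> \<alpha> u1" using inj_onD[OF \<alpha>_inj _ u01(1,2)] u01(3) by blast
  qed (use \<alpha>_box C c\<alpha> u01 in auto)
  obtain s where s: "s \<noteq> 0" "v s = 0" "(\<Sum>\<beta>\<in>exp_box d (2 * Mx). c \<beta> * (\<Prod>k\<le>d. (\<sigma> ^^ k) s ^ \<beta> k)) = 0"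
    using U.unit_root by blast
  let ?x = "\<lambda>k. (\<sigma> ^^ k) s"
  have x0: "?x k \<noteq> 0" for k using s(1) by (simp add: \<sigma>_pow_hom)
  define y :: "'a ^ 'n" where "y = (\<chi> i. t (w $ i) * ?x (D * e i))"
  have y: "y $ i \<noteq> 0" "v (y $ i) = w $ i" for i
    using t_nonzero[OF G, of i] v_t[OF G, of i] x0[of "D * e i"] s by (simp_all add: y_def v_mult v_\<sigma>_pow)
  have mon: "monomial_eval \<sigma> u y = T u * (\<Prod>k\<le>d. ?x k powi E u k)" if u: "u \<in> ?K" for u
  proof -
    have yi: "(\<sigma> ^^ j) (y $ i) = (\<sigma> ^^ j) (yt $ i) * ?x (pos (i, j))" for i j
      by (simp add: y_def yt_def \<sigma>_pow_hom pos_def funpow_add)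
    have "monomial_eval \<sigma> u y = T u * (\<Prod>i\<in>UNIV. \<Prod>j<D. ?x (pos (i, j)) powi coeff (u $ i) j)"
      unfolding T_def monomial_eval_extend[of u D, OF D[OF u]] yi power_int_mult_distrib prod.distrib ..
    also have "(\<Prod>i\<in>UNIV. \<Prod>j<D. ?x (pos (i, j)) powi coeff (u $ i) j) =
        (\<Prod>q\<in>J. ?x (pos q) powi coeff (u $ fst q) (snd q))"
      by (simp add: J_def prod.cartesian_product split_beta')
    also have "\<dots> = (\<Prod>q\<in>J. ?x (pos q) powi E u (pos q))" by (rule prod.cong) (simp_all add: E_pos)
    also have "\<dots> = (\<Prod>k\<in>pos ` J. ?x k powi E u k)" by (simp add: prod.reindex[OF pos_inj])
    also have "\<dots> = (\<Prod>k\<le>d. ?x k powi E u k)"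
      by (rule prod.mono_neutral_left) (auto simp: pos_le E_def)
    finally show ?thesis .
  qed
  have pw: "(\<Prod>k\<le>d. ?x k ^ \<alpha> u k) = (\<Prod>k\<le>d. ?x k powi E u k) * (\<Prod>k\<le>d. ?x k ^ Mx)" if u: "u \<in> ?K" for u
  proof -
    have "?x k ^ \<alpha> u k = ?x k powi E u k * ?x k ^ Mx" if "k \<le> d" for k
    proof -
      have "?x k ^ \<alpha> u k = ?x k powi (int (\<alpha> u k))" by simp
      also have "\<dots> = ?x k powi E u k * ?x k powi (int Mx)"
        unfolding \<alpha>_int[OF u that] using x0[of k] by (simp add: power_int_add)
      finally show ?thesis by simp
    qed
    then show ?thesis by (simp add: prod.distrib flip: prod.distrib)
  qed
  have "0 = (\<Sum>\<beta>\<in>\<alpha> ` ?K. c \<beta> * (\<Prod>k\<le>d. ?x k ^ \<beta> k))"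
    unfolding s(3)[symmetric] using \<alpha>_box
    by (intro sum.mono_neutral_right finite_exp_box) (auto simp: c_def)
  also have "\<dots> = (\<Sum>u\<in>?K. C u * (\<Prod>k\<le>d. ?x k ^ \<alpha> u k))"
    by (simp add: sum.reindex[OF \<alpha>_inj] c\<alpha>)
  also have "\<dots> = (\<Sum>u\<in>?K. inverse (t ?\<tau>) * (\<Prod>k\<le>d. ?x k ^ Mx) * (Poly_Mapping.lookup f u * monomial_eval \<sigma> u y))"
    by (intro sum.cong refl) (simp only: pw mon C_def mult_ac)
  also have "\<dots> = inverse (t ?\<tau>) * (\<Prod>k\<le>d. ?x k ^ Mx) * laurent_eval \<sigma> f y"
    by (simp only: laurent_eval_def sum_distrib_left)
  finally have "laurent_eval \<sigma> f y = 0" using t\<tau>(1) x0 by auto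
  then have "y \<in> zero_set \<sigma> f" using y by (simp add: zero_set_def)
  then show ?thesis using y(2) by blast
qed

lemma trop_hypersurface_eq_closure:
  fixes f :: "('a, 'n::finite) laurent_diff_poly"
  shows "trop_hypersurface v \<rho> f = closure {(\<chi> i. v (y $ i)) | y. y \<in> zero_set \<sigma> f}"
proof
  show "closure {(\<chi> i. v (y $ i)) | y. y \<in> zero_set \<sigma> f} \<subseteq> trop_hypersurface v \<rho> f"
    by (rule closure_minimal[OF _ closed_trop_hypersurface]) (use zero_in_trop_hypersurface in blast)
  show "trop_hypersurface v \<rho> f \<subseteq> closure {(\<chi> i. v (y $ i)) | y. y \<in> zero_set \<sigma> f}"
  proof
    fix w assume w: "w \<in> trop_hypersurface v \<rho> f"
    show "w \<in> closure {(\<chi> i. v (y $ i)) | y. y \<in> zero_set \<sigma> f}"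
      unfolding closure_approachable
    proof (intro allI impI)
      fix \<epsilon> :: real assume "0 < \<epsilon>"
      then obtain w' :: "real ^ 'n" where w': "w' \<in> trop_hypersurface v \<rho> f" "\<And>i. w' $ i \<in> value_group v" "dist w' w < \<epsilon>"
        using trop_hypersurface_approximation[OF w] by blast
      obtain y :: "'a ^ 'n" where y: "y \<in> zero_set \<sigma> f" "\<And>i. v (y $ i) = w' $ i"
        using value_group_point_lifts[OF w'(1,2)] by blast
      have "(\<chi> i. v (y $ i)) = w'" by (simp add: vec_eq_iff y(2))
      then show "\<exists>z\<in>{(\<chi> i. v (y $ i)) | y. y \<in> zero_set \<sigma> f}. dist z w < \<epsilon>" using y(1) w'(3) by blast
    qed
  qed
qed

text \<open>The residues \<open>r u\<close> are nonzero, so the exponents of the initial form are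
  exactly those attaining the minimum. For \<open>f = 0\<close> the initial form is zero, which does
  not count as a monomial.\<close>

lemma trop_hypersurface_iff_initial_form:
  fixes f :: "('a, 'n::finite) laurent_diff_poly"
  shows "w \<in> trop_hypersurface v \<rho> f \<longleftrightarrow> \<not> is_monomial (initial_form v \<rho> t res f w)"
proof -
  let ?K = "Poly_Mapping.keys f"
  define r where "r u = res (Poly_Mapping.lookup f u * t (- v (Poly_Mapping.lookup f u)))" for u
  define Ties where "Ties = {u. u \<in> ?K \<and> trop_term v \<rho> f w u = trop v \<rho> f w}"
  have fin: "finite Ties" unfolding Ties_def by simp
  have r: "r u \<noteq> 0" if "u \<in> ?K" for u
  proof -
    let ?a = "Poly_Mapping.lookup f u"
    have a: "?a \<noteq> 0" using that by (simp add: in_keys_iff)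
    have g: "- v ?a \<in> value_group v" using value_group_v[OF a] value_group_add(2) by blast
    have "?a * t (- v ?a) \<noteq> 0" "v (?a * t (- v ?a)) = 0"
      using a t_nonzero[OF g] v_t[OF g] by (simp_all add: v_mult)
    then show ?thesis using res_eq_zero[of "?a * t (- v ?a)"] by (simp add: r_def vge_def vgt_def)
  qed
  have I: "initial_form v \<rho> t res f w = (\<Sum>u\<in>Ties. Poly_Mapping.single u (r u))"
    by (simp add: initial_form_def Ties_def r_def)
  have l: "Poly_Mapping.lookup (initial_form v \<rho> t res f w) u = (if u \<in> Ties then r u else 0)" for u
    unfolding I by (simp add: lookup_sum lookup_single when_def fin)
  show ?thesis
  proof
    assume w: "w \<in> trop_hypersurface v \<rho> f"
    show "\<not> is_monomial (initial_form v \<rho> t res f w)"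
    proof
      assume "is_monomial (initial_form v \<rho> t res f w)"
      then obtain c u where cu: "c \<noteq> 0" "initial_form v \<rho> t res f w = Poly_Mapping.single u c"
        by (auto simp: is_monomial_def)
      have k: "u' = u" if "u' \<in> Ties" for u'
      proof (rule ccontr)
        assume "u' \<noteq> u"
        then have "Poly_Mapping.lookup (initial_form v \<rho> t res f w) u' = 0" by (simp add: cu(2) lookup_single)
        then show False using l[of u'] that r[of u'] by (simp add: Ties_def)
      qed
      have "Poly_Mapping.lookup (initial_form v \<rho> t res f w) u \<noteq> 0" using cu by (simp add: lookup_single)
      then have "u \<in> Ties" using l[of u] by (simp split: if_splits)
      then have "f \<noteq> 0" by (auto simp: Ties_def)
      then show False using w k unfolding trop_hypersurface_def Ties_def by blast
    qed
  next
    assume nm: "\<not> is_monomial (initial_form v \<rho> t res f w)"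
    show "w \<in> trop_hypersurface v \<rho> f"
    proof (cases "f = 0")
      case False
      then obtain u where u: "u \<in> Ties" using trop_attained by (auto simp: Ties_def)
      have "\<exists>u'\<in>Ties. u' \<noteq> u"
      proof (rule ccontr)
        assume "\<not> ?thesis"
        then have "Ties = {u}" using u by blast
        then have "initial_form v \<rho> t res f w = Poly_Mapping.single u (r u)" by (simp add: I)
        then show False using nm r[of u] u unfolding is_monomial_def Ties_def by blast
      qed
      then show ?thesis using u unfolding trop_hypersurface_def Ties_def by blast
    qed (simp add: trop_hypersurface_def)
  qed
qed

end

theorem theorem1p2:
  fixes v :: "'a::field_char_0 \<Rightarrow> real" and \<sigma> :: "'a \<Rightarrow> 'a"
    and res :: "'a \<Rightarrow> 'k::field_char_0" and \<sigma>k :: "'k \<Rightarrow> 'k"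
    and \<rho> :: real and t :: "real \<Rightarrow> 'a"
    and f :: "('a, 'n::finite) laurent_diff_poly"
  assumes "valued_difference_field v \<sigma>"
    and "scaling_exponent v \<sigma> \<rho>"
    and "value_group v \<noteq> {0}"
    and "spherically_complete v"
    and "difference_residue_field v \<sigma> res \<sigma>k"
    and "ACFA \<sigma>k"
    and "\<not> algebraic \<rho>"
    and "compatible_splitting v \<sigma> \<rho> t"
    and "\<forall>q\<in>rational_function_field \<rho>. \<forall>\<gamma>\<in>value_group v. q * \<gamma> \<in> value_group v"
  shows "trop_hypersurface v \<rho> f = {w. \<not> is_monomial (initial_form v \<rho> t res f w)} \<and>
    trop_hypersurface v \<rho> f = closure {(\<chi> i. v (y $ i)) | y. y \<in> zero_set \<sigma> f}"
proof -
  interpret multiplicative_vdf v \<sigma> res \<sigma>k \<rho> t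
    using assms by unfold_locales
  show ?thesis
    using trop_hypersurface_iff_initial_form[of _ f] trop_hypersurface_eq_closure[of f] by blast
qed

end
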